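(* Let $\Gamma$ be a countable group, let $P\subset\mathbb{R}$ be a closed subset such that the action of $\mathbb{R}$ on the hull $\Omega_P$ is free and uniquely ergodic, and let $\varphi:\Gamma\to\mathbb{R}$ be a quasimorphism with $\varphi(e)=0$ which is not at bounded distance from a homomorphism $\Gamma\to\mathbb{R}$. Let $p$ be a symmetric probability measure on $\Gamma\times\mathbb{R}$, absolutely continuous with respect to Haar measure, whose support generates $\Gamma\times\mathbb{R}$ as a semigroup, and such that $\varphi$ is $p$-integrable; let $p_\Gamma$ be its push-forward to $\Gamma$. If $\nu$ is a $p$-stationary Borel probability measure on $\Omega_{P(\varphi)}$, then $(\Omega_{P(\varphi)},\nu)$ admits a measurable $(\Gamma\times\mathbb{R})$-factor which is a non-trivial $(\Gamma,p_\Gamma)$-boundary (with $\Gamma\times\mathbb{R}$ acting on the boundary through $\Gamma$).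
   Context: $\varphi:\Gamma\to\mathbb{R}$ is a quasimorphism if $\sup_{g,h}|\varphi(gh)-\varphi(g)-\varphi(h)|<\infty$. Functions are at bounded distance if their difference is bounded. $\Gamma$ is discrete. The twist of a closed $P\subset\mathbb{R}$ is $P(\varphi):=\{(\gamma,t)\in\Gamma\times\mathbb{R}\mid\varphi(\gamma)+t\in P\}$. For a locally compact second countable group $G$, $\mathscr{C}(G)$ is the space of closed subsets of $G$ with the Chabauty-Fell topology and action $g.Q:=Qg^{-1}$. The hull $\Omega_Q$ of a closed $Q\subset G$ is the closure of its $G$-orbit in $\mathscr{C}(G)$; thus $\Omega_P\subset\mathscr{C}(\mathbb{R})$ and $\Omega_{P(\varphi)}\subset\mathscr{C}(\Gamma\times\mathbb{R})$. Uniquely ergodic means having exactly one invariant Borel probability measure. $\varphi$ is $p$-integrable if $\sum_\gamma p_\Gamma(\gamma)|\varphi(\gamma)|<\infty$. A Borel probability measure $\nu$ is $p$-stationary if $p*\nu=\nu$. A measurable factor of $(X,\nu)$ is a space $(Y,\eta)$ together with a $\nu$-measurable, $\nu$-a.e. equivariant map $X\to Y$ pushing $\nu$ to $\eta$. The Poisson boundary of $(\Gamma,q)$, $q$ a symmetric probability measure on $\Gamma$ with generating support, is the ergodic $q$-stationary $\Gamma$-space $(B,m)$, unique up to measure-preserving $\Gamma$-isomorphism, such that: (i) $f\mapsto\big(\gamma\mapsto\int_B f(\gamma.b)\,dm(b)\big)$ is a surjective isometry $\mathscr{P}_m$ from $L^\infty(B,m)$ onto the bounded right-$q$-harmonic functions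 on $\Gamma$ (those $h$ with $h*q=h$); (ii) for every countable $\mathcal{A}\subset L^\infty(B,m)$ there are a $q^{\otimes\mathbb{N}}$-conull Borel set $\Omega\subset\Gamma^{\mathbb{N}}$ and a Borel map $Z_\infty:\Omega\to B$ with $(Z_\infty)_*q^{\otimes\mathbb{N}}=m$ and $\lim_n\mathscr{P}_mf(\omega_1\cdots\omega_n)=f(Z_\infty(\omega))$ for all $\omega\in\Omega$, $f\in\mathcal{A}$. A $(\Gamma,q)$-boundary is a pair $(B',\pi_*m)$ with $\pi:B\to B'$ a $\Gamma$-equivariant Borel map to a standard Borel $\Gamma$-space; it is trivial if $\pi_*m$ is a point mass at a $\Gamma$-fixed point, and non-trivial otherwise. *)

theory Defs
  imports "HOL-Probability.Probability" "HOL-Algebra.Group_Action"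
begin

section \<open>Groups, topologies and Borel structures\<close>

definition real_group :: "real monoid" where
  "real_group = \<lparr>carrier = UNIV, monoid.mult = (+), one = 0\<rparr>"

text \<open>A group \<open>\<Gamma>\<close> is always discrete; this is the product topology on \<open>\<Gamma> \<times> \<real>\<close>.\<close>

definition cyl_topology :: "('g, 'z) monoid_scheme \<Rightarrow> ('g \<times> real) topology" where
  "cyl_topology \<Gamma> = prod_topology (discrete_topology (carrier \<Gamma>)) euclideanreal"

text \<open>Counting measure times Lebesgue measure is, up to scaling, the unique Haar measure of
  \<open>\<Gamma> \<times> \<real>\<close>; it is both left and right invariant.\<close>

definition cyl_haar :: "('g, 'z) monoid_scheme \<Rightarrow> ('g \<times> real) measure" where
  "cyl_haar \<Gamma> = count_space (carrier \<Gamma>) \<Otimes>\<^sub>M lborel"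

definition borel_of_top :: "'a topology \<Rightarrow> 'a measure" where
  "borel_of_top X = sigma (topspace X) {U. openin X U}"

definition standard_borel_measure :: "'a measure \<Rightarrow> bool" where
  "standard_borel_measure M \<longleftrightarrow>
     (\<exists>X. completely_metrizable_space X \<and> second_countable X \<and>
          space M = topspace X \<and> sets M = sets (borel_of_top X))"

definition measure_support :: "'a topology \<Rightarrow> 'a measure \<Rightarrow> 'a set" where
  "measure_support X p = {x \<in> topspace X. \<forall>U. openin X U \<and> x \<in> U \<longrightarrow> emeasure p U > 0}"

inductive_set semigroup_generated :: "('a, 'z) monoid_scheme \<Rightarrow> 'a set \<Rightarrow> 'a set"
  for G and S where
  incl: "s \<in> S \<Longrightarrow> s \<in> semigroup_generated G S"
| mult: "x \<in> semigroup_generated G S \<Longrightarrow> y \<in> semigroup_generated G S \<Longrightarrow>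
         x \<otimes>\<^bsub>G\<^esub> y \<in> semigroup_generated G S"

definition symmetric_measure :: "('a, 'z) monoid_scheme \<Rightarrow> 'a measure \<Rightarrow> bool" where
  "symmetric_measure G p \<longleftrightarrow> distr p p (\<lambda>g. inv\<^bsub>G\<^esub> g) = p"


section \<open>The Chabauty--Fell space and hulls\<close>

text \<open>The points are the closed sets; a subbasis is given by the sets of all \<open>F\<close> missing a given
  compact set and the sets of all \<open>F\<close> hitting a given open set.\<close>

definition fell_topology :: "'a topology \<Rightarrow> 'a set topology" where
  "fell_topology X = topology_generated_by
     ({{F. closedin X F \<and> F \<inter> K = {}} | K. compactin X K} \<union>
      {{F. closedin X F \<and> F \<inter> U \<noteq> {}} | U. openin X U})"

definition set_action :: "('a, 'z) monoid_scheme \<Rightarrow> 'a \<Rightarrow> 'a set \<Rightarrow> 'a set" where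
  "set_action G g Q = Q #>\<^bsub>G\<^esub> (inv\<^bsub>G\<^esub> g)"

definition orbit_hull :: "('a, 'z) monoid_scheme \<Rightarrow> 'a topology \<Rightarrow> 'a set \<Rightarrow> 'a set set" where
  "orbit_hull G X Q = fell_topology X closure_of {set_action G g Q | g. g \<in> carrier G}"

definition hull_borel :: "('a, 'z) monoid_scheme \<Rightarrow> 'a topology \<Rightarrow> 'a set \<Rightarrow> 'a set measure" where
  "hull_borel G X Q = borel_of_top (subtopology (fell_topology X) (orbit_hull G X Q))"

definition free_on :: "('a, 'z) monoid_scheme \<Rightarrow> 'x set \<Rightarrow> ('a \<Rightarrow> 'x \<Rightarrow> 'x) \<Rightarrow> bool" where
  "free_on G E act \<longleftrightarrow> (\<forall>x\<in>E. \<forall>g\<in>carrier G. act g x = x \<longrightarrow> g = \<one>\<^bsub>G\<^esub>)"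

text \<open>Here \<open>M\<close> only serves as a measurable space.\<close>

definition uniquely_ergodic ::
  "('a, 'z) monoid_scheme \<Rightarrow> 'x measure \<Rightarrow> ('a \<Rightarrow> 'x \<Rightarrow> 'x) \<Rightarrow> bool" where
  "uniquely_ergodic G M act \<longleftrightarrow>
     (\<exists>!\<mu>. prob_space \<mu> \<and> sets \<mu> = sets M \<and> (\<forall>g\<in>carrier G. distr \<mu> \<mu> (act g) = \<mu>))"


section \<open>Quasimorphisms and twists\<close>

definition quasimorphism :: "('g, 'z) monoid_scheme \<Rightarrow> ('g \<Rightarrow> real) \<Rightarrow> bool" where
  "quasimorphism \<Gamma> \<phi> \<longleftrightarrow>
     (\<exists>C. \<forall>g\<in>carrier \<Gamma>. \<forall>h\<in>carrier \<Gamma>. \<bar>\<phi> (g \<otimes>\<^bsub>\<Gamma>\<^esub> h) - \<phi> g - \<phi> h\<bar> \<le> C)"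

definition bounded_distance :: "'g set \<Rightarrow> ('g \<Rightarrow> real) \<Rightarrow> ('g \<Rightarrow> real) \<Rightarrow> bool" where
  "bounded_distance A \<phi> \<psi> \<longleftrightarrow> bounded ((\<lambda>g. \<phi> g - \<psi> g) ` A)"

definition twist :: "('g, 'z) monoid_scheme \<Rightarrow> real set \<Rightarrow> ('g \<Rightarrow> real) \<Rightarrow> ('g \<times> real) set" where
  "twist \<Gamma> P \<phi> = {(\<gamma>, t). \<gamma> \<in> carrier \<Gamma> \<and> \<phi> \<gamma> + t \<in> P}"

definition push_to_group :: "('g, 'z) monoid_scheme \<Rightarrow> ('g \<times> real) measure \<Rightarrow> 'g measure" where
  "push_to_group \<Gamma> p = distr p (count_space (carrier \<Gamma>)) fst"


section \<open>Stationary measures and factors\<close>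

text \<open>\<open>p * \<nu>\<close> is the image of \<open>p \<otimes> \<nu>\<close> under the action map.\<close>

definition stationary :: "'a measure \<Rightarrow> 'x measure \<Rightarrow> ('a \<Rightarrow> 'x \<Rightarrow> 'x) \<Rightarrow> bool" where
  "stationary p \<nu> act \<longleftrightarrow> distr (p \<Otimes>\<^sub>M \<nu>) \<nu> (\<lambda>(g, x). act g x) = \<nu>"

text \<open>\<open>\<nu>\<close>-measurability is measurability for the completed sigma-algebra. Almost everywhere
  equivariance means that for each group element separately the identity holds almost everywhere.\<close>

definition measurable_factor ::
  "('a, 'z) monoid_scheme \<Rightarrow> 'x measure \<Rightarrow> ('a \<Rightarrow> 'x \<Rightarrow> 'x) \<Rightarrow>
   'y measure \<Rightarrow> ('a \<Rightarrow> 'y \<Rightarrow> 'y) \<Rightarrow> bool" where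
  "measurable_factor G \<nu> actX \<eta> actY \<longleftrightarrow>
     (\<exists>F \<in> measurable (completion \<nu>) \<eta>.
        (\<forall>g\<in>carrier G. AE x in \<nu>. F (actX g x) = actY g (F x)) \<and>
        distr (completion \<nu>) \<eta> F = \<eta>)"


section \<open>Poisson boundaries of countable groups\<close>

definition standard_borel_space_action ::
  "('g, 'z) monoid_scheme \<Rightarrow> 'b measure \<Rightarrow> ('g \<Rightarrow> 'b \<Rightarrow> 'b) \<Rightarrow> bool" where
  "standard_borel_space_action \<Gamma> M act \<longleftrightarrow>
     standard_borel_measure M \<and> group_action \<Gamma> (space M) act \<and>
     (\<forall>\<gamma>\<in>carrier \<Gamma>. act \<gamma> \<in> measurable M M)"

definition ergodic_action ::
  "('g, 'z) monoid_scheme \<Rightarrow> 'b measure \<Rightarrow> ('g \<Rightarrow> 'b \<Rightarrow> 'b) \<Rightarrow> bool" where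
  "ergodic_action \<Gamma> m act \<longleftrightarrow>
     (\<forall>A\<in>sets m. (\<forall>\<gamma>\<in>carrier \<Gamma>. act \<gamma> -` A \<inter> space m = A) \<longrightarrow>
        emeasure m A = 0 \<or> emeasure m A = 1)"

definition linf_norm :: "'b measure \<Rightarrow> ('b \<Rightarrow> real) \<Rightarrow> ereal" where
  "linf_norm m f = esssup m (\<lambda>b. ereal \<bar>f b\<bar>)"

text \<open>Elements of \<open>L\<^sup>\<infinity>\<close> are represented by functions, not by classes modulo null sets.\<close>

definition linf :: "'b measure \<Rightarrow> ('b \<Rightarrow> real) set" where
  "linf m = {f \<in> borel_measurable m. linf_norm m f < \<infinity>}"

definition poisson_transform ::
  "'b measure \<Rightarrow> ('g \<Rightarrow> 'b \<Rightarrow> 'b) \<Rightarrow> ('b \<Rightarrow> real) \<Rightarrow> 'g \<Rightarrow> real" where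
  "poisson_transform m act f \<gamma> = (\<integral>b. f (act \<gamma> b) \<partial>m)"

text \<open>The condition \<open>h * q = h\<close>.\<close>

definition bounded_right_harmonic ::
  "('g, 'z) monoid_scheme \<Rightarrow> 'g measure \<Rightarrow> ('g \<Rightarrow> real) set" where
  "bounded_right_harmonic \<Gamma> q =
     {h. bounded (h ` carrier \<Gamma>) \<and>
         (\<forall>\<gamma>\<in>carrier \<Gamma>. (\<integral>s. h (\<gamma> \<otimes>\<^bsub>\<Gamma>\<^esub> inv\<^bsub>\<Gamma>\<^esub> s) \<partial>q) = h \<gamma>)}"

text \<open>Increments are indexed from \<open>0\<close>: \<open>walk \<Gamma> \<omega> n\<close> is the product of the first \<open>n\<close> increments.\<close>

primrec walk :: "('g, 'z) monoid_scheme \<Rightarrow> (nat \<Rightarrow> 'g) \<Rightarrow> nat \<Rightarrow> 'g" where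
  "walk \<Gamma> \<omega> 0 = \<one>\<^bsub>\<Gamma>\<^esub>"
| "walk \<Gamma> \<omega> (Suc n) = walk \<Gamma> \<omega> n \<otimes>\<^bsub>\<Gamma>\<^esub> \<omega> n"

text \<open>The measurable space underlying \<open>(B, m)\<close> is the one carried by \<open>m\<close>. Since the Poisson transform
  is linear, the norm identity also makes it well defined and injective on classes modulo null
  sets, so that together with the surjectivity condition it is a surjective isometry.\<close>

definition poisson_boundary ::
  "('g, 'z) monoid_scheme \<Rightarrow> 'g measure \<Rightarrow> 'b measure \<Rightarrow> ('g \<Rightarrow> 'b \<Rightarrow> 'b) \<Rightarrow> bool" where
  "poisson_boundary \<Gamma> q m act \<longleftrightarrow>
     prob_space m \<and> standard_borel_space_action \<Gamma> m act \<and>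
     stationary q m act \<and> ergodic_action \<Gamma> m act \<and>
     (\<forall>f\<in>linf m. poisson_transform m act f \<in> bounded_right_harmonic \<Gamma> q \<and>
        (SUP \<gamma>\<in>carrier \<Gamma>. ereal \<bar>poisson_transform m act f \<gamma>\<bar>) = linf_norm m f) \<and>
     (\<forall>h\<in>bounded_right_harmonic \<Gamma> q.
        \<exists>f\<in>linf m. \<forall>\<gamma>\<in>carrier \<Gamma>. poisson_transform m act f \<gamma> = h \<gamma>) \<and>
     (\<forall>\<A>. countable \<A> \<and> \<A> \<subseteq> linf m \<longrightarrow>
        (\<exists>\<Omega>\<in>sets (Pi\<^sub>M (UNIV :: nat set) (\<lambda>_. q)).
           emeasure (Pi\<^sub>M UNIV (\<lambda>_. q)) \<Omega> = 1 \<and>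
           (\<exists>Z\<in>measurable (restrict_space (Pi\<^sub>M UNIV (\<lambda>_. q)) \<Omega>) m.
              distr (restrict_space (Pi\<^sub>M UNIV (\<lambda>_. q)) \<Omega>) m Z = m \<and>
              (\<forall>\<omega>\<in>\<Omega>. \<forall>f\<in>\<A>.
                 (\<lambda>n. poisson_transform m act f (walk \<Gamma> \<omega> n)) \<longlonglongrightarrow> f (Z \<omega>)))))"

text \<open>\<open>(\<eta>, act')\<close> is a boundary relative to the Poisson boundary \<open>(m, act)\<close>: the image of \<open>m\<close> under
  an everywhere equivariant Borel map to a standard Borel \<open>\<Gamma>\<close>-space.\<close>

definition boundary_of ::
  "('g, 'z) monoid_scheme \<Rightarrow> 'b measure \<Rightarrow> ('g \<Rightarrow> 'b \<Rightarrow> 'b) \<Rightarrow>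
   'c measure \<Rightarrow> ('g \<Rightarrow> 'c \<Rightarrow> 'c) \<Rightarrow> bool" where
  "boundary_of \<Gamma> m act \<eta> act' \<longleftrightarrow>
     standard_borel_space_action \<Gamma> \<eta> act' \<and>
     (\<exists>\<pi>\<in>measurable m \<eta>.
        (\<forall>\<gamma>\<in>carrier \<Gamma>. \<forall>b\<in>space m. \<pi> (act \<gamma> b) = act' \<gamma> (\<pi> b)) \<and>
        distr m \<eta> \<pi> = \<eta>)"

definition trivial_boundary ::
  "('g, 'z) monoid_scheme \<Rightarrow> 'c measure \<Rightarrow> ('g \<Rightarrow> 'c \<Rightarrow> 'c) \<Rightarrow> bool" where
  "trivial_boundary \<Gamma> \<eta> act \<longleftrightarrow>
     (\<exists>y\<in>space \<eta>. (\<forall>\<gamma>\<in>carrier \<Gamma>. act \<gamma> y = y) \<and> \<eta> = return \<eta> y)"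

end

theory Submission
  imports Defs
begin

text \<open>
  A point \<open>Q\<close> of the hull of the twist has a closed fibre in \<open>\<real>\<close> over each element of \<open>\<Gamma>\<close>. The condition that the
  fibre over \<open>\<gamma>\<close> is a translate of the fibre over the identity, by an amount in a fixed compact interval, is
  closed in the Chabauty--Fell topology (\<open>closedin_offset\<close>) and holds on the orbit, hence on the hull; as \<open>\<real>\<close> acts
  freely on the hull of \<open>P\<close>, the amount is unique. This gives a function \<open>coc Q\<close> on \<open>\<Gamma>\<close>, at uniformly bounded
  distance from \<open>\<phi>\<close> and depending on \<open>Q\<close> in a Borel way, on which \<open>(g, t)\<close> acts by
  \<open>u \<mapsto> u (\<cdot> g) - u g\<close>. So \<open>\<nu>\<close> has as image a measure on functions that is stationary for the symmetric
  measure \<open>q = p\<^sub>\<Gamma>\<close> on \<open>\<Gamma>\<close> (\<open>coc_image_stationary\<close>), and evaluation of functions is a cocycle.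

  By symmetry of \<open>q\<close> the mean of \<open>\<phi>\<close>, hence that of the cocycle, stays bounded along the random walk. The upper
  limit of the means is a bounded transfer function (\<open>exists_transfer_function\<close>) that makes the cocycle
  harmonic: almost every trajectory becomes a left \<open>q\<close>-harmonic function on \<open>\<Gamma>\<close>, still at bounded distance
  from \<open>\<phi>\<close>.

  Two left harmonic functions at bounded distance from \<open>\<phi>\<close> differ by a bounded harmonic function, whose increments
  tend to zero along the walk (\<open>harmonic_increments_tendsto_0\<close>). Hence the law of the harmonic cocycle
  is the limit law of the increments \<open>avg (j g) - avg g\<close> of its average, as \<open>g\<close> follows the walk
  (\<open>test_functions_limit\<close>). By stationarity, \<open>g \<mapsto> avg (j g) - avg g\<close> is a bounded right harmonic function, hence the
  Poisson transform of a bounded function on the Poisson boundary, to which it converges along the walk. The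
  law of the harmonic cocycle is therefore the image of \<open>m\<close> under an equivariant map
  from the Poisson boundary to functions on \<open>\<Gamma>\<close> (\<open>boundary_law\<close>, \<open>exists_boundary_map\<close>): it is a boundary, and
  it is a factor of \<open>\<nu>\<close> by construction.

  If this boundary were trivial, its only point would be a function fixed by the action, that is, a
  homomorphism up to an additive constant, at bounded distance from \<open>\<phi>\<close>.
\<close>

section \<open>Averages over discrete distributions\<close>

abbreviation pmf_mean :: "'a pmf \<Rightarrow> ('a \<Rightarrow> real) \<Rightarrow> real" (\<open>\<E>\<close>) where
  "\<E> p \<equiv> integral\<^sup>L (measure_pmf p)"

lemma integrable_pmf_bounded:
  fixes f :: "'a \<Rightarrow> real"
  assumes "\<And>a. a \<in> set_pmf q \<Longrightarrow> \<bar>f a\<bar> \<le> K"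
  shows "integrable (measure_pmf q) f"
  by (rule measure_pmf.integrable_const_bound[where B=K]) (auto simp: AE_measure_pmf_iff assms)

lemma abs_expectation_pmf_le:
  fixes f :: "'a \<Rightarrow> real"
  assumes "\<And>a. a \<in> set_pmf q \<Longrightarrow> \<bar>f a\<bar> \<le> K"
  shows "\<bar>\<E> q f\<bar> \<le> K"
proof -
  have "\<bar>\<E> q f\<bar> \<le> \<E> q (\<lambda>a. \<bar>f a\<bar>)"
    by (rule integral_abs_bound)
  also have "\<dots> \<le> \<E> q (\<lambda>_. K)"
    by (rule integral_mono_AE)
       (auto intro!: integrable_pmf_bounded[of _ _ K] simp: assms AE_measure_pmf_iff)
  finally show ?thesis by simp
qed

lemma expectation_pair_pmf_bounded:
  fixes f :: "'a \<times> 'b \<Rightarrow> real"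
  assumes b: "\<And>x y. x \<in> set_pmf p \<Longrightarrow> y \<in> set_pmf q \<Longrightarrow> \<bar>f (x, y)\<bar> \<le> K"
  shows "\<E> (pair_pmf p q) f =
    \<E> p (\<lambda>x. \<E> q (\<lambda>y. f (x, y)))"
proof -
  have nn: "\<E> (pair_pmf p q) g =
      \<E> p (\<lambda>x. \<E> q (\<lambda>y. g (x, y)))"
    if g0: "\<And>z. 0 \<le> g z" and gb: "\<And>x y. x \<in> set_pmf p \<Longrightarrow> y \<in> set_pmf q \<Longrightarrow> \<bar>g (x, y)\<bar> \<le> L"
    for g :: "'a \<times> 'b \<Rightarrow> real" and L
  proof -
    have ip: "integrable (pair_pmf p q) g"
      by (rule integrable_pmf_bounded[of _ _ L]) (auto intro: gb)
    have iq: "integrable q (\<lambda>y. g (x, y))" if "x \<in> set_pmf p" for x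
      by (rule integrable_pmf_bounded[of _ _ L]) (auto intro: gb that)
    have ie: "integrable p (\<lambda>x. \<E> q (\<lambda>y. g (x, y)))"
      by (rule integrable_pmf_bounded[of _ _ L]) (auto intro!: abs_expectation_pmf_le gb)
    have "ennreal (\<E> (pair_pmf p q) g) = (\<integral>\<^sup>+z. g z \<partial>pair_pmf p q)"
      by (rule nn_integral_eq_integral[symmetric]) (auto simp: g0 ip)
    also have "\<dots> = (\<integral>\<^sup>+x. (\<integral>\<^sup>+y. g (x, y) \<partial>q) \<partial>p)"
      by (rule nn_integral_pair_pmf')
    also have "\<dots> = (\<integral>\<^sup>+x. ennreal (\<E> q (\<lambda>y. g (x, y))) \<partial>p)"
      by (rule nn_integral_cong_AE) (auto simp: AE_measure_pmf_iff g0 intro!: nn_integral_eq_integral iq)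
    also have "\<dots> = ennreal (\<E> p (\<lambda>x. \<E> q (\<lambda>y. g (x, y))))"
      by (rule nn_integral_eq_integral[OF ie]) (auto simp: g0)
    finally show ?thesis
      by (subst (asm) ennreal_inj) (auto simp: g0 intro!: Bochner_Integration.integral_nonneg)
  qed
  define h where "h z = (if z \<in> set_pmf p \<times> set_pmf q then f z + K else 0)" for z
  have K0: "0 \<le> K"
    using b set_pmf_not_empty[of p] set_pmf_not_empty[of q] by (force simp: ex_in_conv[symmetric])
  have hb: "\<bar>h (x, y)\<bar> \<le> 2 * K" and hf: "h (x, y) = f (x, y) + K"
    if "x \<in> set_pmf p" "y \<in> set_pmf q" for x y
    using b[OF that] that by (auto simp: h_def)
  have h0: "0 \<le> h z" for z
    using b by (cases z) (force simp: h_def abs_le_iff)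
  have "\<E> (pair_pmf p q) h = \<E> (pair_pmf p q) (\<lambda>z. f z + K)"
    by (rule integral_cong_AE) (auto simp: AE_measure_pmf_iff hf)
  also have "\<dots> = \<E> (pair_pmf p q) f + K"
    by (subst Bochner_Integration.integral_add) (auto intro!: integrable_pmf_bounded[of _ _ K] b)
  finally have 1: "\<E> (pair_pmf p q) h = \<E> (pair_pmf p q) f + K" .
  have in1: "\<E> q (\<lambda>y. h (x, y)) = \<E> q (\<lambda>y. f (x, y)) + K"
    if "x \<in> set_pmf p" for x
  proof -
    have "\<E> q (\<lambda>y. h (x, y)) = \<E> q (\<lambda>y. f (x, y) + K)"
      by (rule integral_cong_AE) (auto simp: AE_measure_pmf_iff hf that)
    also have "\<dots> = \<E> q (\<lambda>y. f (x, y)) + K"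
      by (subst Bochner_Integration.integral_add) (auto intro!: integrable_pmf_bounded[of _ _ K] b that)
    finally show ?thesis .
  qed
  have "\<E> p (\<lambda>x. \<E> q (\<lambda>y. h (x, y)))
      = \<E> p (\<lambda>x. \<E> q (\<lambda>y. f (x, y)) + K)"
    by (rule integral_cong_AE) (auto simp: AE_measure_pmf_iff in1)
  also have "\<dots> = \<E> p (\<lambda>x. \<E> q (\<lambda>y. f (x, y))) + K"
    by (subst Bochner_Integration.integral_add)
       (auto intro!: integrable_pmf_bounded[of _ _ K] abs_expectation_pmf_le b)
  finally show ?thesis using 1 nn[of h "2 * K", OF h0 hb] by simp
qed

lemma expectation_pmf_swap:
  fixes f :: "'a \<Rightarrow> 'b \<Rightarrow> real"
  assumes b: "\<And>x y. x \<in> set_pmf p \<Longrightarrow> y \<in> set_pmf q \<Longrightarrow> \<bar>f x y\<bar> \<le> K"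
  shows "\<E> p (\<lambda>x. \<E> q (f x)) =
    \<E> q (\<lambda>y. \<E> p (\<lambda>x. f x y))"
proof -
  have "\<E> p (\<lambda>x. \<E> q (f x)) =
      \<E> (pair_pmf p q) (\<lambda>(x, y). f x y)"
    by (subst expectation_pair_pmf_bounded[where K=K]) (auto intro: b)
  also have "\<dots> = \<E> (pair_pmf q p) (\<lambda>(y, x). f x y)"
    by (subst pair_commute_pmf) (simp add: case_prod_beta')
  also have "\<dots> = \<E> q (\<lambda>y. \<E> p (\<lambda>x. f x y))"
    by (subst expectation_pair_pmf_bounded[where K=K]) (auto intro: b)
  finally show ?thesis .
qed

lemma expectation_pmf_cong:
  fixes f g :: "'b \<Rightarrow> real"
  assumes "\<And>x. x \<in> set_pmf p \<Longrightarrow> f x = g x"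
  shows "\<E> p f = \<E> p g"
  using assms by (intro integral_cong_AE) (auto simp: AE_measure_pmf_iff)

lemma pmf_times_le_expectation:
  fixes f :: "'b \<Rightarrow> real"
  assumes "\<And>x. x \<in> set_pmf p \<Longrightarrow> 0 \<le> f x" "\<And>x. x \<in> set_pmf p \<Longrightarrow> \<bar>f x\<bar> \<le> K" "j \<in> set_pmf p"
  shows "pmf p j * f j \<le> \<E> p f"
proof -
  have "pmf p j * f j = \<E> p (\<lambda>s. f j * indicator {j} s)"
    by (simp add: measure_pmf_single)
  also have "\<dots> \<le> \<E> p f"
  proof (rule integral_mono_AE)
    show "integrable p (\<lambda>s. f j * indicator {j} s)"
      by (rule integrable_pmf_bounded[where K="\<bar>f j\<bar>"]) (auto simp: indicator_def)
    show "integrable p f" by (rule integrable_pmf_bounded[where K=K]) (rule assms(2))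
  qed (auto simp: AE_measure_pmf_iff assms indicator_def)
  finally show ?thesis .
qed

text \<open>Restricting a discrete distribution to its countable support makes functions on a product
  jointly measurable as soon as they are measurable in the second variable.\<close>

lemma pmf_restrict_support:
  defines "r \<equiv> \<lambda>q :: 'a pmf. restrict_space (measure_pmf q) (set_pmf q)"
  shows "prob_space (r q)" "sets (r q) = sets (count_space (set_pmf q))"
    "integral\<^sup>L (r q) (f :: 'a \<Rightarrow> real) = \<E> q f"
proof -
  show "prob_space (r q)"
    unfolding r_def by (rule prob_space_restrict_space) (auto simp: emeasure_pmf)
  show "sets (r q) = sets (count_space (set_pmf q))"
    unfolding r_def by (auto simp: sets_restrict_space)
  show "integral\<^sup>L (r q) f = \<E> q f"
    unfolding r_def
    by (subst integral_restrict_space) (auto intro!: integral_cong_AE simp: AE_measure_pmf_iff)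
qed

lemma pmf_fubini_bounded:
  fixes f :: "'a \<Rightarrow> 'x \<Rightarrow> real"
  assumes M: "prob_space M"
    and meas: "\<And>a. a \<in> set_pmf q \<Longrightarrow> f a \<in> borel_measurable M"
    and b: "\<And>a x. a \<in> set_pmf q \<Longrightarrow> x \<in> space M \<Longrightarrow> \<bar>f a x\<bar> \<le> K"
  shows "\<E> q (\<lambda>a. \<integral>x. f a x \<partial>M) = (\<integral>x. \<E> q (\<lambda>a. f a x) \<partial>M)"
proof -
  define r where "r = restrict_space (measure_pmf q) (set_pmf q)"
  note r = pmf_restrict_support[of q, folded r_def]
  interpret M: prob_space M by fact
  interpret r: prob_space r by (rule r)
  interpret P: pair_prob_space r M ..
  have sr: "space r = set_pmf q" using sets_eq_imp_space_eq[OF r(2)] by simp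
  have "case_prod f \<in> borel_measurable (count_space (set_pmf q) \<Otimes>\<^sub>M M)"
    by (rule measurable_pair_measure_countable1) (auto intro: meas)
  then have m: "case_prod f \<in> borel_measurable (r \<Otimes>\<^sub>M M)"
    by (subst measurable_cong_sets[OF sets_pair_measure_cong[OF r(2) refl] refl])
  have "integrable (r \<Otimes>\<^sub>M M) (case_prod f)"
    by (rule P.P.integrable_const_bound[where B=K]) (auto simp: m space_pair_measure sr b)
  from P.Fubini_integral[OF this] show ?thesis unfolding r(3) by simp
qed

lemma borel_measurable_pmf_expectation:
  fixes f :: "'a \<Rightarrow> 'x \<Rightarrow> real"
  assumes meas: "\<And>a. a \<in> set_pmf q \<Longrightarrow> f a \<in> borel_measurable M"
  shows "(\<lambda>x. \<E> q (\<lambda>a. f a x)) \<in> borel_measurable M"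
proof -
  define r where "r = restrict_space (measure_pmf q) (set_pmf q)"
  note r = pmf_restrict_support[of q, folded r_def]
  interpret r: prob_space r by (rule r)
  have "case_prod f \<in> borel_measurable (count_space (set_pmf q) \<Otimes>\<^sub>M M)"
    by (rule measurable_pair_measure_countable1) (auto intro: meas)
  then have "case_prod f \<in> borel_measurable (r \<Otimes>\<^sub>M M)"
    by (subst measurable_cong_sets[OF sets_pair_measure_cong[OF r(2) refl] refl])
  then have "case_prod (\<lambda>x a. f a x) \<in> borel_measurable (M \<Otimes>\<^sub>M r)"
    by (subst measurable_split_conv) (auto dest: measurable_pair_swap simp: case_prod_beta')
  from r.borel_measurable_lebesgue_integral[OF this] show ?thesis unfolding r(3) .
qed

section \<open>Convolution powers and random walks\<close>

text \<open>The convolution of two distributions on a group, that is, the law of the product of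
  independent elements.\<close>

definition pmf_conv :: "('g, 'z) monoid_scheme \<Rightarrow> 'g pmf \<Rightarrow> 'g pmf \<Rightarrow> 'g pmf" where
  "pmf_conv G p q = map_pmf (\<lambda>(g, h). g \<otimes>\<^bsub>G\<^esub> h) (pair_pmf p q)"

text \<open>A symmetric step distribution whose support generates the group as a semigroup.\<close>

locale symmetric_walk = group G for G (structure) +
  fixes q :: "'a pmf"
  assumes supp: "set_pmf q \<subseteq> carrier G"
    and symm: "map_pmf (m_inv G) q = q"
    and gen: "semigroup_generated G (set_pmf q) = carrier G"
begin

text \<open>The law of the random walk after \<open>n\<close> steps.\<close>

primrec conv_pow :: "nat \<Rightarrow> 'a pmf" where
  "conv_pow 0 = return_pmf \<one>"
| "conv_pow (Suc n) = pmf_conv G q (conv_pow n)"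

lemma set_pmf_conv: "set_pmf (pmf_conv G p r) = (\<lambda>(g, h). g \<otimes> h) ` (set_pmf p \<times> set_pmf r)"
  by (simp add: pmf_conv_def)

lemma set_conv_pow: "set_pmf (conv_pow n) \<subseteq> carrier G"
  by (induction n) (use supp in \<open>auto simp: set_pmf_conv\<close>)

lemma conv_pow_closed: "g \<in> set_pmf (conv_pow n) \<Longrightarrow> g \<in> carrier G"
  using set_conv_pow by auto

lemma q_closed: "g \<in> set_pmf q \<Longrightarrow> g \<in> carrier G"
  using supp by auto

lemma pmf_conv_assoc:
  assumes "set_pmf a \<subseteq> carrier G" "set_pmf b \<subseteq> carrier G" "set_pmf c \<subseteq> carrier G"
  shows "pmf_conv G (pmf_conv G a b) c = pmf_conv G a (pmf_conv G b c)"
proof -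
  have "pmf_conv G (pmf_conv G a b) c =
      map_pmf (\<lambda>(x, y, z). (x \<otimes> y) \<otimes> z) (pair_pmf a (pair_pmf b c))"
    unfolding pmf_conv_def pair_map_pmf1 pair_pair_pmf pmf.map_comp
    by (rule map_pmf_cong) auto
  also have "\<dots> = map_pmf (\<lambda>(x, y, z). x \<otimes> (y \<otimes> z)) (pair_pmf a (pair_pmf b c))"
    using assms by (intro map_pmf_cong) (auto intro!: m_assoc)
  also have "\<dots> = pmf_conv G a (pmf_conv G b c)"
    unfolding pmf_conv_def pair_map_pmf2 pmf.map_comp
    by (rule map_pmf_cong) auto
  finally show ?thesis .
qed

lemma pmf_conv_one: "set_pmf a \<subseteq> carrier G \<Longrightarrow> pmf_conv G (return_pmf \<one>) a = a"
  "set_pmf a \<subseteq> carrier G \<Longrightarrow> pmf_conv G a (return_pmf \<one>) = a"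
  unfolding pmf_conv_def pair_return_pmf1 pair_return_pmf2 pmf.map_comp
  by (auto intro!: map_pmf_idI)

lemma conv_pow_add: "conv_pow (m + n) = pmf_conv G (conv_pow m) (conv_pow n)"
  by (induction m) (simp_all add: pmf_conv_one set_conv_pow pmf_conv_assoc supp)

lemma conv_pow_1: "conv_pow 1 = q"
  by (simp add: pmf_conv_one supp)

lemma conv_pow_Suc': "conv_pow (Suc n) = pmf_conv G (conv_pow n) q"
  using conv_pow_add[of n 1] unfolding conv_pow_1 by simp

lemma inv_conv_pow: "map_pmf (m_inv G) (conv_pow n) = conv_pow n"
proof (induction n)
  case (Suc n)
  have "map_pmf (m_inv G) (conv_pow (Suc n)) =
      map_pmf (\<lambda>(g, h). inv (g \<otimes> h)) (pair_pmf q (conv_pow n))"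
    by (simp add: pmf_conv_def pmf.map_comp comp_def case_prod_beta')
  also have "\<dots> = map_pmf (\<lambda>(g, h). inv h \<otimes> inv g) (pair_pmf q (conv_pow n))"
    by (rule map_pmf_cong) (auto simp: q_closed conv_pow_closed inv_mult_group)
  also have "\<dots> = map_pmf (\<lambda>(h, g). inv h \<otimes> inv g) (pair_pmf (conv_pow n) q)"
    by (subst pair_commute_pmf) (simp add: pmf.map_comp comp_def case_prod_beta')
  also have "\<dots> = pmf_conv G (map_pmf (m_inv G) (conv_pow n)) (map_pmf (m_inv G) q)"
    by (simp add: pmf_conv_def map_pair[symmetric] pmf.map_comp comp_def case_prod_beta')
  also have "\<dots> = conv_pow (Suc n)"
    unfolding Suc symm conv_pow_Suc' ..
  finally show ?case .
qed simp

lemma conv_pow_reaches: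
  assumes "g \<in> carrier G"
  shows "\<exists>n. g \<in> set_pmf (conv_pow n)"
proof -
  have "g \<in> semigroup_generated G (set_pmf q)" using assms gen by simp
  then show ?thesis
  proof induction
    case (incl s)
    then show ?case using conv_pow_1 by metis
  next
    case (mult x y)
    then obtain m n where "x \<in> set_pmf (conv_pow m)" "y \<in> set_pmf (conv_pow n)" by auto
    then have "x \<otimes> y \<in> set_pmf (conv_pow (m + n))"
      by (force simp: conv_pow_add set_pmf_conv)
    then show ?case by blast
  qed
qed

lemma expectation_pmf_conv:
  fixes f :: "'a \<Rightarrow> real"
  assumes "\<And>g h. g \<in> set_pmf a \<Longrightarrow> h \<in> set_pmf b \<Longrightarrow> \<bar>f (g \<otimes> h)\<bar> \<le> K"
  shows "\<E> (pmf_conv G a b) f =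
    \<E> a (\<lambda>g. \<E> b (\<lambda>h. f (g \<otimes> h)))"
  unfolding pmf_conv_def integral_map_pmf
  by (subst expectation_pair_pmf_bounded[where K=K]) (auto simp: assms)

lemma harmonic_conv_pow:
  assumes b: "\<And>g. g \<in> carrier G \<Longrightarrow> \<bar>v g\<bar> \<le> (K :: real)"
    and harm: "\<And>g. g \<in> carrier G \<Longrightarrow> \<E> q (\<lambda>s. v (s \<otimes> g)) = v g"
    and g: "g \<in> carrier G"
  shows "\<E> (conv_pow n) (\<lambda>s. v (s \<otimes> g)) = v g"
  using g
proof (induction n arbitrary: g)
  case (Suc n)
  have "\<E> (conv_pow (Suc n)) (\<lambda>s. v (s \<otimes> g)) =
      \<E> (conv_pow n) (\<lambda>h. \<E> q (\<lambda>s. v ((h \<otimes> s) \<otimes> g)))"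
    unfolding conv_pow_Suc'
    by (rule expectation_pmf_conv[where K=K]) (auto intro!: b Suc.prems simp: q_closed conv_pow_closed)
  also have "\<dots> = \<E> q (\<lambda>s. \<E> (conv_pow n) (\<lambda>h. v ((h \<otimes> s) \<otimes> g)))"
    by (rule expectation_pmf_swap[where K=K])
       (auto intro!: b Suc.prems simp: q_closed conv_pow_closed)
  also have "\<dots> = \<E> q (\<lambda>s. \<E> (conv_pow n) (\<lambda>h. v (h \<otimes> (s \<otimes> g))))"
    by (intro expectation_pmf_cong) (simp add: m_assoc q_closed conv_pow_closed Suc.prems)
  also have "\<dots> = \<E> q (\<lambda>s. v (s \<otimes> g))"
    by (intro expectation_pmf_cong Suc.IH) (simp add: q_closed Suc.prems)
  also have "\<dots> = v g" by (rule harm) (rule Suc.prems)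
  finally show ?case .
qed (simp add: g)

text \<open>Along the random walk a bounded harmonic function is a bounded martingale: its increments
  are orthogonal.\<close>

lemma harmonic_square_increment:
  fixes v :: "'a \<Rightarrow> real"
  assumes b: "\<And>g. g \<in> carrier G \<Longrightarrow> \<bar>v g\<bar> \<le> K"
    and harm: "\<And>g. g \<in> carrier G \<Longrightarrow> \<E> q (\<lambda>s. v (s \<otimes> g)) = v g"
  shows "\<E> (conv_pow n)
      (\<lambda>g. \<E> (conv_pow k) (\<lambda>s. (v (s \<otimes> g) - v g)\<^sup>2)) =
    \<E> (conv_pow (k + n)) (\<lambda>g. (v g)\<^sup>2) -
    \<E> (conv_pow n) (\<lambda>g. (v g)\<^sup>2)" (is "?l = ?a (k + n) - ?a n")
proof -
  have b2: "(v g)\<^sup>2 \<le> K\<^sup>2" if "g \<in> carrier G" for g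
    using b[OF that] abs_le_square_iff[of "v g" K] by auto
  have eq: "\<E> (conv_pow k) (\<lambda>s. (v (s \<otimes> g) - v g)\<^sup>2)
      = \<E> (conv_pow k) (\<lambda>s. (v (s \<otimes> g))\<^sup>2) - (v g)\<^sup>2"
    if g: "g \<in> carrier G" for g
  proof -
    have i1: "integrable (conv_pow k) (\<lambda>s. (v (s \<otimes> g))\<^sup>2)"
      by (rule integrable_pmf_bounded[where K="K\<^sup>2"]) (simp add: b2 g conv_pow_closed)
    have i2: "integrable (conv_pow k) (\<lambda>s. v (s \<otimes> g))"
      by (rule integrable_pmf_bounded[where K=K]) (simp add: b g conv_pow_closed)
    have "\<E> (conv_pow k) (\<lambda>s. (v (s \<otimes> g) - v g)\<^sup>2)
      = \<E> (conv_pow k) (\<lambda>s. (v (s \<otimes> g))\<^sup>2 - (2 * v g * v (s \<otimes> g) - (v g)\<^sup>2))"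
      by (rule arg_cong[where f="\<E> _"]) (rule ext, simp add: power2_eq_square algebra_simps)
    also have "\<dots> = \<E> (conv_pow k) (\<lambda>s. (v (s \<otimes> g))\<^sup>2) -
        (2 * v g * \<E> (conv_pow k) (\<lambda>s. v (s \<otimes> g)) - (v g)\<^sup>2)"
      using i1 i2 by simp
    also have "\<E> (conv_pow k) (\<lambda>s. v (s \<otimes> g)) = v g"
      by (rule harmonic_conv_pow[OF b harm g])
    finally show ?thesis by (simp add: power2_eq_square)
  qed
  have "?l = \<E> (conv_pow n)
     (\<lambda>g. \<E> (conv_pow k) (\<lambda>s. (v (s \<otimes> g))\<^sup>2) - (v g)\<^sup>2)"
    by (rule expectation_pmf_cong) (simp add: eq conv_pow_closed)
  also have "\<dots> = \<E> (conv_pow n)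
     (\<lambda>g. \<E> (conv_pow k) (\<lambda>s. (v (s \<otimes> g))\<^sup>2)) - ?a n"
  proof (rule Bochner_Integration.integral_diff; rule integrable_pmf_bounded[where K="K\<^sup>2"])
    fix g assume "g \<in> set_pmf (conv_pow n)"
    then show "\<bar>\<E> (conv_pow k) (\<lambda>s. (v (s \<otimes> g))\<^sup>2)\<bar> \<le> K\<^sup>2"
      by (intro abs_expectation_pmf_le) (simp add: b2 conv_pow_closed)
  qed (simp add: b2 conv_pow_closed)
  also have "\<E> (conv_pow n)
     (\<lambda>g. \<E> (conv_pow k) (\<lambda>s. (v (s \<otimes> g))\<^sup>2)) =
     \<E> (conv_pow k)
     (\<lambda>s. \<E> (conv_pow n) (\<lambda>g. (v (s \<otimes> g))\<^sup>2))"
    by (rule expectation_pmf_swap[where K="K\<^sup>2"])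
       (simp_all add: b2 conv_pow_closed)
  also have "\<dots> = ?a (k + n)"
    unfolding conv_pow_add
    by (rule expectation_pmf_conv[where K="K\<^sup>2", symmetric]) (simp add: b2 conv_pow_closed)
  finally show ?thesis .
qed

lemma harmonic_increments_tendsto_0:
  fixes v :: "'a \<Rightarrow> real"
  assumes b: "\<And>g. g \<in> carrier G \<Longrightarrow> \<bar>v g\<bar> \<le> K"
    and harm: "\<And>g. g \<in> carrier G \<Longrightarrow> \<E> q (\<lambda>s. v (s \<otimes> g)) = v g"
    and j: "j \<in> carrier G"
  shows "(\<lambda>n. \<E> (conv_pow n) (\<lambda>g. \<bar>v (j \<otimes> g) - v g\<bar>)) \<longlonglongrightarrow> 0"
proof -
  obtain k where k: "j \<in> set_pmf (conv_pow k)" using conv_pow_reaches[OF j] by blast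
  define c where "c = pmf (conv_pow k) j"
  have c: "0 < c" using k by (simp add: c_def pmf_positive)
  define a where "a n = \<E> (conv_pow n) (\<lambda>g. (v g)\<^sup>2)" for n
  have inc: "\<E> (conv_pow n)
      (\<lambda>g. \<E> (conv_pow k) (\<lambda>s. (v (s \<otimes> g) - v g)\<^sup>2)) = a (k + n) - a n" for n k
    unfolding a_def by (rule harmonic_square_increment[OF b harm])
  have b2: "\<bar>(v g)\<^sup>2\<bar> \<le> K\<^sup>2" if "g \<in> carrier G" for g
    using b[OF that] abs_le_square_iff[of "v g" K] by auto
  have K0: "0 \<le> K" using b[of \<one>] by simp
  have bd1: "\<bar>v (s \<otimes> g) - v g\<bar> \<le> 2 * K" if "g \<in> carrier G" "s \<in> carrier G" for s g
    using b[of g] b[of "s \<otimes> g"] that K0 by auto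
  have bd: "(v (s \<otimes> g) - v g)\<^sup>2 \<le> (2 * K)\<^sup>2" if "g \<in> carrier G" "s \<in> carrier G" for s g
    using bd1[OF that] abs_le_square_iff[of "v (s \<otimes> g) - v g" "2 * K"] K0 by auto
  have "incseq a"
  proof (rule incseq_SucI)
    fix n
    have "0 \<le> a (1 + n) - a n"
      unfolding inc[symmetric] by (intro Bochner_Integration.integral_nonneg) auto
    then show "a n \<le> a (Suc n)" by simp
  qed
  moreover have "a n \<le> K\<^sup>2" for n
    using abs_expectation_pmf_le[of "conv_pow n" "\<lambda>g. (v g)\<^sup>2" "K\<^sup>2"] b2
    by (auto simp: a_def conv_pow_closed)
  ultimately obtain L where L: "a \<longlonglongrightarrow> L"
    using incseq_convergent[of a "K\<^sup>2"] by blast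
  have "(\<lambda>n. a (n + k)) \<longlonglongrightarrow> L" using L by (rule LIMSEQ_ignore_initial_segment)
  with L have "(\<lambda>n. (a (n + k) - a n) / c) \<longlonglongrightarrow> (L - L) / c"
    by (intro tendsto_intros) (use c in auto)
  then have lim: "(\<lambda>n. sqrt ((a (k + n) - a n) / c)) \<longlonglongrightarrow> 0"
    using tendsto_real_sqrt[of "\<lambda>n. (a (n + k) - a n) / c" 0 sequentially] by (simp add: add.commute)
  have "\<E> (conv_pow n) (\<lambda>g. \<bar>v (j \<otimes> g) - v g\<bar>) \<le> sqrt ((a (k + n) - a n) / c)" for n
  proof (rule real_le_rsqrt)
    let ?X = "\<lambda>g. \<bar>v (j \<otimes> g) - v g\<bar>"
    have i2: "integrable (conv_pow n) (\<lambda>g. (?X g)\<^sup>2)"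
      by (rule integrable_pmf_bounded[where K="(2 * K)\<^sup>2"]) (use bd j in \<open>simp add: conv_pow_closed\<close>)
    have "0 \<le> measure_pmf.variance (conv_pow n) ?X"
      by (rule measure_pmf.variance_positive)
    also have "\<dots> = \<E> (conv_pow n) (\<lambda>g. (?X g)\<^sup>2) - (\<E> (conv_pow n) ?X)\<^sup>2"
      by (rule measure_pmf.variance_eq)
         (use i2 bd1 j in \<open>auto intro!: integrable_pmf_bounded[where K="2 * K"] simp: conv_pow_closed\<close>)
    finally have "(\<E> (conv_pow n) ?X)\<^sup>2 \<le> \<E> (conv_pow n) (\<lambda>g. (?X g)\<^sup>2)"
      by simp
    also have "\<dots> \<le> \<E> (conv_pow n)
        (\<lambda>g. \<E> (conv_pow k) (\<lambda>s. (v (s \<otimes> g) - v g)\<^sup>2) / c)"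
    proof (rule integral_mono_AE[OF i2])
      show "integrable (conv_pow n) (\<lambda>g. \<E> (conv_pow k) (\<lambda>s. (v (s \<otimes> g) - v g)\<^sup>2) / c)"
        by (intro integrable_divide integrable_pmf_bounded[where K="(2 * K)\<^sup>2"] abs_expectation_pmf_le)
           (use bd in \<open>simp add: conv_pow_closed\<close>)
      have "c * (v (j \<otimes> g) - v g)\<^sup>2 \<le> \<E> (conv_pow k) (\<lambda>s. (v (s \<otimes> g) - v g)\<^sup>2)"
        if "g \<in> carrier G" for g
        unfolding c_def
        by (rule pmf_times_le_expectation[where K="(2 * K)\<^sup>2" and f="\<lambda>s. (v (s \<otimes> g) - v g)\<^sup>2"]) (use bd k that in \<open>auto simp: conv_pow_closed\<close>)
      then show "AE g in conv_pow n. (?X g)\<^sup>2 \<le>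
          \<E> (conv_pow k) (\<lambda>s. (v (s \<otimes> g) - v g)\<^sup>2) / c"
        using c by (auto simp: AE_measure_pmf_iff conv_pow_closed field_simps)
    qed
    also have "\<dots> = (a (k + n) - a n) / c"
      using inc[of n k] by simp
    finally show "(\<E> (conv_pow n) ?X)\<^sup>2 \<le> (a (k + n) - a n) / c" .
  qed
  then show ?thesis
    by (intro tendsto_sandwich[OF _ _ tendsto_const lim]) (auto intro!: always_eventually)
qed

text \<open>For a quasimorphism \<open>\<phi>\<close>, symmetry of the walk keeps the mean of \<open>\<phi>\<close> bounded in time:
  \<open>\<phi> g + \<phi> (inv g)\<close> is uniformly bounded.\<close>

lemma quasimorphism_conv_pow:
  fixes \<phi> :: "'a \<Rightarrow> real"
  assumes qm: "\<And>g h. g \<in> carrier G \<Longrightarrow> h \<in> carrier G \<Longrightarrow> \<bar>\<phi> (g \<otimes> h) - \<phi> g - \<phi> h\<bar> \<le> C"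
    and int: "integrable q \<phi>"
  shows "integrable (conv_pow n) \<phi>"
    and "\<bar>\<E> (conv_pow n) \<phi>\<bar> \<le> C + \<bar>\<phi> \<one>\<bar>"
proof -
  show i: "integrable (conv_pow n) \<phi>" for n
  proof (induction n)
    case 0 show ?case by (rule integrable_pmf_bounded[where K="\<bar>\<phi> \<one>\<bar>"]) simp
  next
    case (Suc n)
    let ?pp = "pair_pmf q (conv_pow n)"
    have "integrable ?pp (\<lambda>z. \<phi> (fst z))" "integrable ?pp (\<lambda>z. \<phi> (snd z))"
      using int Suc integrable_map_pmf_eq[of fst ?pp \<phi>] integrable_map_pmf_eq[of snd ?pp \<phi>]
      by (simp_all add: map_fst_pair_pmf map_snd_pair_pmf)
    moreover have "integrable ?pp (\<lambda>z. \<phi> (fst z \<otimes> snd z) - \<phi> (fst z) - \<phi> (snd z))"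
      by (rule integrable_pmf_bounded[where K=C]) (auto intro!: qm simp: q_closed conv_pow_closed)
    ultimately have "integrable ?pp (\<lambda>z. (\<phi> (fst z \<otimes> snd z) - \<phi> (fst z) - \<phi> (snd z)) + \<phi> (fst z) + \<phi> (snd z))"
      by (intro Bochner_Integration.integrable_add)
    then show ?case
      by (simp add: pmf_conv_def integrable_map_pmf_eq case_prod_beta')
  qed
  let ?E = "\<E> (conv_pow n)"
  have "?E \<phi> = \<E> (map_pmf (m_inv G) (conv_pow n)) \<phi>"
    by (simp add: inv_conv_pow)
  then have E: "?E \<phi> = ?E (\<lambda>g. \<phi> (inv g))" by simp
  have i': "integrable (conv_pow n) (\<lambda>g. \<phi> (inv g))"
    using i[of n] integrable_map_pmf_eq[of "m_inv G" "conv_pow n" \<phi>] by (simp add: inv_conv_pow)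
  have "2 * ?E \<phi> = ?E (\<lambda>g. \<phi> g + \<phi> (inv g))"
    using i i' E by simp
  also have "\<bar>\<dots>\<bar> \<le> C + \<bar>\<phi> \<one>\<bar>"
  proof (rule abs_expectation_pmf_le)
    fix g assume "g \<in> set_pmf (conv_pow n)"
    then show "\<bar>\<phi> g + \<phi> (inv g)\<bar> \<le> C + \<bar>\<phi> \<one>\<bar>"
      using qm[of g "inv g"] by (simp add: conv_pow_closed)
  qed
  finally show "\<bar>?E \<phi>\<bar> \<le> C + \<bar>\<phi> \<one>\<bar>" by simp
qed

lemma walk_closed: "(\<And>i. \<omega> i \<in> carrier G) \<Longrightarrow> walk G \<omega> n \<in> carrier G"
  by (induction n) auto

lemma walk_case_nat:
  assumes "s \<in> carrier G" "\<And>i. \<omega> i \<in> carrier G"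
  shows "walk G (case_nat s \<omega>) (Suc n) = s \<otimes> walk G \<omega> n"
proof (induction n)
  case (Suc n)
  have "walk G (case_nat s \<omega>) (Suc (Suc n)) = walk G (case_nat s \<omega>) (Suc n) \<otimes> \<omega> n" by simp
  also have "\<dots> = s \<otimes> walk G \<omega> (Suc n)"
    unfolding Suc using assms by (simp add: m_assoc walk_closed)
  finally show ?case .
qed (use assms in simp)

lemma measurable_walk:
  assumes q': "sets q' = sets (count_space (carrier G))" and ctb: "countable (carrier G)"
  shows "(\<lambda>\<omega>. walk G \<omega> n) \<in> measurable (Pi\<^sub>M UNIV (\<lambda>_::nat. q')) (count_space (carrier G))"
proof (induction n)
  case (Suc n)
  let ?C = "count_space (carrier G)"
  have c: "(\<lambda>\<omega>. \<omega> n) \<in> measurable (Pi\<^sub>M UNIV (\<lambda>_::nat. q')) ?C"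
    by (subst measurable_cong_sets[OF refl q'[symmetric]]) simp
  have "(\<lambda>(g, h). g \<otimes> h) \<in> measurable (?C \<Otimes>\<^sub>M ?C) ?C"
    by (subst pair_measure_countable[OF ctb ctb]) auto
  from measurable_compose[OF measurable_Pair[OF Suc c] this] show ?case by simp
qed auto

text \<open>The law of the walk at time \<open>n\<close> is the \<open>n\<close>-th convolution power. The first increment is split off,
  since this is the recursion by which convolution powers are defined.\<close>

lemma expectation_walk:
  fixes f :: "'a \<Rightarrow> real"
  assumes q': "prob_space q'" "sets q' = sets (count_space (carrier G))"
    and eq: "\<And>f :: 'a \<Rightarrow> real. integral\<^sup>L q' f = \<E> q f"
    and ctb: "countable (carrier G)"
    and b: "\<And>g. g \<in> carrier G \<Longrightarrow> \<bar>f g\<bar> \<le> K"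
  shows "(\<integral>\<omega>. f (walk G \<omega> n) \<partial>Pi\<^sub>M UNIV (\<lambda>_::nat. q')) = \<E> (conv_pow n) f"
proof -
  let ?P = "Pi\<^sub>M UNIV (\<lambda>_::nat. q')"
  interpret q': prob_space q' by fact
  interpret sequence_space q' ..
  interpret P: prob_space ?P by (rule prob_space_PiM) (rule q')
  interpret qP: pair_prob_space q' ?P ..
  have sq: "space q' = carrier G" using sets_eq_imp_space_eq[OF q'(2)] by simp
  note m = measurable_walk[OF q'(2) ctb]
  show "(\<integral>\<omega>. f (walk G \<omega> n) \<partial>?P) = \<E> (conv_pow n) f"
    using b
  proof (induction n arbitrary: f)
    case 0
    then show ?case by (simp add: P.prob_space)
  next
    case (Suc n)
    have fm: "(\<lambda>\<omega>. f (walk G \<omega> n)) \<in> borel_measurable ?P" for n and f :: "'a \<Rightarrow> real"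
      using m by (rule measurable_compose) simp
    have mi: "(\<lambda>(s, \<omega>). case_nat s \<omega>) \<in> measurable (q' \<Otimes>\<^sub>M ?P) ?P" by measurable
    have "(\<integral>\<omega>. f (walk G \<omega> (Suc n)) \<partial>?P) =
      (\<integral>\<omega>. f (walk G \<omega> (Suc n)) \<partial>distr (q' \<Otimes>\<^sub>M ?P) ?P (\<lambda>(s, \<omega>). case_nat s \<omega>))"
      by (simp only: PiM_iter)
    also have "\<dots> = (\<integral>z. f (walk G (case_nat (fst z) (snd z)) (Suc n)) \<partial>(q' \<Otimes>\<^sub>M ?P))"
      by (subst integral_distr[OF mi fm]) (simp add: case_prod_beta' del: walk.simps)
    also have "\<dots> = (\<integral>s. (\<integral>\<omega>. f (walk G (case_nat s \<omega>) (Suc n)) \<partial>?P) \<partial>q')"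
    proof (subst qP.integral_fst'[symmetric])
      show "integrable (q' \<Otimes>\<^sub>M ?P) (\<lambda>z. f (walk G (case_nat (fst z) (snd z)) (Suc n)))"
      proof (rule qP.P.integrable_const_bound[where B=K])
        show "(\<lambda>z. f (walk G (case_nat (fst z) (snd z)) (Suc n))) \<in> borel_measurable (q' \<Otimes>\<^sub>M ?P)"
          using measurable_compose[OF mi fm] by (simp add: case_prod_beta' del: walk.simps)
        show "AE z in q' \<Otimes>\<^sub>M ?P. norm (f (walk G (case_nat (fst z) (snd z)) (Suc n))) \<le> K"
          by (intro AE_I2)
             (auto simp: space_pair_measure space_PiM sq PiE_iff simp del: walk.simps
               intro!: Suc.prems walk_closed split: nat.split)
      qed
    qed simp
    also have "\<dots> = (\<integral>s. (\<integral>\<omega>. f (s \<otimes> walk G \<omega> n) \<partial>?P) \<partial>q')"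
      by (intro Bochner_Integration.integral_cong refl)
         (subst walk_case_nat, auto simp: space_PiM sq PiE_iff)
    also have "\<dots> = (\<integral>s. \<E> (conv_pow n) (\<lambda>g. f (s \<otimes> g)) \<partial>q')"
      by (intro Bochner_Integration.integral_cong refl Suc.IH) (auto simp: sq intro!: Suc.prems)
    also have "\<dots> = \<E> q (\<lambda>s. \<E> (conv_pow n) (\<lambda>g. f (s \<otimes> g)))"
      by (rule eq)
    also have "\<dots> = \<E> (conv_pow (Suc n)) f"
      unfolding conv_pow.simps
      by (rule expectation_pmf_conv[symmetric, where K=K]) (auto intro!: Suc.prems simp: q_closed conv_pow_closed)
    finally show ?case .
  qed
qed

end

section \<open>Stationary spaces and cocycles\<close>

text \<open>A measure stationary under a symmetric walk. Stationarity is assumed in integrated form, for bounded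
  measurable functions.\<close>

locale stationary_space = symmetric_walk G q + prob_space M
  for G (structure) and q and M :: "'x measure" +
  fixes act :: "'a \<Rightarrow> 'x \<Rightarrow> 'x"
  assumes act_meas: "g \<in> carrier G \<Longrightarrow> act g \<in> measurable M M"
    and act_mult: "g \<in> carrier G \<Longrightarrow> h \<in> carrier G \<Longrightarrow> x \<in> space M \<Longrightarrow> act (g \<otimes> h) x = act g (act h x)"
    and stat: "f \<in> borel_measurable M \<Longrightarrow> (\<And>x. x \<in> space M \<Longrightarrow> \<bar>f x :: real\<bar> \<le> K) \<Longrightarrow>
      integral\<^sup>L M f = \<E> q (\<lambda>g. \<integral>x. f (act g x) \<partial>M)"
begin

lemma act_space: "g \<in> carrier G \<Longrightarrow> x \<in> space M \<Longrightarrow> act g x \<in> space M"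
  using measurable_space[OF act_meas] .

lemma integrable_bounded:
  fixes f :: "'x \<Rightarrow> real"
  assumes "f \<in> borel_measurable M" "\<And>x. x \<in> space M \<Longrightarrow> \<bar>f x\<bar> \<le> K"
  shows "integrable M f"
  by (rule integrable_const_bound[where B=K]) (auto simp: assms)

lemma abs_integral_le:
  fixes f :: "'x \<Rightarrow> real"
  assumes "f \<in> borel_measurable M" "\<And>x. x \<in> space M \<Longrightarrow> \<bar>f x\<bar> \<le> K"
  shows "\<bar>integral\<^sup>L M f\<bar> \<le> K"
proof -
  have "\<bar>integral\<^sup>L M f\<bar> \<le> (\<integral>x. \<bar>f x\<bar> \<partial>M)" by (rule integral_abs_bound)
  also have "\<dots> \<le> (\<integral>x. K \<partial>M)"
    by (rule integral_mono) (simp_all add: integrable_bounded[OF assms] assms(2))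
  finally show ?thesis by (simp add: prob_space)
qed

lemma act_comp_meas:
  assumes "f \<in> borel_measurable M" "g \<in> carrier G"
  shows "(\<lambda>x. f (act g x)) \<in> borel_measurable M"
  using measurable_compose[OF act_meas[OF assms(2)] assms(1)] .

lemma stat_conv_pow:
  assumes "f \<in> borel_measurable M" "\<And>x. x \<in> space M \<Longrightarrow> \<bar>f x :: real\<bar> \<le> K"
  shows "integral\<^sup>L M f = \<E> (conv_pow n) (\<lambda>g. \<integral>x. f (act g x) \<partial>M)"
  using assms
proof (induction n arbitrary: f)
  case 0
  have "(\<integral>x. f (act \<one> x) \<partial>M) = (\<integral>x. f x \<partial>M)"
  proof -
    have eq: "(\<integral>x. f (act s x) \<partial>M) = (\<integral>x. f (act \<one> (act s x)) \<partial>M)" if "s \<in> set_pmf q" for s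
      using that by (intro Bochner_Integration.integral_cong) (auto simp flip: act_mult simp: q_closed)
    have "(\<integral>x. f x \<partial>M) = \<E> q (\<lambda>s. \<integral>x. f (act s x) \<partial>M)"
      by (rule stat[OF 0])
    also have "\<dots> = \<E> q (\<lambda>s. \<integral>x. f (act \<one> (act s x)) \<partial>M)"
      by (rule expectation_pmf_cong) (rule eq)
    also have "\<dots> = (\<integral>x. f (act \<one> x) \<partial>M)"
      by (rule stat[symmetric, where K=K]) (auto intro: act_comp_meas 0 act_space)
    finally show ?thesis by simp
  qed
  then show ?case by simp
next
  case (Suc n)
  have "integral\<^sup>L M f = \<E> (conv_pow n) (\<lambda>g. \<integral>x. f (act g x) \<partial>M)"
    by (rule Suc.IH[OF Suc.prems])
  also have "\<dots> = \<E> (conv_pow n)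
      (\<lambda>g. \<E> q (\<lambda>s. \<integral>x. f (act (g \<otimes> s) x) \<partial>M))"
  proof (rule expectation_pmf_cong)
    fix g assume g: "g \<in> set_pmf (conv_pow n)"
    have "(\<integral>x. f (act g x) \<partial>M) = \<E> q (\<lambda>s. \<integral>x. f (act g (act s x)) \<partial>M)"
      using g by (intro stat[where K=K] act_comp_meas Suc.prems) (auto simp: conv_pow_closed act_space)
    also have "\<dots> = \<E> q (\<lambda>s. \<integral>x. f (act (g \<otimes> s) x) \<partial>M)"
      using g by (intro expectation_pmf_cong Bochner_Integration.integral_cong)
        (auto simp: conv_pow_closed act_mult q_closed)
    finally show "(\<integral>x. f (act g x) \<partial>M) = \<dots>" .
  qed
  also have "\<dots> = \<E> (conv_pow (Suc n)) (\<lambda>g. \<integral>x. f (act g x) \<partial>M)"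
    unfolding conv_pow_Suc'
    by (rule expectation_pmf_conv[symmetric, where K=K])
       (auto intro!: abs_integral_le act_comp_meas Suc.prems simp: conv_pow_closed q_closed act_space)
  finally show ?case .
qed

lemma integral_average:
  assumes "f \<in> borel_measurable M" "\<And>x. x \<in> space M \<Longrightarrow> \<bar>f x :: real\<bar> \<le> K"
  shows "(\<integral>x. \<E> q (\<lambda>s. f (act s x)) \<partial>M) = integral\<^sup>L M f"
    and "integrable M (\<lambda>x. \<E> q (\<lambda>s. f (act s x)))"
proof -
  have "(\<integral>x. \<E> q (\<lambda>s. f (act s x)) \<partial>M) =
      \<E> q (\<lambda>s. \<integral>x. f (act s x) \<partial>M)"
    by (rule pmf_fubini_bounded[symmetric, where K=K])
       (auto intro!: prob_space_axioms act_comp_meas assms act_space simp: q_closed)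
  also have "\<dots> = integral\<^sup>L M f"
    by (rule stat[OF assms, symmetric])
  finally show "(\<integral>x. \<E> q (\<lambda>s. f (act s x)) \<partial>M) = integral\<^sup>L M f" .
  show "integrable M (\<lambda>x. \<E> q (\<lambda>s. f (act s x)))"
    by (rule integrable_bounded[where K=K])
       (auto intro!: borel_measurable_pmf_expectation act_comp_meas assms abs_expectation_pmf_le act_space
         simp: q_closed)
qed

text \<open>Null sets are preserved because every group element is reached by the walk with positive
  probability.\<close>

lemma quasi_invariant:
  assumes P: "AE x in M. P x" and g: "g \<in> carrier G"
  shows "AE x in M. P (act g x)"
proof -
  obtain N where N: "N \<in> sets M" "emeasure M N = 0" "{x \<in> space M. \<not> P x} \<subseteq> N"
    using AE_E[OF P] by metis
  obtain n where n: "g \<in> set_pmf (conv_pow n)" using conv_pow_reaches[OF g] by blast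
  let ?I = "\<lambda>h. \<integral>x. indicator N (act h x) \<partial>M :: real"
  have im: "(indicator N :: 'x \<Rightarrow> real) \<in> borel_measurable M" using N by simp
  have Ib: "\<bar>?I h\<bar> \<le> 1" if "h \<in> carrier G" for h
    by (rule abs_integral_le[OF act_comp_meas[OF im that]]) (simp add: indicator_def)
  have "pmf (conv_pow n) g * ?I g \<le> \<E> (conv_pow n) ?I"
    by (rule pmf_times_le_expectation[where K=1 and f="?I"])
       (use Ib n conv_pow_closed in \<open>auto intro!: Bochner_Integration.integral_nonneg\<close>)
  also have "\<dots> = (\<integral>x. indicator N x \<partial>M)"
    by (rule stat_conv_pow[OF im, of 1, symmetric]) (simp add: indicator_def)
  also have "\<dots> = 0" using N by (simp add: measure_def)
  finally have "?I g \<le> 0"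
    using pmf_positive[OF n] by (simp add: mult_le_0_iff)
  moreover have "?I g \<ge> 0" by (intro Bochner_Integration.integral_nonneg) auto
  ultimately have "?I g = 0" by simp
  then have "AE x in M. (indicator N (act g x) :: real) = 0"
    using integral_nonneg_eq_0_iff_AE[OF integrable_bounded[OF act_comp_meas[OF im g], of 1]]
    by (simp add: indicator_def)
  then show ?thesis
  proof (rule AE_mp, intro AE_I2 impI)
    fix x assume "x \<in> space M" "(indicator N (act g x) :: real) = 0"
    then show "P (act g x)" using N(3) act_space[OF g] by (auto simp: indicator_def split: if_splits)
  qed
qed

end

text \<open>A measurable real cocycle all of whose trajectories are at uniformly bounded distance from one
  quasimorphism \<open>\<phi>\<close>.\<close>

locale stationary_cocycle = stationary_space G q M act
  for G (structure) and q and M :: "'x measure" and act +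
  fixes c :: "'a \<Rightarrow> 'x \<Rightarrow> real" and \<phi> :: "'a \<Rightarrow> real" and C D :: real
  assumes c_meas: "g \<in> carrier G \<Longrightarrow> c g \<in> borel_measurable M"
    and cocycle: "g \<in> carrier G \<Longrightarrow> h \<in> carrier G \<Longrightarrow> x \<in> space M \<Longrightarrow>
      c (g \<otimes> h) x = c g (act h x) + c h x"
    and near: "g \<in> carrier G \<Longrightarrow> x \<in> space M \<Longrightarrow> \<bar>c g x - \<phi> g\<bar> \<le> C"
    and qm: "g \<in> carrier G \<Longrightarrow> h \<in> carrier G \<Longrightarrow> \<bar>\<phi> (g \<otimes> h) - \<phi> g - \<phi> h\<bar> \<le> D"
    and int: "integrable q \<phi>"
begin

lemmas int_pow = quasimorphism_conv_pow(1)[OF qm int]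
lemmas mean_pow = quasimorphism_conv_pow(2)[OF qm int]

lemma int_diff_pow:
  assumes "x \<in> space M"
  shows "integrable (conv_pow n) (\<lambda>g. c g x - \<phi> g)"
  by (rule integrable_pmf_bounded[where K=C]) (simp add: near assms conv_pow_closed)

lemma int_c_pow:
  assumes "x \<in> space M"
  shows "integrable (conv_pow n) (\<lambda>g. c g x)"
  using Bochner_Integration.integrable_add[OF int_diff_pow[OF assms] int_pow] by simp

lemma int_c: "x \<in> space M \<Longrightarrow> integrable q (\<lambda>g. c g x)"
  using int_c_pow[of x 1] unfolding conv_pow_1 .

text \<open>The mean of the cocycle at time \<open>n\<close>, and over a single step.\<close>

definition mean :: "nat \<Rightarrow> 'x \<Rightarrow> real" where
  "mean n x = \<E> (conv_pow n) (\<lambda>g. c g x)"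

definition step :: "'x \<Rightarrow> real" where
  "step x = \<E> q (\<lambda>g. c g x)"

lemma mean_meas [measurable]: "mean n \<in> borel_measurable M"
  unfolding mean_def by (intro borel_measurable_pmf_expectation c_meas conv_pow_closed)

lemma mean_bound:
  assumes x: "x \<in> space M"
  shows "\<bar>mean n x\<bar> \<le> C + D + \<bar>\<phi> \<one>\<bar>"
proof -
  have "mean n x = \<E> (conv_pow n) (\<lambda>g. c g x - \<phi> g) +
      \<E> (conv_pow n) \<phi>"
    unfolding mean_def using int_c_pow[OF x] int_pow by simp
  moreover have "\<bar>\<E> (conv_pow n) (\<lambda>g. c g x - \<phi> g)\<bar> \<le> C"
    by (rule abs_expectation_pmf_le) (simp add: near x conv_pow_closed)
  ultimately show ?thesis using mean_pow[of n] by simp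
qed

lemma step_eq: "step = mean 1"
  by (rule ext) (simp add: step_def mean_def conv_pow_1[simplified])

text \<open>The cocycle itself need not be bounded along the walk, so the interchange of the two averages
  is applied only to its bounded part.\<close>

lemma mean_Suc:
  assumes x: "x \<in> space M"
  shows "mean (Suc n) x = \<E> q (\<lambda>s. mean n (act s x)) + step x"
proof -
  let ?pp = "pair_pmf (conv_pow n) q"
  have sx: "act s x \<in> space M" if "s \<in> set_pmf q" for s using act_space x that q_closed by blast
  have i1: "integrable ?pp (\<lambda>z. \<phi> (fst z))"
    using int_pow[of n] integrable_map_pmf_eq[of fst ?pp \<phi>] by (simp add: map_fst_pair_pmf)
  have i2: "integrable ?pp (\<lambda>z. c (snd z) x)"
    using int_c[OF x] integrable_map_pmf_eq[of snd ?pp "\<lambda>g. c g x"] by (simp add: map_snd_pair_pmf)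
  have b: "\<bar>c (g \<otimes> s) x - \<phi> g - c s x\<bar> \<le> C" if "g \<in> set_pmf (conv_pow n)" "s \<in> set_pmf q" for g s
    using near[of g "act s x"] sx that x by (simp add: cocycle conv_pow_closed q_closed)
  have i3: "integrable ?pp (\<lambda>z. c (fst z \<otimes> snd z) x - \<phi> (fst z) - c (snd z) x)"
    by (rule integrable_pmf_bounded[where K=C]) (use b in auto)
  have "mean (Suc n) x = \<E> ?pp (\<lambda>z. c (fst z \<otimes> snd z) x)"
    unfolding mean_def conv_pow_Suc' pmf_conv_def by (simp add: case_prod_beta')
  also have "\<dots> = \<E> ?pp
      (\<lambda>z. (c (fst z \<otimes> snd z) x - \<phi> (fst z) - c (snd z) x) + \<phi> (fst z) + c (snd z) x)"
    by simp
  also have "\<dots> = \<E> ?pp (\<lambda>z. c (fst z \<otimes> snd z) x - \<phi> (fst z) - c (snd z) x) +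
      \<E> ?pp (\<lambda>z. \<phi> (fst z)) + \<E> ?pp (\<lambda>z. c (snd z) x)"
    using i1 i2 i3 by (simp only: Bochner_Integration.integral_add Bochner_Integration.integrable_add)
  also have "\<dots> = \<E> ?pp (\<lambda>z. c (fst z \<otimes> snd z) x - \<phi> (fst z) - c (snd z) x) +
      \<E> (conv_pow n) \<phi> + step x"
    by (simp only: expectation_pair_pmf_fst expectation_pair_pmf_snd[where f="\<lambda>g. c g x"] step_def)
  also have "\<E> ?pp (\<lambda>z. c (fst z \<otimes> snd z) x - \<phi> (fst z) - c (snd z) x) =
      \<E> (conv_pow n) (\<lambda>g. \<E> q (\<lambda>s. c (g \<otimes> s) x - \<phi> g - c s x))"
    by (subst expectation_pair_pmf_bounded[where K=C]) (use b in auto)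
  also have "\<dots> = \<E> q (\<lambda>s. \<E> (conv_pow n) (\<lambda>g. c (g \<otimes> s) x - \<phi> g - c s x))"
    by (rule expectation_pmf_swap[where K=C]) (use b in auto)
  also have "\<dots> = \<E> q
     (\<lambda>s. mean n (act s x) - \<E> (conv_pow n) \<phi>)"
  proof (rule expectation_pmf_cong)
    fix s assume s: "s \<in> set_pmf q"
    have "\<E> (conv_pow n) (\<lambda>g. c (g \<otimes> s) x - \<phi> g - c s x) =
        \<E> (conv_pow n) (\<lambda>g. c g (act s x) - \<phi> g)"
      by (rule expectation_pmf_cong) (simp add: cocycle conv_pow_closed q_closed s x)
    also have "\<dots> = mean n (act s x) - \<E> (conv_pow n) \<phi>"
      unfolding mean_def using int_c_pow[OF sx[OF s]] int_pow by simp
    finally show "\<E> (conv_pow n) (\<lambda>g. c (g \<otimes> s) x - \<phi> g - c s x) = \<dots>" .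
  qed
  also have "\<dots> = \<E> q (\<lambda>s. mean n (act s x)) - \<E> (conv_pow n) \<phi>"
    by (subst Bochner_Integration.integral_diff)
       (auto intro!: integrable_pmf_bounded[where K="C + D + \<bar>\<phi> \<one>\<bar>"] mean_bound sx)
  finally show ?thesis by simp
qed

text \<open>The drift vanishes, since the integral of the mean is both linear and bounded in time.\<close>

lemma integral_step_zero: "integral\<^sup>L M step = 0"
proof -
  let ?B = "C + D + \<bar>\<phi> \<one>\<bar>"
  have ii: "integrable M (mean n)" for n by (rule integrable_bounded[OF mean_meas mean_bound])
  have ist: "integrable M step" using ii[of 1] by (simp add: step_eq)
  have lin: "integral\<^sup>L M (mean (Suc n)) = real (Suc n) * integral\<^sup>L M step" for n
  proof (induction n)
    case 0 show ?case by (simp add: step_eq)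
  next
    case (Suc n)
    have "integral\<^sup>L M (mean (Suc (Suc n))) =
        (\<integral>x. \<E> q (\<lambda>s. mean (Suc n) (act s x)) + step x \<partial>M)"
      by (rule Bochner_Integration.integral_cong) (simp_all add: mean_Suc)
    also have "\<dots> = integral\<^sup>L M (mean (Suc n)) + integral\<^sup>L M step"
      using integral_average[OF mean_meas mean_bound] ist by simp
    finally show ?case using Suc by (simp add: algebra_simps)
  qed
  have bd: "real (Suc n) * \<bar>integral\<^sup>L M step\<bar> \<le> ?B" for n
    using abs_integral_le[OF mean_meas mean_bound, of "Suc n"] unfolding lin by (simp add: abs_mult)
  show ?thesis
  proof (rule ccontr)
    assume "integral\<^sup>L M step \<noteq> 0"
    then obtain n where "?B < real n * \<bar>integral\<^sup>L M step\<bar>"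
      using reals_Archimedean3[of "\<bar>integral\<^sup>L M step\<bar>"] by auto
    also have "\<dots> \<le> real (Suc n) * \<bar>integral\<^sup>L M step\<bar>" by (intro mult_right_mono) auto
    finally show False using bd[of n] by simp
  qed
qed

text \<open>The cocycle is cohomologous to one whose mean over a step vanishes almost everywhere. The transfer
  function is the upper limit of the means: it satisfies the cohomological equation as an inequality,
  and both sides have the same integral.\<close>

lemma exists_transfer_function:
  obtains \<kappa> where "\<kappa> \<in> borel_measurable M"
    and "\<And>x. x \<in> space M \<Longrightarrow> \<bar>\<kappa> x\<bar> \<le> C + D + \<bar>\<phi> \<one>\<bar>"
    and "AE x in M. \<E> q (\<lambda>s. c s x + \<kappa> (act s x) - \<kappa> x) = 0"
proof -
  define B where "B = C + D + \<bar>\<phi> \<one>\<bar>"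
  define S where "S N x = (SUP n\<in>{N..}. mean n x)" for N x
  define \<kappa> where "\<kappa> x = lim (\<lambda>N. S N x)" for x
  note mb = mean_bound[folded B_def]
  have bdd: "bdd_above ((\<lambda>n. mean n x) ` A)" if "x \<in> space M" for x A
    using mb[OF that] by (intro bdd_aboveI[of _ B]) (auto simp: abs_le_iff)
  have Smeas [measurable]: "S N \<in> borel_measurable M" for N
    unfolding S_def by (rule borel_measurable_cSUP) (auto simp: bdd)
  have Sb: "\<bar>S N x\<bar> \<le> B" if x: "x \<in> space M" for N x
  proof -
    have "S N x \<le> B" unfolding S_def
      by (rule cSUP_least) (use mb[OF x] in \<open>auto simp: abs_le_iff\<close>)
    moreover have "mean N x \<le> S N x" unfolding S_def
      by (rule cSUP_upper) (auto simp: bdd x)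
    ultimately show ?thesis using mb[OF x, of N] by (simp add: abs_le_iff)
  qed
  have lim: "(\<lambda>N. S N x) \<longlonglongrightarrow> \<kappa> x" if x: "x \<in> space M" for x
  proof -
    have "decseq (\<lambda>N. S N x)"
      unfolding decseq_def S_def by (auto intro!: cSUP_subset_mono simp: bdd x)
    moreover have "-B \<le> S N x" for N using Sb[OF x, of N] by (simp add: abs_le_iff)
    ultimately have "convergent (\<lambda>N. S N x)"
      using decseq_convergent by (metis convergentI)
    then show ?thesis unfolding \<kappa>_def by (simp add: convergent_LIMSEQ_iff)
  qed
  have \<kappa>_meas [measurable]: "\<kappa> \<in> borel_measurable M"
    unfolding \<kappa>_def by measurable
  have \<kappa>_b: "\<bar>\<kappa> x\<bar> \<le> B" if x: "x \<in> space M" for x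
    by (rule LIMSEQ_le_const2[OF tendsto_rabs[OF lim[OF x]]]) (use Sb[OF x] in auto)
  let ?A = "\<lambda>f x. \<E> q (\<lambda>s. f (act s x)) :: real"
  have ineq: "\<kappa> x \<le> ?A \<kappa> x + step x" if x: "x \<in> space M" for x
  proof -
    have sx: "act s x \<in> space M" if "s \<in> set_pmf q" for s using act_space x that q_closed by blast
    have "S (Suc N) x \<le> ?A (S N) x + step x" for N
      unfolding S_def[of "Suc N"]
    proof (rule cSUP_least)
      fix n assume "n \<in> {Suc N..}"
      then obtain k where k: "n = Suc k" "k \<ge> N" by (cases n) auto
      have "?A (mean k) x \<le> ?A (S N) x"
      proof (rule integral_mono_AE)
        show "AE s in q. mean k (act s x) \<le> S N (act s x)"
          unfolding S_def using k by (auto simp: AE_measure_pmf_iff intro!: cSUP_upper bdd sx)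
      qed (auto intro!: integrable_pmf_bounded[where K=B] mb sx Sb)
      then show "mean n x \<le> ?A (S N) x + step x"
        using mean_Suc[OF x, of k] k by simp
    qed auto
    moreover have "(\<lambda>N. S (Suc N) x) \<longlonglongrightarrow> \<kappa> x"
      using lim[OF x] by (rule LIMSEQ_Suc)
    moreover have "(\<lambda>N. ?A (S N) x + step x) \<longlonglongrightarrow> ?A \<kappa> x + step x"
    proof (intro tendsto_intros integral_dominated_convergence[where w="\<lambda>_. B"])
      show "AE s in q. (\<lambda>N. S N (act s x)) \<longlonglongrightarrow> \<kappa> (act s x)"
        by (auto simp: AE_measure_pmf_iff intro!: lim sx)
      show "AE s in q. norm (S N (act s x)) \<le> B" for N
        by (auto simp: AE_measure_pmf_iff intro!: Sb sx)
    qed auto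
    ultimately show ?thesis by (intro LIMSEQ_le) auto
  qed
  have i\<kappa>: "integrable M \<kappa>" by (rule integrable_bounded[OF \<kappa>_meas \<kappa>_b])
  have ist: "integrable M step" unfolding step_eq by (rule integrable_bounded[OF mean_meas mean_bound])
  note av = integral_average[OF \<kappa>_meas \<kappa>_b]
  have "(\<integral>x. ?A \<kappa> x + step x - \<kappa> x \<partial>M) = 0"
    using av i\<kappa> ist integral_step_zero by simp
  then have "AE x in M. ?A \<kappa> x + step x - \<kappa> x = 0"
    by (subst (asm) integral_nonneg_eq_0_iff_AE) (use av i\<kappa> ist ineq in auto)
  then have "AE x in M. \<E> q (\<lambda>s. c s x + \<kappa> (act s x) - \<kappa> x) = 0"
  proof (rule AE_mp, intro AE_I2 impI)
    fix x assume x: "x \<in> space M" and e: "?A \<kappa> x + step x - \<kappa> x = 0"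
    have sx: "act s x \<in> space M" if "s \<in> set_pmf q" for s using act_space x that q_closed by blast
    have "integrable q (\<lambda>s. \<kappa> (act s x))"
      by (rule integrable_pmf_bounded[where K=B]) (auto intro!: \<kappa>_b sx)
    then show "\<E> q (\<lambda>s. c s x + \<kappa> (act s x) - \<kappa> x) = 0"
      using int_c[OF x] e by (simp add: step_def)
  qed
  with \<kappa>_meas \<kappa>_b[unfolded B_def] show ?thesis by (rule that)
qed

end

section \<open>Harmonic cocycles\<close>

text \<open>The mean step vanishes at almost every point. By quasi-invariance the trajectory of almost every point
  is then a left harmonic function on the group.\<close>

locale harmonic_cocycle = stationary_cocycle +
  assumes harm: "AE x in M. \<E> q (\<lambda>s. c s x) = 0"
begin

text \<open>The averaged cocycle.\<close>

definition avg :: "'a \<Rightarrow> real" where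
  "avg g = (\<integral>x. c g x \<partial>M)"

lemma c_integrable:
  assumes g: "g \<in> carrier G"
  shows "integrable M (c g)"
  by (rule integrable_bounded[OF c_meas[OF g], of "C + \<bar>\<phi> g\<bar>"]) (use near[OF g] in force)

lemma avg_near:
  assumes g: "g \<in> carrier G"
  shows "\<bar>avg g - \<phi> g\<bar> \<le> C"
proof -
  have "avg g - \<phi> g = (\<integral>x. c g x - \<phi> g \<partial>M)"
    unfolding avg_def using c_integrable[OF g] by (simp add: prob_space)
  also have "\<bar>\<dots>\<bar> \<le> C"
    by (rule abs_integral_le) (use near[OF g] c_meas[OF g] in auto)
  finally show ?thesis .
qed

lemma avg_diff:
  assumes j: "j \<in> carrier G" and g: "g \<in> carrier G"
  shows "avg (j \<otimes> g) - avg g = (\<integral>x. c j (act g x) \<partial>M)"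
proof -
  have "avg (j \<otimes> g) - avg g = (\<integral>x. c (j \<otimes> g) x - c g x \<partial>M)"
    unfolding avg_def using j g by (simp add: c_integrable)
  also have "\<dots> = (\<integral>x. c j (act g x) \<partial>M)"
    by (rule Bochner_Integration.integral_cong) (simp_all add: cocycle j g)
  finally show ?thesis .
qed

lemma avg_diff_bound:
  assumes j: "j \<in> carrier G" and g: "g \<in> carrier G"
  shows "\<bar>avg (j \<otimes> g) - avg g\<bar> \<le> C + \<bar>\<phi> j\<bar>"
  unfolding avg_diff[OF j g]
proof (rule abs_integral_le)
  show "(\<lambda>x. c j (act g x)) \<in> borel_measurable M" by (intro act_comp_meas c_meas j g)
  fix x assume "x \<in> space M"
  then show "\<bar>c j (act g x)\<bar> \<le> C + \<bar>\<phi> j\<bar>" using near[OF j, of "act g x"] act_space[OF g] by auto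
qed

text \<open>By stationarity the increments of the averaged cocycle are right harmonic.\<close>

lemma avg_diff_right_harmonic:
  assumes j: "j \<in> carrier G" and g: "g \<in> carrier G"
  shows "\<E> q (\<lambda>s. avg (j \<otimes> (g \<otimes> s)) - avg (g \<otimes> s)) = avg (j \<otimes> g) - avg g"
proof -
  have m: "(\<lambda>x. c j (act g x)) \<in> borel_measurable M" by (intro act_comp_meas c_meas j g)
  have "avg (j \<otimes> g) - avg g = (\<integral>x. c j (act g x) \<partial>M)" by (rule avg_diff[OF j g])
  also have "\<dots> = \<E> q (\<lambda>s. \<integral>x. c j (act g (act s x)) \<partial>M)"
  proof (rule stat[OF m])
    fix x assume "x \<in> space M"
    then show "\<bar>c j (act g x)\<bar> \<le> C + \<bar>\<phi> j\<bar>" using near[OF j, of "act g x"] act_space[OF g] by auto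
  qed
  also have "\<dots> = \<E> q (\<lambda>s. avg (j \<otimes> (g \<otimes> s)) - avg (g \<otimes> s))"
  proof (rule expectation_pmf_cong)
    fix s assume "s \<in> set_pmf q"
    then have s: "s \<in> carrier G" by (rule q_closed)
    have "(\<integral>x. c j (act g (act s x)) \<partial>M) = (\<integral>x. c j (act (g \<otimes> s) x) \<partial>M)"
      by (rule Bochner_Integration.integral_cong) (simp_all add: act_mult g s)
    then show "(\<integral>x. c j (act g (act s x)) \<partial>M) = avg (j \<otimes> (g \<otimes> s)) - avg (g \<otimes> s)"
      using avg_diff[OF j, of "g \<otimes> s"] g s by simp
  qed
  finally show ?thesis ..
qed

text \<open>Almost everywhere harmonicity passes to the averaged cocycle; \<open>\<phi>\<close> is subtracted to make the
  integrand bounded.\<close>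

lemma avg_left_harmonic:
  assumes g: "g \<in> carrier G"
  shows "\<E> q (\<lambda>s. avg (s \<otimes> g) - avg g) = 0"
proof -
  have i: "integrable q \<phi>" by (rule int)
  have b: "\<bar>c s (act g x) - \<phi> s\<bar> \<le> C" if "s \<in> set_pmf q" "x \<in> space M" for s x
    using near[of s "act g x"] act_space[OF g] that by (simp add: q_closed)
  have m: "(\<lambda>x. c s (act g x)) \<in> borel_measurable M" if "s \<in> set_pmf q" for s
    by (intro act_comp_meas c_meas g q_closed that)
  have i1: "integrable M (\<lambda>x. c s (act g x))" if "s \<in> set_pmf q" for s
  proof (rule integrable_bounded[OF m[OF that], of "C + \<bar>\<phi> s\<bar>"])
    fix x assume "x \<in> space M"
    then show "\<bar>c s (act g x)\<bar> \<le> C + \<bar>\<phi> s\<bar>" using b[OF that, of x] by linarith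
  qed
  have i2: "integrable q (\<lambda>s. avg (s \<otimes> g) - avg g - \<phi> s)"
  proof (rule integrable_pmf_bounded[where K=C])
    fix s assume s: "s \<in> set_pmf q"
    have "avg (s \<otimes> g) - avg g - \<phi> s = (\<integral>x. c s (act g x) - \<phi> s \<partial>M)"
      using i1[OF s] s g by (simp add: avg_diff prob_space q_closed)
    also have "\<bar>\<dots>\<bar> \<le> C" by (rule abs_integral_le) (use b[OF s] m[OF s] in auto)
    finally show "\<bar>avg (s \<otimes> g) - avg g - \<phi> s\<bar> \<le> C" .
  qed
  have "\<E> q (\<lambda>s. avg (s \<otimes> g) - avg g - \<phi> s) =
      \<E> q (\<lambda>s. \<integral>x. c s (act g x) - \<phi> s \<partial>M)"
    using i1 g by (intro expectation_pmf_cong) (simp add: avg_diff prob_space q_closed)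
  also have "\<dots> = (\<integral>x. \<E> q (\<lambda>s. c s (act g x) - \<phi> s) \<partial>M)"
    by (rule pmf_fubini_bounded[where K=C]) (use b m prob_space_axioms in auto)
  also have "\<dots> = (\<integral>x. - \<E> q \<phi> \<partial>M)"
  proof (rule integral_cong_AE)
    show "AE x in M. \<E> q (\<lambda>s. c s (act g x) - \<phi> s) = - \<E> q \<phi>"
      using quasi_invariant[OF harm g]
    proof (rule AE_mp, intro AE_I2 impI)
      fix x assume x: "x \<in> space M" and e: "\<E> q (\<lambda>s. c s (act g x)) = 0"
      show "\<E> q (\<lambda>s. c s (act g x) - \<phi> s) = - \<E> q \<phi>"
        using int_c[OF act_space[OF g x]] i e by simp
    qed
    show "(\<lambda>x. \<E> q (\<lambda>s. c s (act g x) - \<phi> s)) \<in> borel_measurable M"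
      by (rule borel_measurable_pmf_expectation) (use m in auto)
  qed auto
  also have "\<dots> = - \<E> q \<phi>" by (simp add: prob_space)
  finally have "\<E> q (\<lambda>s. (avg (s \<otimes> g) - avg g - \<phi> s) + \<phi> s) = 0"
    using Bochner_Integration.integral_add[OF i2 i] by simp
  then show ?thesis by simp
qed

text \<open>Almost every trajectory of the cocycle differs from the averaged cocycle by a bounded left harmonic
  function, and the increments of such functions vanish along the random walk.\<close>

lemma contraction:
  assumes j: "j \<in> carrier G"
  shows "(\<lambda>n. \<E> (conv_pow n)
    (\<lambda>g. \<integral>x. \<bar>c j (act g x) - (avg (j \<otimes> g) - avg g)\<bar> \<partial>M)) \<longlonglongrightarrow> 0"
proof -
  let ?d = "\<lambda>g x. \<bar>c j (act g x) - (avg (j \<otimes> g) - avg g)\<bar>"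
  let ?K = "2 * (C + \<bar>\<phi> j\<bar>)"
  have db: "?d g x \<le> ?K" if "g \<in> carrier G" "x \<in> space M" for g x
    using near[OF j, of "act g x"] act_space[OF that] avg_diff_bound[OF j that(1)] by auto
  have dm: "?d g \<in> borel_measurable M" if "g \<in> carrier G" for g
    using act_comp_meas[OF c_meas[OF j] that] by measurable
  have eq: "\<E> (conv_pow n) (\<lambda>g. \<integral>x. ?d g x \<partial>M) =
      (\<integral>x. \<E> (conv_pow n) (\<lambda>g. ?d g x) \<partial>M)" for n
    by (rule pmf_fubini_bounded[where K="?K"]) (use db dm prob_space_axioms in \<open>auto simp: conv_pow_closed\<close>)
  have "(\<lambda>n. \<integral>x. \<E> (conv_pow n) (\<lambda>g. ?d g x) \<partial>M) \<longlonglongrightarrow> (\<integral>x. 0 \<partial>M)"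
  proof (rule integral_dominated_convergence[where w="\<lambda>_. ?K"])
    show "AE x in M. norm (\<E> (conv_pow n) (\<lambda>g. ?d g x)) \<le> ?K" for n
    proof (intro AE_I2)
      fix x assume x: "x \<in> space M"
      have "\<bar>\<E> (conv_pow n) (\<lambda>g. ?d g x)\<bar> \<le> ?K"
        by (rule abs_expectation_pmf_le) (use db x in \<open>auto simp: conv_pow_closed\<close>)
      then show "norm (\<E> (conv_pow n) (\<lambda>g. ?d g x)) \<le> ?K" by simp
    qed
    show "(\<lambda>x. \<E> (conv_pow n) (\<lambda>g. ?d g x)) \<in> borel_measurable M" for n
      by (rule borel_measurable_pmf_expectation) (use dm in \<open>auto simp: conv_pow_closed\<close>)
    have ctb: "countable (carrier G)"
    proof (rule countable_subset)
      show "carrier G \<subseteq> (\<Union>n. set_pmf (conv_pow n))" using conv_pow_reaches by blast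
    qed (auto intro: countable_set_pmf)
    have "AE x in M. \<forall>g\<in>carrier G. \<E> q (\<lambda>s. c s (act g x)) = 0"
      by (subst AE_ball_countable[OF ctb]) (intro ballI quasi_invariant[OF harm])
    then show "AE x in M. (\<lambda>n. \<E> (conv_pow n) (\<lambda>g. ?d g x)) \<longlonglongrightarrow> 0"
    proof (rule AE_mp, intro AE_I2 impI)
      fix x assume x: "x \<in> space M"
        and hx: "\<forall>g\<in>carrier G. \<E> q (\<lambda>s. c s (act g x)) = 0"
      define v where "v g = c g x - avg g" for g
      have "(\<lambda>n. \<E> (conv_pow n) (\<lambda>g. \<bar>v (j \<otimes> g) - v g\<bar>)) \<longlonglongrightarrow> 0"
      proof (rule harmonic_increments_tendsto_0[OF _ _ j])
        fix g assume g: "g \<in> carrier G"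
        show vb: "\<bar>v g\<bar> \<le> 2 * C" using near[OF g x] avg_near[OF g] by (auto simp: v_def)
        have vb': "\<bar>v (s \<otimes> g)\<bar> \<le> 2 * C" if "s \<in> set_pmf q" for s
          using near[of "s \<otimes> g", OF _ x] avg_near[of "s \<otimes> g"] g that by (auto simp: v_def q_closed)
        have iv: "integrable q (\<lambda>s. v (s \<otimes> g))"
          by (rule integrable_pmf_bounded[OF vb'])
        have ic: "integrable q (\<lambda>s. c s (act g x))" by (rule int_c[OF act_space[OF g x]])
        have e1: "v (s \<otimes> g) - v g = c s (act g x) - (avg (s \<otimes> g) - avg g)" if "s \<in> set_pmf q" for s
          using cocycle[OF q_closed[OF that] g x] by (simp add: v_def)
        have ia: "integrable q (\<lambda>s. avg (s \<otimes> g) - avg g)"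
        proof -
          have "integrable q (\<lambda>s. c s (act g x) - (v (s \<otimes> g) - v g))" using iv ic by simp
          also have "?this \<longleftrightarrow> integrable q (\<lambda>s. avg (s \<otimes> g) - avg g)"
            by (rule integrable_cong_AE) (auto simp: AE_measure_pmf_iff e1)
          finally show ?thesis .
        qed
        have "\<E> q (\<lambda>s. v (s \<otimes> g)) - v g = \<E> q (\<lambda>s. v (s \<otimes> g) - v g)"
          using iv by simp
        also have "\<dots> = \<E> q (\<lambda>s. c s (act g x) - (avg (s \<otimes> g) - avg g))"
          by (rule expectation_pmf_cong) (rule e1)
        also have "\<dots> = 0"
          using ic ia hx g avg_left_harmonic[OF g] by (subst Bochner_Integration.integral_diff) auto
        finally show "\<E> q (\<lambda>s. v (s \<otimes> g)) = v g" by simp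
      qed
      also have "(\<lambda>n. \<E> (conv_pow n) (\<lambda>g. \<bar>v (j \<otimes> g) - v g\<bar>)) =
          (\<lambda>n. \<E> (conv_pow n) (\<lambda>g. ?d g x))"
        by (intro ext expectation_pmf_cong) (simp add: v_def cocycle[OF j _ x] conv_pow_closed algebra_simps)
      finally show "(\<lambda>n. \<E> (conv_pow n) (\<lambda>g. ?d g x)) \<longlonglongrightarrow> 0" .
    qed
  qed auto
  then show ?thesis by (simp add: eq)
qed

text \<open>Hence the joint law of the values of the cocycle is the limit law of the increments of the averaged
  cocycle along the walk. This is stated for products of Lipschitz test functions bounded by one.\<close>

lemma test_functions_limit:
  fixes f :: "'a \<Rightarrow> real \<Rightarrow> real"
  assumes J: "finite J" "J \<subseteq> carrier G"
    and f01: "\<And>j t. j \<in> J \<Longrightarrow> \<bar>f j t\<bar> \<le> 1"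
    and lip: "\<And>j s t. j \<in> J \<Longrightarrow> \<bar>f j s - f j t\<bar> \<le> L * \<bar>s - t\<bar>"
    and fm: "\<And>j. j \<in> J \<Longrightarrow> f j \<in> borel_measurable borel"
  shows "(\<lambda>n. \<E> (conv_pow n) (\<lambda>g. \<Prod>j\<in>J. f j (avg (j \<otimes> g) - avg g)))
    \<longlonglongrightarrow> (\<integral>x. (\<Prod>j\<in>J. f j (c j x)) \<partial>M)"
proof -
  define I where "I = (\<integral>x. (\<Prod>j\<in>J. f j (c j x)) \<partial>M)"
  have jc: "j \<in> carrier G" if "j \<in> J" for j using that J by auto
  have prod1: "\<bar>\<Prod>j\<in>J. f j (t j)\<bar> \<le> 1" for t
    unfolding abs_prod by (rule prod_le_1) (use f01 in auto)
  have pm: "(\<lambda>x. \<Prod>j\<in>J. f j (c j x)) \<in> borel_measurable M"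
    by (intro borel_measurable_prod measurable_compose[OF c_meas fm] jc)
  let ?H = "\<lambda>j g. avg (j \<otimes> g) - avg g"
  let ?d = "\<lambda>j g x. \<bar>c j (act g x) - ?H j g\<bar>"
  let ?e = "\<lambda>n. \<Sum>j\<in>J. L * \<E> (conv_pow n) (\<lambda>g. \<integral>x. ?d j g x \<partial>M)"
  have db: "?d j g x \<le> 2 * (C + \<bar>\<phi> j\<bar>)" if "g \<in> carrier G" "x \<in> space M" "j \<in> J" for g x j
    using near[OF jc[OF that(3)], of "act g x"] act_space[OF that(1,2)] avg_diff_bound[OF jc[OF that(3)] that(1)] by auto
  have dm: "?d j g \<in> borel_measurable M" if "g \<in> carrier G" "j \<in> J" for g j
    using act_comp_meas[OF c_meas[OF jc[OF that(2)]] that(1)] by measurable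
  have di: "integrable M (?d j g)" if "g \<in> carrier G" "j \<in> J" for g j
    by (rule integrable_bounded[OF dm[OF that], of "2 * (C + \<bar>\<phi> j\<bar>)"]) (use db that in auto)
  let ?p = "\<lambda>g x. \<Prod>j\<in>J. f j (c j (act g x))" and ?r = "\<lambda>g. \<Prod>j\<in>J. f j (?H j g)"
  have bound: "\<bar>I - \<E> (conv_pow n) (\<lambda>g. ?r g)\<bar> \<le> ?e n" for n
  proof -
    have pb: "\<bar>\<integral>x. ?p g x \<partial>M\<bar> \<le> 1" if "g \<in> carrier G" for g
      by (rule abs_integral_le[OF act_comp_meas[OF pm that] prod1])
    have ie: "integrable (conv_pow n) (\<lambda>g. \<integral>x. ?d j g x \<partial>M)" if "j \<in> J" for j
    proof (rule integrable_pmf_bounded[where K="2 * (C + \<bar>\<phi> j\<bar>)"])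
      fix g assume "g \<in> set_pmf (conv_pow n)"
      then have g: "g \<in> carrier G" by (rule conv_pow_closed)
      show "\<bar>\<integral>x. ?d j g x \<partial>M\<bar> \<le> 2 * (C + \<bar>\<phi> j\<bar>)"
        by (rule abs_integral_le[OF dm[OF g that]]) (use db[OF g _ that] in auto)
    qed
    have "I - \<E> (conv_pow n) (\<lambda>g. ?r g) =
        \<E> (conv_pow n) (\<lambda>g. \<integral>x. ?p g x \<partial>M) -
        \<E> (conv_pow n) (\<lambda>g. ?r g)"
      unfolding I_def by (subst stat_conv_pow[OF pm prod1, of n]) simp
    also have "\<dots> = \<E> (conv_pow n) (\<lambda>g. (\<integral>x. ?p g x \<partial>M) - ?r g)"
      by (rule Bochner_Integration.integral_diff[symmetric]; rule integrable_pmf_bounded[where K=1])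
         (use pb prod1 in \<open>auto simp: conv_pow_closed\<close>)
    also have "\<bar>\<dots>\<bar> \<le> \<E> (conv_pow n) (\<lambda>g. \<bar>(\<integral>x. ?p g x \<partial>M) - ?r g\<bar>)"
      by (rule integral_abs_bound)
    also have "\<dots> \<le> \<E> (conv_pow n) (\<lambda>g. \<Sum>j\<in>J. L * (\<integral>x. ?d j g x \<partial>M))"
    proof (rule integral_mono_AE)
      show "integrable (conv_pow n) (\<lambda>g. \<Sum>j\<in>J. L * (\<integral>x. ?d j g x \<partial>M))"
        using ie by (intro Bochner_Integration.integrable_sum integrable_mult_right) auto
      show "integrable (conv_pow n) (\<lambda>g. \<bar>(\<integral>x. ?p g x \<partial>M) - ?r g\<bar>)"
      proof (rule integrable_pmf_bounded[where K=2])
        fix g assume "g \<in> set_pmf (conv_pow n)"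
        then show "\<bar>\<bar>(\<integral>x. ?p g x \<partial>M) - ?r g\<bar>\<bar> \<le> 2"
          using pb[of g] prod1[of "\<lambda>j. ?H j g"] by (auto simp: conv_pow_closed)
      qed
      have "\<bar>(\<integral>x. ?p g x \<partial>M) - ?r g\<bar> \<le> (\<Sum>j\<in>J. L * (\<integral>x. ?d j g x \<partial>M))"
        if g: "g \<in> carrier G" for g
      proof -
        have ip: "integrable M (\<lambda>x. ?p g x)"
          by (rule integrable_bounded[OF act_comp_meas[OF pm g] prod1])
        have "(\<integral>x. ?p g x \<partial>M) - ?r g =
            (\<integral>x. ?p g x - ?r g \<partial>M)"
          using ip by (simp add: prob_space)
        also have "\<bar>\<dots>\<bar> \<le> (\<integral>x. \<bar>?p g x - ?r g\<bar> \<partial>M)"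
          by (rule integral_abs_bound)
        also have "\<dots> \<le> (\<integral>x. (\<Sum>j\<in>J. L * ?d j g x) \<partial>M)"
        proof (rule integral_mono)
          show "integrable M (\<lambda>x. \<bar>?p g x - ?r g\<bar>)"
            using ip by simp
          show "integrable M (\<lambda>x. \<Sum>j\<in>J. L * ?d j g x)"
            using di[OF g] by (intro Bochner_Integration.integrable_sum integrable_mult_right) auto
          fix x assume x: "x \<in> space M"
          have "\<bar>?p g x - ?r g\<bar> \<le>
              (\<Sum>j\<in>J. \<bar>f j (c j (act g x)) - f j (?H j g)\<bar>)"
            using norm_prod_diff[of J "\<lambda>j. f j (c j (act g x))" "\<lambda>j. f j (?H j g)"] f01 by simp
          also have "\<dots> \<le> (\<Sum>j\<in>J. L * ?d j g x)" by (intro sum_mono lip)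
          finally show "\<bar>?p g x - ?r g\<bar> \<le> (\<Sum>j\<in>J. L * ?d j g x)" .
        qed
        also have "\<dots> = (\<Sum>j\<in>J. L * (\<integral>x. ?d j g x \<partial>M))"
          using di[OF g] by (subst Bochner_Integration.integral_sum) auto
        finally show ?thesis .
      qed
      then show "AE g in conv_pow n. \<bar>(\<integral>x. ?p g x \<partial>M) - ?r g\<bar>
          \<le> (\<Sum>j\<in>J. L * (\<integral>x. ?d j g x \<partial>M))"
        by (auto simp: AE_measure_pmf_iff conv_pow_closed)
    qed
    also have "\<dots> = ?e n"
      using ie by (subst Bochner_Integration.integral_sum) auto
    finally show ?thesis .
  qed
  have "?e \<longlonglongrightarrow> (\<Sum>j\<in>J. L * 0)"
    by (intro tendsto_sum tendsto_mult_left contraction jc)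
  then have "?e \<longlonglongrightarrow> 0" by simp
  then have "(\<lambda>n. I - \<E> (conv_pow n) (\<lambda>g. ?r g)) \<longlonglongrightarrow> 0"
    by (rule Lim_null_comparison[rotated]) (simp add: bound always_eventually)
  from tendsto_diff[OF tendsto_const[of I] this]
  show ?thesis by (simp add: I_def)
qed

end

section \<open>Laws on products of lines\<close>

text \<open>A piecewise linear approximation of the indicator of a half-line.\<close>

definition ramp :: "real \<Rightarrow> nat \<Rightarrow> real \<Rightarrow> real" where
  "ramp a n t = max 0 (min 1 (1 - real n * (t - a)))"

lemma ramp_bounds: "0 \<le> ramp a n t" "ramp a n t \<le> 1" "\<bar>ramp a n t\<bar> \<le> 1"
  by (auto simp: ramp_def)

lemma ramp_lipschitz: "\<bar>ramp a n s - ramp a n t\<bar> \<le> real n * \<bar>s - t\<bar>"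
proof -
  have "\<bar>ramp a n s - ramp a n t\<bar> \<le> \<bar>(1 - real n * (s - a)) - (1 - real n * (t - a))\<bar>"
    unfolding ramp_def by (auto simp: max_def min_def)
  also have "\<dots> = real n * \<bar>s - t\<bar>"
    by (simp add: abs_mult[symmetric, of "real n", simplified] algebra_simps flip: abs_minus_commute[of "real n * t"])
  finally show ?thesis .
qed

lemma ramp_measurable [measurable]: "ramp a n \<in> borel_measurable borel"
  unfolding ramp_def by measurable

lemma ramp_tendsto: "(\<lambda>n. ramp a n t) \<longlonglongrightarrow> indicator {..a} t"
proof (cases "t \<le> a")
  case True
  then have "ramp a n t = 1" for n
    by (simp add: ramp_def mult_nonneg_nonpos)
  with True show ?thesis by simp
next
  case False
  obtain N where N: "1 < real N * (t - a)" using reals_Archimedean3[of "t - a"] False by auto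
  have "ramp a n t = 0" if "n \<ge> N" for n
  proof -
    have "real N * (t - a) \<le> real n * (t - a)" using that False by (intro mult_right_mono) auto
    with N show ?thesis by (simp add: ramp_def)
  qed
  then have "eventually (\<lambda>n. ramp a n t = 0) sequentially"
    by (auto simp: eventually_sequentially)
  with False show ?thesis by (simp add: tendsto_eventually)
qed

text \<open>Finite intersections of half-spaces generate the product sigma-algebra.\<close>

lemma sets_PiM_halflines:
  "sets (PiM I (\<lambda>_. borel :: real measure)) =
    sigma_sets (PiE I (\<lambda>_. UNIV)) {{u \<in> PiE I (\<lambda>_. UNIV). \<forall>j\<in>J. u j \<le> a j} | J a. finite J \<and> J \<subseteq> I}"
  (is "_ = sigma_sets ?\<Omega> ?E")
proof
  have E: "?E \<subseteq> Pow ?\<Omega>" by auto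
  have c: "(\<lambda>u. u i) \<in> borel_measurable (sigma ?\<Omega> ?E)" if i: "i \<in> I" for i
    unfolding borel_measurable_iff_le
  proof
    fix b :: real
    have "{u \<in> ?\<Omega>. u i \<le> b} \<in> ?E"
      using i by (intro CollectI exI[of _ "{i}"] exI[of _ "\<lambda>_. b"]) auto
    then show "{w \<in> space (sigma ?\<Omega> ?E). w i \<le> b} \<in> sets (sigma ?\<Omega> ?E)"
      using E by (simp add: space_measure_of_conv)
  qed
  show "sets (PiM I (\<lambda>_. borel)) \<subseteq> sigma_sets ?\<Omega> ?E"
    unfolding sets_PiM_single
  proof (simp only: space_borel, rule sigma_sets_mono)
    show "{{f \<in> ?\<Omega>. f i \<in> A} | i A. i \<in> I \<and> A \<in> sets borel} \<subseteq> sigma_sets ?\<Omega> ?E"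
    proof
      fix X assume "X \<in> {{f \<in> ?\<Omega>. f i \<in> A} | i A. i \<in> I \<and> A \<in> sets borel}"
      then obtain i A where X: "X = {f \<in> ?\<Omega>. f i \<in> A}" and iA: "i \<in> I" "A \<in> sets borel" by blast
      from measurable_sets[OF c[OF iA(1)] iA(2)] E
      have "(\<lambda>u. u i) -` A \<inter> ?\<Omega> \<in> sigma_sets ?\<Omega> ?E" by (simp add: space_measure_of_conv)
      also have "(\<lambda>u. u i) -` A \<inter> ?\<Omega> = X" using X by auto
      finally show "X \<in> sigma_sets ?\<Omega> ?E" .
    qed
  qed
  show "sigma_sets ?\<Omega> ?E \<subseteq> sets (PiM I (\<lambda>_. borel))"
  proof (rule sets.sigma_sets_subset'[of ?E "PiM I (\<lambda>_. borel :: real measure)", simplified space_PiM space_borel])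
    show "?E \<subseteq> sets (PiM I (\<lambda>_. borel))"
    proof
      fix X assume "X \<in> ?E"
      then obtain J a where X: "X = {u \<in> ?\<Omega>. \<forall>j\<in>J. u j \<le> a j}" and J: "finite J" "J \<subseteq> I" by blast
      have "{u \<in> space (PiM I (\<lambda>_. borel :: real measure)). \<forall>j\<in>J. u j \<le> a j} \<in> sets (PiM I (\<lambda>_. borel))"
      proof (rule sets.sets_Collect_finite_All[OF _ J(1)])
        fix j assume "j \<in> J"
        then have [measurable]: "(\<lambda>u. u j) \<in> borel_measurable (PiM I (\<lambda>_. borel :: real measure))"
          using J by (intro measurable_component_singleton) auto
        show "{u \<in> space (PiM I (\<lambda>_. borel :: real measure)). u j \<le> a j} \<in> sets (PiM I (\<lambda>_. borel))"
          by measurable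
      qed
      then show "X \<in> sets (PiM I (\<lambda>_. borel))"
        by (simp add: space_PiM X)
    qed
    show "?\<Omega> \<in> sets (PiM I (\<lambda>_. borel :: real measure))"
      using sets.top[of "PiM I (\<lambda>_. borel :: real measure)"] by (simp add: space_PiM)
  qed
qed

lemma law_eqI_ramps:
  assumes M1: "prob_space M1" "sets M1 = sets (PiM I (\<lambda>_. borel :: real measure))"
    and M2: "prob_space M2" "sets M2 = sets (PiM I (\<lambda>_. borel :: real measure))"
    and eq: "\<And>J a n. finite J \<Longrightarrow> J \<subseteq> I \<Longrightarrow>
      (\<integral>u. (\<Prod>j\<in>J. ramp (a j) n (u j)) \<partial>M1) = (\<integral>u. (\<Prod>j\<in>J. ramp (a j) n (u j)) \<partial>M2)"
  shows "M1 = M2"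
proof -
  let ?\<Omega> = "PiE I (\<lambda>_. UNIV :: real set)"
  let ?E = "{{u \<in> ?\<Omega>. \<forall>j\<in>J. u j \<le> a j} | J a. finite J \<and> J \<subseteq> I}"
  have lim: "(\<lambda>n. \<integral>u. (\<Prod>j\<in>J. ramp (a j) n (u j)) \<partial>M) \<longlonglongrightarrow> measure M {u \<in> ?\<Omega>. \<forall>j\<in>J. u j \<le> a j}"
    if M: "prob_space M" "sets M = sets (PiM I (\<lambda>_. borel :: real measure))" and J: "finite J" "J \<subseteq> I"
    for M J a
  proof -
    interpret prob_space M by fact
    have sp: "space M = ?\<Omega>" using sets_eq_imp_space_eq[OF M(2)] by (simp add: space_PiM)
    have c: "(\<lambda>u. u j) \<in> borel_measurable M" if "j \<in> J" for j
      using that J by (subst measurable_cong_sets[OF M(2) refl]) (auto intro!: measurable_component_singleton)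
    let ?S = "{u \<in> ?\<Omega>. \<forall>j\<in>J. u j \<le> a j}"
    have S: "?S \<in> sets M"
      unfolding M(2) sets_PiM_halflines using J by (intro sigma_sets.Basic) blast
    have "(\<lambda>n. \<integral>u. (\<Prod>j\<in>J. ramp (a j) n (u j)) \<partial>M) \<longlonglongrightarrow> (\<integral>u. indicator ?S u \<partial>M)"
    proof (rule integral_dominated_convergence[where w="\<lambda>_. 1"])
      show "(\<lambda>u. \<Prod>j\<in>J. ramp (a j) n (u j)) \<in> borel_measurable M" for n
        by (intro borel_measurable_prod measurable_compose[OF c ramp_measurable])
      show "AE u in M. norm (\<Prod>j\<in>J. ramp (a j) n (u j)) \<le> 1" for n
        by (intro AE_I2) (auto simp: abs_prod ramp_bounds intro!: prod_le_1)
      have "(\<lambda>n. \<Prod>j\<in>J. ramp (a j) n (u j)) \<longlonglongrightarrow> indicator ?S u" if "u \<in> space M" for u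
      proof -
        have "(\<lambda>n. \<Prod>j\<in>J. ramp (a j) n (u j)) \<longlonglongrightarrow> (\<Prod>j\<in>J. indicator {..a j} (u j))"
          by (intro tendsto_prod ramp_tendsto)
        also have "(\<Prod>j\<in>J. indicator {..a j} (u j)) = (indicator ?S u :: real)"
          using J(1) that by (auto simp: indicator_def sp prod_zero_iff)
        finally show ?thesis .
      qed
      then show "AE u in M. (\<lambda>n. \<Prod>j\<in>J. ramp (a j) n (u j)) \<longlonglongrightarrow> indicator ?S u" by (intro AE_I2)
    qed (use S in auto)
    also have "(\<integral>u. indicator ?S u \<partial>M) = measure M ?S" using S by simp
    finally show ?thesis .
  qed
  show ?thesis
  proof (rule measure_eqI_generator_eq[where E="?E" and \<Omega>="?\<Omega>" and A="\<lambda>_. ?\<Omega>"])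
    show "Int_stable ?E"
    proof (rule Int_stableI)
      fix X Y assume "X \<in> ?E" "Y \<in> ?E"
      then obtain J a J' a' where X: "X = {u \<in> ?\<Omega>. \<forall>j\<in>J. u j \<le> a j}" and Y: "Y = {u \<in> ?\<Omega>. \<forall>j\<in>J'. u j \<le> a' j}"
        and J: "finite J" "J \<subseteq> I" "finite J'" "J' \<subseteq> I" by blast
      define b where "b j = (if j \<in> J \<and> j \<in> J' then min (a j) (a' j) else if j \<in> J then a j else a' j)" for j
      have "{u \<in> ?\<Omega>. \<forall>j\<in>J. u j \<le> a j} \<inter> {u \<in> ?\<Omega>. \<forall>j\<in>J'. u j \<le> a' j} = {u \<in> ?\<Omega>. \<forall>j\<in>J \<union> J'. u j \<le> b j}"
        by (auto simp: b_def)
      with J show "X \<inter> Y \<in> ?E"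
        unfolding X Y by (intro CollectI exI[of _ "J \<union> J'"] exI[of _ b]) auto
    qed
    show "?E \<subseteq> Pow ?\<Omega>" by auto
    show "sets M1 = sigma_sets ?\<Omega> ?E" "sets M2 = sigma_sets ?\<Omega> ?E"
      unfolding M1 M2 sets_PiM_halflines by auto
    show "range (\<lambda>_::nat. ?\<Omega>) \<subseteq> ?E" by (auto intro!: exI[of _ "{}"])
    show "emeasure M1 ?\<Omega> \<noteq> \<infinity>"
      using prob_space.emeasure_le_1[OF M1(1), of ?\<Omega>] by (auto simp: top_unique)
    fix X assume "X \<in> ?E"
    then obtain J a where J: "finite J" "J \<subseteq> I" and X: "X = {u \<in> ?\<Omega>. \<forall>j\<in>J. u j \<le> a j}" by blast
    have "measure M1 X = measure M2 X"
      using LIMSEQ_unique[OF lim[OF M1 J, of a] lim[OF M2 J, of a, folded eq[OF J]]] X by simp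
    then show "emeasure M1 X = emeasure M2 X"
      using M1(1) M2(1) by (simp add: finite_measure.emeasure_eq_measure prob_space_def)
  qed auto
qed

section \<open>The boundary map\<close>

lemma stationary_integral:
  fixes f :: "'x \<Rightarrow> real"
  assumes st: "stationary q' M act" and q': "prob_space q'" "sets q' = sets (count_space A)" and A: "countable A"
    and M: "prob_space M" and am: "\<And>g. g \<in> A \<Longrightarrow> act g \<in> measurable M M"
    and f: "f \<in> borel_measurable M" "\<And>x. x \<in> space M \<Longrightarrow> \<bar>f x\<bar> \<le> K"
  shows "integral\<^sup>L M f = (\<integral>g. (\<integral>x. f (act g x) \<partial>M) \<partial>q')"
proof -
  interpret q': prob_space q' by fact
  interpret M: prob_space M by fact
  interpret P: pair_prob_space q' M ..
  have sq: "space q' = A" using sets_eq_imp_space_eq[OF q'(2)] by simp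
  have "(\<lambda>(g, x). act g x) \<in> measurable (count_space A \<Otimes>\<^sub>M M) M"
    by (rule measurable_pair_measure_countable1[OF A]) (use am in auto)
  then have m: "(\<lambda>(g, x). act g x) \<in> measurable (q' \<Otimes>\<^sub>M M) M"
    by (subst measurable_cong_sets[OF sets_pair_measure_cong[OF q'(2) refl] refl])
  have "integral\<^sup>L M f = integral\<^sup>L (distr (q' \<Otimes>\<^sub>M M) M (\<lambda>(g, x). act g x)) f"
    using st by (simp add: stationary_def)
  also have "\<dots> = (\<integral>z. f (act (fst z) (snd z)) \<partial>(q' \<Otimes>\<^sub>M M))"
    by (subst integral_distr[OF m f(1)]) (simp add: case_prod_beta')
  also have "\<dots> = (\<integral>g. (\<integral>x. f (act g x) \<partial>M) \<partial>q')"
  proof (subst P.integral_fst'[symmetric])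
    show "integrable (q' \<Otimes>\<^sub>M M) (\<lambda>z. f (act (fst z) (snd z)))"
    proof (rule P.P.integrable_const_bound[where B=K])
      show "AE z in q' \<Otimes>\<^sub>M M. norm (f (act (fst z) (snd z))) \<le> K"
        by (intro AE_I2) (auto simp: space_pair_measure sq intro!: f(2) measurable_space[OF am])
      show "(\<lambda>z. f (act (fst z) (snd z))) \<in> borel_measurable (q' \<Otimes>\<^sub>M M)"
        using measurable_compose[OF m f(1)] by (simp add: case_prod_beta')
    qed
  qed simp
  finally show ?thesis .
qed

text \<open>Functions on the group with the product of the Borel structures of the line.\<close>

abbreviation fun_borel :: "('g, 'z) monoid_scheme \<Rightarrow> ('g \<Rightarrow> real) measure" where
  "fun_borel G \<equiv> PiM (carrier G) (\<lambda>_. borel)"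

text \<open>The action of a group on functions on the group. On functions vanishing at the identity it is
  \<open>u \<mapsto> u (\<cdot> g) - u g\<close>; the constant \<open>u \<one>\<close> makes the identity act trivially on all functions.\<close>

definition shift :: "('g, 'z) monoid_scheme \<Rightarrow> 'g \<Rightarrow> ('g \<Rightarrow> real) \<Rightarrow> 'g \<Rightarrow> real" where
  "shift G g u = (\<lambda>j\<in>carrier G. u (j \<otimes>\<^bsub>G\<^esub> g) - u g + u \<one>\<^bsub>G\<^esub>)"

lemma linf_bounded:
  assumes "f \<in> linf m"
  obtains K where "AE b in m. \<bar>f b\<bar> \<le> K"
proof -
  have f: "f \<in> borel_measurable m" and "esssup m (\<lambda>b. ereal \<bar>f b\<bar>) < \<infinity>"
    using assms by (auto simp: linf_def linf_norm_def)
  then obtain K where K: "esssup m (\<lambda>b. ereal \<bar>f b\<bar>) < ereal K"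
    using less_PInf_Ex_of_nat by (metis ereal_less_ereal_Ex ereal_dense2)
  have "AE b in m. ereal \<bar>f b\<bar> \<le> esssup m (\<lambda>b. ereal \<bar>f b\<bar>)"
    by (rule esssup_AE) 
  then have "AE b in m. \<bar>f b\<bar> \<le> K"
  proof (rule AE_mp, intro AE_I2 impI)
    fix b assume "ereal \<bar>f b\<bar> \<le> esssup m (\<lambda>b. ereal \<bar>f b\<bar>)"
    with K have "ereal \<bar>f b\<bar> \<le> ereal K" by (metis less_imp_le order_trans)
    then show "\<bar>f b\<bar> \<le> K" by simp
  qed
  then show ?thesis by (rule that)
qed

lemma AE_linf: "(AE b in m. \<bar>f b\<bar> \<le> K) \<Longrightarrow> f \<in> borel_measurable m \<Longrightarrow> f \<in> linf m"
proof -
  assume *: "AE b in m. \<bar>f b\<bar> \<le> K" "f \<in> borel_measurable m"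
  then have "esssup m (\<lambda>b. ereal \<bar>f b\<bar>) \<le> ereal K"
    by (intro esssup_I) auto
  then have "esssup m (\<lambda>b. ereal \<bar>f b\<bar>) < \<infinity>"
    using le_less_trans by fastforce
  with * show ?thesis by (simp add: linf_def linf_norm_def)
qed

text \<open>A harmonic cocycle over a stationary space, together with the Poisson boundary of the same walk. The
  step distribution appears both as the measure \<open>q'\<close> and as the discrete distribution \<open>q\<close>.\<close>

locale cocycle_and_boundary = harmonic_cocycle G q M act c \<phi> C D
  for G :: "('a, 'z) monoid_scheme" (structure) and q and M :: "'x measure" and act and c \<phi> C D +
  fixes q' :: "'a measure" and m :: "'y measure" and actB :: "'a \<Rightarrow> 'y \<Rightarrow> 'y"
  assumes q': "prob_space q'" "sets q' = sets (count_space (carrier G))"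
    and q'_eq: "\<And>f :: 'a \<Rightarrow> real. integral\<^sup>L q' f = \<E> q f"
    and ctb: "countable (carrier G)"
    and pb: "poisson_boundary G q' m actB"
begin

lemma m_prob: "prob_space m"
  and m_borel: "standard_borel_space_action G m actB"
  and m_stat: "stationary q' m actB"
  using pb by (auto simp: poisson_boundary_def)

lemma actB_meas: "g \<in> carrier G \<Longrightarrow> actB g \<in> measurable m m"
  using m_borel by (simp add: standard_borel_space_action_def)

lemma actB_action: "group_action G (space m) actB"
  using m_borel by (simp add: standard_borel_space_action_def)

lemma actB_space: "g \<in> carrier G \<Longrightarrow> b \<in> space m \<Longrightarrow> actB g b \<in> space m"
  using measurable_space[OF actB_meas] .

lemma actB_mult: "g \<in> carrier G \<Longrightarrow> h \<in> carrier G \<Longrightarrow> b \<in> space m \<Longrightarrow> actB (g \<otimes> h) b = actB g (actB h b)"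
  using group_action.composition_rule[OF actB_action] by blast

lemma actB_one: "b \<in> space m \<Longrightarrow> actB \<one> b = b"
  using group_action.id_eq_one[OF actB_action] by (metis restrict_apply)

sublocale B: stationary_space G q m actB
proof (intro stationary_space.intro m_prob stationary_space_axioms.intro)
  show "symmetric_walk G q" ..
  show "integral\<^sup>L m f = \<E> q (\<lambda>g. \<integral>x. f (actB g x) \<partial>m)"
    if "f \<in> borel_measurable m" "\<And>x. x \<in> space m \<Longrightarrow> \<bar>f x :: real\<bar> \<le> K" for f K
    using stationary_integral[OF m_stat q' ctb m_prob actB_meas that] by (simp add: q'_eq)
  show "actB g \<in> measurable m m" if "g \<in> carrier G" for g using that by (rule actB_meas)
  show "actB (g \<otimes> h) x = actB g (actB h x)" if "g \<in> carrier G" "h \<in> carrier G" "x \<in> space m" for g h x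
    using that by (rule actB_mult)
qed

lemma increment_right_harmonic:
  assumes j: "j \<in> carrier G"
  shows "(\<lambda>g. avg (j \<otimes> g) - avg g) \<in> bounded_right_harmonic G q'"
  unfolding bounded_right_harmonic_def
proof (intro CollectI conjI ballI)
  show "bounded ((\<lambda>g. avg (j \<otimes> g) - avg g) ` carrier G)"
    using avg_diff_bound[OF j] by (auto simp: bounded_iff)
  fix g assume g: "g \<in> carrier G"
  have "(\<integral>s. avg (j \<otimes> (g \<otimes> inv s)) - avg (g \<otimes> inv s) \<partial>q') =
      \<E> (map_pmf (m_inv G) q) (\<lambda>s. avg (j \<otimes> (g \<otimes> s)) - avg (g \<otimes> s))"
    unfolding q'_eq by simp
  also have "\<dots> = avg (j \<otimes> g) - avg g"
    unfolding symm by (rule avg_diff_right_harmonic[OF j g])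
  finally show "(\<integral>s. avg (j \<otimes> (g \<otimes> inv s)) - avg (g \<otimes> inv s) \<partial>q') = avg (j \<otimes> g) - avg g" .
qed

lemma poisson_surj: "\<forall>h\<in>bounded_right_harmonic G q'.
    \<exists>f\<in>linf m. \<forall>g\<in>carrier G. poisson_transform m actB f g = h g"
  using pb unfolding poisson_boundary_def by (elim conjE) assumption

text \<open>The bounded function on the boundary whose Poisson transform is the increment of the averaged
  cocycle by \<open>j\<close>.\<close>

definition bdry :: "'a \<Rightarrow> 'y \<Rightarrow> real" where
  "bdry j = (SOME f. f \<in> linf m \<and> (\<forall>g\<in>carrier G. poisson_transform m actB f g = avg (j \<otimes> g) - avg g))"

lemma bdry:
  assumes j: "j \<in> carrier G"
  shows bdry_linf: "bdry j \<in> linf m"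
    and bdry_poisson: "g \<in> carrier G \<Longrightarrow> poisson_transform m actB (bdry j) g = avg (j \<otimes> g) - avg g"
proof -
  have "\<exists>f\<in>linf m. \<forall>g\<in>carrier G. poisson_transform m actB f g = avg (j \<otimes> g) - avg g"
    using poisson_surj increment_right_harmonic[OF j] by (rule bspec)
  then have "\<exists>f. f \<in> linf m \<and> (\<forall>g\<in>carrier G. poisson_transform m actB f g = avg (j \<otimes> g) - avg g)"
    by (simp only: Bex_def)
  then have *: "bdry j \<in> linf m \<and> (\<forall>g\<in>carrier G. poisson_transform m actB (bdry j) g = avg (j \<otimes> g) - avg g)"
    unfolding bdry_def by (rule someI_ex)
  then show "bdry j \<in> linf m" ..
  show "poisson_transform m actB (bdry j) g = avg (j \<otimes> g) - avg g" if "g \<in> carrier G"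
    using conjunct2[OF *] that by (rule bspec)
qed

lemma bdry_meas: "j \<in> carrier G \<Longrightarrow> bdry j \<in> borel_measurable m"
  using bdry_linf by (simp add: linf_def)

lemma poisson_transform_injective:
  assumes f: "f \<in> linf m" and z: "\<And>g. g \<in> carrier G \<Longrightarrow> poisson_transform m actB f g = 0"
  shows "AE b in m. f b = 0"
proof -
  have fm: "f \<in> borel_measurable m" using f by (simp add: linf_def)
  have "linf_norm m f = (SUP g\<in>carrier G. ereal \<bar>poisson_transform m actB f g\<bar>)"
    using pb f unfolding poisson_boundary_def by metis
  also have "\<dots> \<le> 0" by (rule SUP_least) (simp add: z)
  finally have "esssup m (\<lambda>b. ereal \<bar>f b\<bar>) \<le> 0" by (simp add: linf_norm_def)
  moreover have "AE b in m. ereal \<bar>f b\<bar> \<le> esssup m (\<lambda>b. ereal \<bar>f b\<bar>)"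
    by (rule esssup_AE)
  ultimately show ?thesis
    by (auto elim!: eventually_mono dest: order_trans)
qed

lemma bdry_equivariant_AE:
  assumes j: "j \<in> carrier G" and h: "h \<in> carrier G"
  shows "AE b in m. bdry j (actB h b) = bdry (j \<otimes> h) b - bdry h b"
proof -
  have jh: "j \<otimes> h \<in> carrier G" using j h by simp
  obtain K1 where K1: "AE b in m. \<bar>bdry j b\<bar> \<le> K1" using linf_bounded[OF bdry_linf[OF j]] .
  obtain K2 where K2: "AE b in m. \<bar>bdry (j \<otimes> h) b\<bar> \<le> K2" using linf_bounded[OF bdry_linf[OF jh]] .
  obtain K3 where K3: "AE b in m. \<bar>bdry h b\<bar> \<le> K3" using linf_bounded[OF bdry_linf[OF h]] .
  let ?f = "\<lambda>b. bdry j (actB h b) - (bdry (j \<otimes> h) b - bdry h b)"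
  have meas: "(\<lambda>b. bdry j (actB h b)) \<in> borel_measurable m" "bdry (j \<otimes> h) \<in> borel_measurable m"
    "bdry h \<in> borel_measurable m"
    by (intro B.act_comp_meas bdry_meas j h jh)+
  have "AE b in m. \<bar>?f b\<bar> \<le> K1 + K2 + K3"
    using B.quasi_invariant[OF K1 h] K2 K3 by eventually_elim auto
  then have lf: "?f \<in> linf m" by (rule AE_linf) (use meas in measurable)
  have "poisson_transform m actB ?f g = 0" if g: "g \<in> carrier G" for g
  proof -
    have hg: "h \<otimes> g \<in> carrier G" using g h by simp
    have int: "integrable m (\<lambda>b. f (actB k b))" if "AE b in m. \<bar>f b\<bar> \<le> K" "f \<in> borel_measurable m" "k \<in> carrier G"
      for f :: "'y \<Rightarrow> real" and K k
      by (rule B.integrable_const_bound[where B=K]) (use B.quasi_invariant[OF that(1,3)] B.act_comp_meas[OF that(2,3)] in auto)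
    have e: "(\<integral>b. bdry j (actB h (actB g b)) \<partial>m) = (\<integral>b. bdry j (actB (h \<otimes> g) b) \<partial>m)"
      by (rule Bochner_Integration.integral_cong) (simp_all add: actB_mult g h)
    have i1: "integrable m (\<lambda>b. bdry j (actB h (actB g b)))"
    proof -
      have "integrable m (\<lambda>b. bdry j (actB (h \<otimes> g) b))" by (rule int[OF K1 bdry_meas[OF j] hg])
      also have "?this \<longleftrightarrow> integrable m (\<lambda>b. bdry j (actB h (actB g b)))"
        by (rule Bochner_Integration.integrable_cong) (simp_all add: actB_mult g h)
      finally show ?thesis .
    qed
    have "poisson_transform m actB ?f g = (\<integral>b. bdry j (actB h (actB g b)) \<partial>m) -
        ((\<integral>b. bdry (j \<otimes> h) (actB g b) \<partial>m) - (\<integral>b. bdry h (actB g b) \<partial>m))"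
      unfolding poisson_transform_def
      using i1 int[OF K2 bdry_meas[OF jh] g] int[OF K3 bdry_meas[OF h] g] by simp
    also have "\<dots> = (avg (j \<otimes> (h \<otimes> g)) - avg (h \<otimes> g)) - ((avg (j \<otimes> h \<otimes> g) - avg g) - (avg (h \<otimes> g) - avg g))"
      using bdry_poisson[OF j hg] bdry_poisson[OF jh g] bdry_poisson[OF h g] e
      by (simp add: poisson_transform_def)
    also have "\<dots> = 0" using j h g by (simp add: m_assoc)
    finally show ?thesis .
  qed
  then have "AE b in m. ?f b = 0" by (rule poisson_transform_injective[OF lf])
  then show ?thesis by eventually_elim simp
qed

text \<open>Both sides are the limit law of the increments of the averaged cocycle along the walk: on the left by
  contraction, on the right by convergence of Poisson transforms along almost every path.\<close>

lemma boundary_law: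
  "distr M (fun_borel G) (\<lambda>x. \<lambda>j\<in>carrier G. c j x) =
   distr m (fun_borel G) (\<lambda>b. \<lambda>j\<in>carrier G. bdry j b)"
proof -
  let ?Y = "fun_borel G"
  have mc: "(\<lambda>x. \<lambda>j\<in>carrier G. c j x) \<in> measurable M ?Y"
    by (rule measurable_restrict) (rule c_meas)
  have mb: "(\<lambda>b. \<lambda>j\<in>carrier G. bdry j b) \<in> measurable m ?Y"
    by (rule measurable_restrict) (rule bdry_meas)
  show ?thesis
  proof (rule law_eqI_ramps)
    show "prob_space (distr M ?Y (\<lambda>x. \<lambda>j\<in>carrier G. c j x))" by (rule prob_space_distr[OF mc])
    show "prob_space (distr m ?Y (\<lambda>b. \<lambda>j\<in>carrier G. bdry j b))" by (rule B.prob_space_distr[OF mb])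
    fix J :: "'a set" and a :: "'a \<Rightarrow> real" and n assume J: "finite J" "J \<subseteq> carrier G"
    let ?f = "\<lambda>j. ramp (a j) n"
    let ?p = "\<lambda>t :: 'a \<Rightarrow> real. \<Prod>j\<in>J. ramp (a j) n (t j)"
    have jc: "j \<in> carrier G" if "j \<in> J" for j using that J by auto
    have p1: "\<bar>?p t\<bar> \<le> 1" for t
      unfolding abs_prod by (rule prod_le_1) (use ramp_bounds in auto)
    have cm: "(\<lambda>u. u j) \<in> borel_measurable ?Y" if "j \<in> J" for j
      by (rule measurable_component_singleton) (rule jc[OF that])
    have pm: "?p \<in> borel_measurable ?Y"
      by (intro borel_measurable_prod measurable_compose[OF cm ramp_measurable])
    let ?P = "Pi\<^sub>M UNIV (\<lambda>_::nat. q')"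
    interpret P: prob_space ?P by (rule prob_space_PiM) (rule q')
    have "countable (bdry ` carrier G)" "bdry ` carrier G \<subseteq> linf m"
      using ctb bdry_linf by auto
    then obtain \<Omega> Z where \<Omega>: "\<Omega> \<in> sets ?P" "emeasure ?P \<Omega> = 1"
      and Z: "Z \<in> measurable (restrict_space ?P \<Omega>) m" "distr (restrict_space ?P \<Omega>) m Z = m"
      and conv: "\<And>\<omega> f. \<omega> \<in> \<Omega> \<Longrightarrow> f \<in> bdry ` carrier G \<Longrightarrow>
        (\<lambda>n. poisson_transform m actB f (walk G \<omega> n)) \<longlonglongrightarrow> f (Z \<omega>)"
      using pb unfolding poisson_boundary_def by meson
    have sq: "space q' = carrier G" using sets_eq_imp_space_eq[OF q'(2)] by simp
    have \<Omega>sp: "\<Omega> \<subseteq> space ?P" using \<Omega>(1) by (rule sets.sets_into_space)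
    have AE\<Omega>: "AE \<omega> in ?P. \<omega> \<in> \<Omega>"
      using \<Omega> P.AE_in_set_eq_1[of \<Omega>] by (simp add: P.emeasure_eq_measure)
    have wc: "walk G \<omega> k \<in> carrier G" if "\<omega> \<in> \<Omega>" for \<omega> k
      using that \<Omega>sp by (intro walk_closed) (auto simp: space_PiM sq PiE_iff)
    let ?H = "\<lambda>g. ?p (\<lambda>j. avg (j \<otimes> g) - avg g)"
    have wm: "(\<lambda>\<omega>. ?H (walk G \<omega> k)) \<in> borel_measurable ?P" for k
      by (rule measurable_compose[OF measurable_walk[OF q'(2) ctb]]) auto
    have we: "(\<integral>\<omega>. ?H (walk G \<omega> k) \<partial>?P) = \<E> (conv_pow k) ?H" for k
      by (rule expectation_walk[OF q' q'_eq ctb, of _ 1]) (rule p1)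
    have bm: "(\<lambda>\<omega>. ?p (\<lambda>j. bdry j (Z \<omega>))) \<in> borel_measurable (restrict_space ?P \<Omega>)"
      by (intro borel_measurable_prod measurable_compose[OF measurable_compose[OF Z(1) bdry_meas] ramp_measurable] jc)
    have "(\<lambda>k. \<integral>\<omega>. indicator \<Omega> \<omega> *\<^sub>R ?H (walk G \<omega> k) \<partial>?P) \<longlonglongrightarrow>
        (\<integral>\<omega>. indicator \<Omega> \<omega> *\<^sub>R ?p (\<lambda>j. bdry j (Z \<omega>)) \<partial>?P)"
    proof (rule integral_dominated_convergence[where w="\<lambda>_. 1"])
      show "(\<lambda>\<omega>. indicator \<Omega> \<omega> *\<^sub>R ?p (\<lambda>j. bdry j (Z \<omega>))) \<in> borel_measurable ?P"
        using bm by (subst (asm) borel_measurable_restrict_space_iff) (use \<Omega> in auto)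
      show "(\<lambda>\<omega>. indicator \<Omega> \<omega> *\<^sub>R ?H (walk G \<omega> k)) \<in> borel_measurable ?P" for k
        using wm[of k] \<Omega>(1) by measurable
      show "AE \<omega> in ?P. norm (indicator \<Omega> \<omega> *\<^sub>R ?H (walk G \<omega> k)) \<le> 1" for k
        using p1 by (intro AE_I2) (auto simp: indicator_def)
      show "AE \<omega> in ?P. (\<lambda>k. indicator \<Omega> \<omega> *\<^sub>R ?H (walk G \<omega> k)) \<longlonglongrightarrow> indicator \<Omega> \<omega> *\<^sub>R ?p (\<lambda>j. bdry j (Z \<omega>))"
      proof (intro AE_I2)
        fix \<omega>
        show "(\<lambda>k. indicator \<Omega> \<omega> *\<^sub>R ?H (walk G \<omega> k)) \<longlonglongrightarrow> indicator \<Omega> \<omega> *\<^sub>R ?p (\<lambda>j. bdry j (Z \<omega>))"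
        proof (cases "\<omega> \<in> \<Omega>")
          case True
          have cv: "(\<lambda>k. avg (j \<otimes> walk G \<omega> k) - avg (walk G \<omega> k)) \<longlonglongrightarrow> bdry j (Z \<omega>)" if "j \<in> J" for j
            using conv[OF True, of "bdry j"] jc[OF that] by (simp add: bdry_poisson wc[OF True])
          have cont: "isCont (ramp (a j) n) t" for j t
            unfolding ramp_def by (intro continuous_intros)
          have "(\<lambda>k. ?H (walk G \<omega> k)) \<longlonglongrightarrow> ?p (\<lambda>j. bdry j (Z \<omega>))"
            by (intro tendsto_prod) (rule isCont_tendsto_compose[OF cont cv])
          then show ?thesis using True by simp
        qed simp
      qed
    qed auto
    also have "(\<lambda>k. \<integral>\<omega>. indicator \<Omega> \<omega> *\<^sub>R ?H (walk G \<omega> k) \<partial>?P) = (\<lambda>k. \<E> (conv_pow k) ?H)"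
    proof
      fix k
      have "(\<integral>\<omega>. indicator \<Omega> \<omega> *\<^sub>R ?H (walk G \<omega> k) \<partial>?P) = (\<integral>\<omega>. ?H (walk G \<omega> k) \<partial>?P)"
        by (rule integral_cong_AE) (use wm[of k] \<Omega>(1) AE\<Omega> in auto)
      then show "(\<integral>\<omega>. indicator \<Omega> \<omega> *\<^sub>R ?H (walk G \<omega> k) \<partial>?P) = \<E> (conv_pow k) ?H"
        by (simp only: we)
    qed
    also have "(\<integral>\<omega>. indicator \<Omega> \<omega> *\<^sub>R ?p (\<lambda>j. bdry j (Z \<omega>)) \<partial>?P) = (\<integral>\<omega>. ?p (\<lambda>j. bdry j (Z \<omega>)) \<partial>restrict_space ?P \<Omega>)"
      by (rule integral_restrict_space[symmetric]) (use \<Omega> in auto)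
    also have "\<dots> = (\<integral>b. ?p (\<lambda>j. bdry j b) \<partial>distr (restrict_space ?P \<Omega>) m Z)"
      by (rule integral_distr[OF Z(1), symmetric])
         (intro borel_measurable_prod measurable_compose[OF bdry_meas ramp_measurable] jc)
    also have "\<dots> = (\<integral>b. ?p (\<lambda>j. bdry j b) \<partial>m)" unfolding Z(2) ..
    finally have 1: "(\<lambda>k. \<E> (conv_pow k) ?H) \<longlonglongrightarrow> (\<integral>b. ?p (\<lambda>j. bdry j b) \<partial>m)" .
    have 2: "(\<lambda>k. \<E> (conv_pow k) ?H) \<longlonglongrightarrow> (\<integral>x. ?p (\<lambda>j. c j x) \<partial>M)"
      by (rule test_functions_limit[OF J, of ?f "real n"]) (auto simp: ramp_bounds ramp_lipschitz)
    have "(\<integral>u. ?p u \<partial>distr M ?Y (\<lambda>x. \<lambda>j\<in>carrier G. c j x)) = (\<integral>x. ?p (\<lambda>j. c j x) \<partial>M)"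
      by (subst integral_distr[OF mc pm]) (auto intro!: Bochner_Integration.integral_cong prod.cong simp: jc)
    also have "\<dots> = (\<integral>b. ?p (\<lambda>j. bdry j b) \<partial>m)" by (rule LIMSEQ_unique[OF 2 1])
    also have "\<dots> = (\<integral>u. ?p u \<partial>distr m ?Y (\<lambda>b. \<lambda>j\<in>carrier G. bdry j b))"
      by (subst integral_distr[OF mb pm]) (auto intro!: Bochner_Integration.integral_cong prod.cong simp: jc)
    finally show "(\<integral>u. ?p u \<partial>distr M ?Y (\<lambda>x. \<lambda>j\<in>carrier G. c j x)) =
       (\<integral>u. ?p u \<partial>distr m ?Y (\<lambda>b. \<lambda>j\<in>carrier G. bdry j b))" .
  qed simp_all
qed

text \<open>Off an invariant null set, on which the zero function serves as a fixed point, the boundary functions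
  form an equivariant map.\<close>

lemma exists_boundary_map:
  obtains \<pi> where "\<pi> \<in> measurable m (fun_borel G)"
    and "\<And>g b. g \<in> carrier G \<Longrightarrow> b \<in> space m \<Longrightarrow> \<pi> (actB g b) = shift G g (\<pi> b)"
    and "distr m (fun_borel G) \<pi> =
      distr M (fun_borel G) (\<lambda>x. \<lambda>j\<in>carrier G. c j x)"
proof -
  let ?Y = "fun_borel G"
  define good where "good b \<longleftrightarrow> (\<forall>j\<in>carrier G. \<forall>h\<in>carrier G. bdry j (actB h b) = bdry (j \<otimes> h) b - bdry h b)" for b
  define B0 where "B0 b \<longleftrightarrow> (\<forall>g\<in>carrier G. good (actB g b))" for b
  define \<pi> where "\<pi> b = (if B0 b then (\<lambda>j\<in>carrier G. bdry j b) else (\<lambda>j\<in>carrier G. 0))" for b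
  have good_AE: "AE b in m. good b"
    unfolding good_def by (intro AE_ball_countable[OF ctb, THEN iffD2] ballI bdry_equivariant_AE)
  have B0_AE: "AE b in m. B0 b"
    unfolding B0_def by (intro AE_ball_countable[OF ctb, THEN iffD2] ballI B.quasi_invariant[OF good_AE])
  have good_set: "{b \<in> space m. good (actB g b)} \<in> sets m" if g: "g \<in> carrier G" for g
  proof -
    have "{b \<in> space m. good b} \<in> sets m"
      unfolding good_def
    proof (intro sets.sets_Collect_countable_All'[OF _ ctb])
      fix j h assume j: "j \<in> carrier G" and h: "h \<in> carrier G"
      have [measurable]: "(\<lambda>b. bdry j (actB h b)) \<in> borel_measurable m" "bdry (j \<otimes> h) \<in> borel_measurable m"
        "bdry h \<in> borel_measurable m"
        using j h by (intro B.act_comp_meas bdry_meas; simp)+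
      show "{b \<in> space m. bdry j (actB h b) = bdry (j \<otimes> h) b - bdry h b} \<in> sets m" by measurable
    qed
    from measurable_sets[OF actB_meas[OF g] this]
    have "actB g -` {b \<in> space m. good b} \<inter> space m \<in> sets m" .
    also have "actB g -` {b \<in> space m. good b} \<inter> space m = {b \<in> space m. good (actB g b)}"
      using actB_space[OF g] by auto
    finally show ?thesis .
  qed
  have B0_set: "{b \<in> space m. B0 b} \<in> sets m"
    unfolding B0_def by (intro sets.sets_Collect_countable_All'[OF _ ctb] good_set)
  have B0_act: "B0 (actB g b) \<longleftrightarrow> B0 b" if g: "g \<in> carrier G" and b: "b \<in> space m" for g b
  proof
    assume B: "B0 b"
    show "B0 (actB g b)" unfolding B0_def
      using B g b by (auto simp: B0_def simp flip: actB_mult)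
  next
    assume B: "B0 (actB g b)"
    show "B0 b" unfolding B0_def
    proof
      fix h assume h: "h \<in> carrier G"
      have "actB (h \<otimes> inv g) (actB g b) = actB h b"
        using g h b by (simp add: m_assoc flip: actB_mult)
      then show "good (actB h b)" using B g h unfolding B0_def by (metis inv_closed m_closed)
    qed
  qed
  have mb: "(\<lambda>b. \<lambda>j\<in>carrier G. bdry j b) \<in> measurable m ?Y"
    by (rule measurable_restrict) (rule bdry_meas)
  have "\<pi> \<in> measurable m ?Y"
    unfolding \<pi>_def by (rule measurable_If[OF mb _ B0_set]) simp
  moreover have "\<pi> (actB g b) = shift G g (\<pi> b)" if g: "g \<in> carrier G" and b: "b \<in> space m" for g b
  proof (cases "B0 b")
    case True
    have gb: "good b" using True b unfolding B0_def by (metis actB_one one_closed)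
    have "bdry \<one> (actB \<one> b) = bdry (\<one> \<otimes> \<one>) b - bdry \<one> b" using gb unfolding good_def by blast
    then have z: "bdry \<one> b = 0" by (simp add: actB_one b)
    show ?thesis
      using True gb g b z B0_act[OF g b] by (auto simp: \<pi>_def shift_def good_def)
  next
    case False
    then show ?thesis using g B0_act[OF g b] by (auto simp: \<pi>_def shift_def)
  qed
  moreover have "distr m ?Y \<pi> = distr M ?Y (\<lambda>x. \<lambda>j\<in>carrier G. c j x)"
    unfolding boundary_law
    by (rule distr_cong_AE) (use B0_AE mb \<open>\<pi> \<in> measurable m ?Y\<close> in \<open>auto simp: \<pi>_def elim!: eventually_mono\<close>)
  ultimately show ?thesis by (rule that)
qed

end

section \<open>Standard Borel structures and their transport\<close>

lemma second_countable_euclidean_space: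
  "second_countable (euclidean :: 'a::second_countable_topology topology)"
proof -
  obtain B :: "'a set set" where B: "countable B" "topological_basis B" using ex_countable_basis by blast
  show ?thesis
    unfolding second_countable_def
  proof (intro exI[of _ B] conjI ballI allI impI)
    show "countable B" by (rule B)
    show "openin euclidean V" if "V \<in> B" for V using topological_basis_open[OF B(2) that] by simp
    fix U and x :: 'a assume "openin euclidean U \<and> x \<in> U"
    then show "\<exists>V\<in>B. x \<in> V \<and> V \<subseteq> U" by (metis B(2) open_openin topological_basisE)
  qed
qed

lemma standard_borel_measure_embed:
  assumes M: "standard_borel_measure M" and inj: "inj_on f (space M)"
  shows "standard_borel_measure (embed_measure M f)"
proof -
  obtain X where X: "completely_metrizable_space X" "second_countable X"
    "space M = topspace X" "sets M = sets (borel_of_top X)"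
    using M by (auto simp: standard_borel_measure_def)
  let ?g = "the_inv_into (space M) f"
  define Y where "Y = pullback_topology (f ` space M) ?g X"
  have gf: "?g (f x) = x" if "x \<in> space M" for x
    using inj that by (rule the_inv_into_f_f)
  have tY: "topspace Y = f ` space M"
    unfolding Y_def topspace_pullback_topology using gf by (auto simp flip: X(3))
  have "homeomorphic_maps X Y f ?g"
    unfolding homeomorphic_maps_def
  proof (intro conjI ballI)
    show "continuous_map X Y f"
      unfolding continuous_map_def
    proof (intro conjI allI impI)
      show "f \<in> topspace X \<rightarrow> topspace Y" using X(3) tY by auto
      fix U assume "openin Y U"
      then obtain V where V: "openin X V" "U = ?g -` V \<inter> f ` space M"
        unfolding Y_def openin_pullback_topology by blast
      have "f x \<in> U \<longleftrightarrow> x \<in> V" if "x \<in> space M" for x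
        unfolding V(2) using gf[OF that] that by simp
      then have "{x \<in> topspace X. f x \<in> U} = V"
        using openin_subset[OF V(1)] by (auto simp flip: X(3))
      then show "openin X {x \<in> topspace X. f x \<in> U}" using V by simp
    qed
    show "continuous_map Y X ?g"
      unfolding continuous_map_def
    proof (intro conjI allI impI)
      show "?g \<in> topspace Y \<rightarrow> topspace X" using X(3) tY gf by auto
      fix V assume V: "openin X V"
      show "openin Y {y \<in> topspace Y. ?g y \<in> V}"
        unfolding Y_def openin_pullback_topology
        using V tY unfolding Y_def by (intro exI[of _ V]) auto
    qed
  qed (use X(3) tY gf in auto)
  then have "X homeomorphic_space Y" by (auto simp: homeomorphic_space_def)
  then have "completely_metrizable_space Y" "second_countable Y"
    using X homeomorphic_completely_metrizable_space homeomorphic_space_second_countability by blast+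
  moreover have "space (embed_measure M f) = topspace Y" by (simp add: space_embed_measure tY)
  moreover have "sets (embed_measure M f) = sets (borel_of_top Y)"
  proof -
    have "sets (embed_measure M f) = sets (vimage_algebra (f ` space M) ?g M)"
      by (rule sets_embed_eq_vimage_algebra[OF inj])
    also have "\<dots> = sets (vimage_algebra (f ` space M) ?g (sigma (topspace X) {U. openin X U}))"
      by (rule sets_vimage_algebra_cong) (simp add: X(4) borel_of_top_def)
    also have "\<dots> = sets (sigma (f ` space M) {?g -` U \<inter> f ` space M | U. U \<in> {U. openin X U}})"
      by (subst vimage_algebra_sigma) (use gf X(3) in \<open>auto dest: openin_subset\<close>)
    also have "{?g -` U \<inter> f ` space M | U. U \<in> {U. openin X U}} = {U. openin Y U}"
      unfolding Y_def openin_pullback_topology by auto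
    finally show ?thesis by (simp add: borel_of_top_def tY)
  qed
  ultimately show ?thesis unfolding standard_borel_measure_def by (intro exI[of _ Y] conjI)
qed

lemma standard_borel_measure_cong:
  assumes "sets M = sets N"
  shows "standard_borel_measure M \<longleftrightarrow> standard_borel_measure N"
  unfolding standard_borel_measure_def sets_eq_imp_space_eq[OF assms] assms ..

text \<open>Functions on a countable index set are coded by sequences vanishing off the range of an
  enumeration; these form a closed subset of a Polish space.\<close>

lemma standard_borel_measure_PiM:
  assumes I: "countable I"
  shows "standard_borel_measure (PiM I (\<lambda>_. borel :: real measure))"
proof -
  let ?Y = "PiM I (\<lambda>_. borel :: real measure)"
  let ?e = "to_nat_on I"
  have einj: "inj_on ?e I" by (rule inj_on_to_nat_on[OF I])
  define S where "S = {v :: nat \<Rightarrow> real. \<forall>n. n \<notin> ?e ` I \<longrightarrow> v n = 0}"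
  define f where "f v = (\<lambda>i\<in>I. v (?e i))" for v :: "nat \<Rightarrow> real"
  define g where "g u = (\<lambda>n. if n \<in> ?e ` I then u (the_inv_into I ?e n) else 0)" for u :: "'a \<Rightarrow> real"
  have "S = (\<Inter>n\<in>-(?e ` I). {v. v n = 0})" by (auto simp: S_def)
  moreover have "closed {v :: nat \<Rightarrow> real. v n = 0}" for n
    by (intro closed_Collect_eq continuous_intros continuous_on_product_coordinates)
  ultimately have cl: "closed S" by auto
  define R where "R = restrict_space (borel :: (nat \<Rightarrow> real) measure) S"
  have spR: "space R = S" by (simp add: R_def space_restrict_space)
  have spY: "space ?Y = PiE I (\<lambda>_. UNIV)" by (simp add: space_PiM)
  have gf: "g (f v) = v" if "v \<in> S" for v
    using that by (auto simp: g_def f_def S_def the_inv_into_f_f[OF einj] fun_eq_iff)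
  have fg: "f (g u) = u" if "u \<in> space ?Y" for u
    using that by (auto simp: g_def f_def spY the_inv_into_f_f[OF einj] PiE_iff extensional_def)
  have gS: "g u \<in> S" for u by (auto simp: g_def S_def)
  have stR: "standard_borel_measure R"
    unfolding standard_borel_measure_def
  proof (intro exI conjI)
    show "completely_metrizable_space (top_of_set S)"
      using cl by (simp add: completely_metrizable_space_closedin completely_metrizable_space_euclidean)
    show "second_countable (top_of_set S)"
      by (intro second_countable_subtopology second_countable_euclidean_space)
    show "space R = topspace (top_of_set S)" by (simp add: spR)
    have b: "sets (borel :: (nat \<Rightarrow> real) measure) = sigma_sets UNIV {U. open U}"
      by (simp add: borel_def)
    have "sets R = (\<lambda>A. S \<inter> A) ` sigma_sets UNIV {U. open U}"
      unfolding R_def sets_restrict_space b ..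
    also have "\<dots> = sigma_sets S ((\<lambda>A. S \<inter> A) ` {U. open U})"
      using borel_closed[OF cl] unfolding b by (rule sigma_sets_Int) simp
    also have "(\<lambda>A. S \<inter> A) ` {U. open U} = {U. openin (top_of_set S) U}"
      by (auto simp: openin_open)
    also have "sigma_sets S {U. openin (top_of_set S) U} = sets (borel_of_top (top_of_set S))"
      unfolding borel_of_top_def topspace_euclidean_subtopology
      by (rule sets_measure_of[symmetric]) (use openin_imp_subset in blast)
    finally show "sets R = sets (borel_of_top (top_of_set S))" .
  qed
  have finj: "inj_on f (space R)" unfolding spR using gf by (metis inj_onI)
  have fim: "f ` S = space ?Y"
  proof
    show "f ` S \<subseteq> space ?Y" by (auto simp: f_def spY)
    show "space ?Y \<subseteq> f ` S"
    proof
      fix u assume "u \<in> space ?Y"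
      then have "u = f (g u)" by (rule fg[symmetric])
      then show "u \<in> f ` S" using gS by (rule image_eqI)
    qed
  qed
  have fm: "f \<in> measurable R ?Y"
    unfolding f_def R_def
    by (intro measurable_restrict measurable_restrict_space1 borel_measurable_continuous_onI
        continuous_on_product_coordinates)
  have gm: "g \<in> measurable ?Y (borel :: (nat \<Rightarrow> real) measure)"
  proof (subst measurable_cong_sets[OF refl sets_PiM_equal_borel[symmetric]], rule measurable_PiM_single')
    fix n :: nat
    show "(\<lambda>u. g u n) \<in> borel_measurable ?Y"
    proof (cases "n \<in> ?e ` I")
      case True
      then have "the_inv_into I ?e n \<in> I" by (auto simp: the_inv_into_f_f[OF einj])
      then show ?thesis using True by (simp add: g_def measurable_component_singleton)
    qed (simp add: g_def)
  qed auto
  have "sets (embed_measure R f) = sets ?Y"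
  proof (intro equalityI subsetI)
    fix A assume "A \<in> sets (embed_measure R f)"
    then obtain A0 where A0: "A0 \<in> sets R" "A = f ` A0" by (auto simp: sets_embed_measure'[OF finj])
    have sub: "A0 \<subseteq> S" using sets.sets_into_space[OF A0(1)] spR by simp
    have "A0 \<in> sets borel"
      using A0(1) cl unfolding R_def by (simp add: sets_restrict_space_iff)
    then have "g -` A0 \<inter> space ?Y \<in> sets ?Y" by (rule measurable_sets[OF gm])
    also have "g -` A0 \<inter> space ?Y = A"
      unfolding A0(2) using sub gf fg fim by force
    finally show "A \<in> sets ?Y" .
  next
    fix A assume A: "A \<in> sets ?Y"
    have "f -` A \<inter> space R \<in> sets R" by (rule measurable_sets[OF fm A])
    moreover have "A \<subseteq> f ` S" using sets.sets_into_space[OF A] fim by simp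
    then have "A = f ` (f -` A \<inter> space R)" unfolding spR by auto
    ultimately show "A \<in> sets (embed_measure R f)" by (metis in_sets_embed_measure)
  qed
  then show ?thesis
    using standard_borel_measure_embed[OF stR finj] standard_borel_measure_cong by blast
qed

lemma exists_inj_PiE_real:
  assumes I: "countable I"
  obtains \<iota> :: "('i \<Rightarrow> real) \<Rightarrow> real" where "inj_on \<iota> (PiE I (\<lambda>_. UNIV))"
proof -
  obtain k :: "nat set \<Rightarrow> real" where bij: "bij k"
    using nat_sets_eqpoll_reals unfolding eqpoll_def by (rule exE)
  then have k: "inj k" by (rule bij_is_inj)
  define h where "h = inv_into UNIV k"
  have h: "inj h" unfolding h_def using bij by (intro bij_is_inj bij_imp_bij_inv)
  define \<iota> where "\<iota> u = k {prod_encode (to_nat_on I i, n) | i n. i \<in> I \<and> n \<in> h (u i)}" for u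
  have "inj_on \<iota> (PiE I (\<lambda>_. UNIV))"
  proof (rule inj_onI)
    fix u v assume u: "u \<in> PiE I (\<lambda>_. UNIV)" and v: "v \<in> PiE I (\<lambda>_. UNIV)" and e: "\<iota> u = \<iota> v"
    have *: "{prod_encode (to_nat_on I i, n) | i n. i \<in> I \<and> n \<in> h (u i)} =
        {prod_encode (to_nat_on I i, n) | i n. i \<in> I \<and> n \<in> h (v i)}" (is "?U u = ?U v")
      using injD[OF k e[unfolded \<iota>_def]] .
    show "u = v"
    proof (rule PiE_ext[OF u v])
      fix i assume i: "i \<in> I"
      have mem: "n \<in> h (w i) \<longleftrightarrow> prod_encode (to_nat_on I i, n) \<in> ?U w" for n w
        using i inj_on_eq_iff[OF inj_on_to_nat_on[OF I]] by auto
      have "n \<in> h (u i) \<longleftrightarrow> n \<in> h (v i)" for n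
        unfolding mem * ..
      then have "h (u i) = h (v i)" by auto
      then show "u i = v i" using h by (rule injD[rotated])
    qed
  qed
  then show ?thesis by (rule that)
qed

lemma group_actionI:
  assumes G: "group G"
    and ext: "\<And>g. g \<in> carrier G \<Longrightarrow> act g \<in> extensional E"
    and cl: "\<And>g x. g \<in> carrier G \<Longrightarrow> x \<in> E \<Longrightarrow> act g x \<in> E"
    and mult: "\<And>g h x. g \<in> carrier G \<Longrightarrow> h \<in> carrier G \<Longrightarrow> x \<in> E \<Longrightarrow> act (g \<otimes>\<^bsub>G\<^esub> h) x = act g (act h x)"
    and one: "\<And>x. x \<in> E \<Longrightarrow> act \<one>\<^bsub>G\<^esub> x = x"
  shows "group_action G E act"
proof -
  interpret group G by fact
  have bij: "act g \<in> Bij E" if g: "g \<in> carrier G" for g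
  proof -
    have "bij_betw (act g) E E"
    proof (rule bij_betw_byWitness[where f'="act (inv\<^bsub>G\<^esub> g)"])
      show "\<forall>a\<in>E. act (inv\<^bsub>G\<^esub> g) (act g a) = a"
        using g by (simp add: one flip: mult)
      show "\<forall>a\<in>E. act g (act (inv\<^bsub>G\<^esub> g) a) = a"
        using g by (simp add: one flip: mult)
    qed (use cl g in auto)
    then show ?thesis using ext[OF g] by (simp add: Bij_def)
  qed
  show ?thesis
    unfolding group_action_def group_hom_def group_hom_axioms_def
  proof (intro conjI G group_BijGroup homI)
    show "act g \<in> carrier (BijGroup E)" if "g \<in> carrier G" for g
      using bij[OF that] by (simp add: BijGroup_def)
    fix g h assume gh: "g \<in> carrier G" "h \<in> carrier G"
    show "act (g \<otimes>\<^bsub>G\<^esub> h) = act g \<otimes>\<^bsub>BijGroup E\<^esub> act h"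
    proof
      fix x
      show "act (g \<otimes>\<^bsub>G\<^esub> h) x = (act g \<otimes>\<^bsub>BijGroup E\<^esub> act h) x"
        using gh bij mult[OF gh] ext[of "g \<otimes>\<^bsub>G\<^esub> h"]
        by (cases "x \<in> E") (auto simp: BijGroup_def compose_def extensional_def)
    qed
  qed
qed

section \<open>Functions on the group as a boundary\<close>

context group
begin

lemma shift_mult:
  assumes "g \<in> carrier G" "h \<in> carrier G"
  shows "shift G (g \<otimes> h) u = shift G g (shift G h u)"
  using assms by (auto simp: shift_def m_assoc)

lemma shift_one: "u \<in> PiE (carrier G) (\<lambda>_. UNIV) \<Longrightarrow> shift G \<one> u = u"
  by (auto simp: shift_def PiE_iff extensional_def fun_eq_iff)

lemma shift_space: "shift G g u \<in> PiE (carrier G) (\<lambda>_. UNIV)"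
  by (auto simp: shift_def)

lemma shift_measurable:
  assumes "g \<in> carrier G"
  shows "shift G g \<in> measurable (fun_borel G) (fun_borel G)"
  unfolding shift_def
  by (intro measurable_restrict borel_measurable_add borel_measurable_diff measurable_component_singleton)
     (use assms in auto)

lemma shift_fixed_hom:
  assumes fixed: "\<And>g. g \<in> carrier G \<Longrightarrow> shift G g u = u"
  shows "(\<lambda>g. u g - u \<one>) \<in> hom G real_group"
proof (rule homI)
  fix g h assume "g \<in> carrier G" "h \<in> carrier G"
  then have "u g = u (g \<otimes> h) - u h + u \<one>"
    using fun_cong[OF fixed[of h], of g] by (simp add: shift_def)
  then show "u (g \<otimes> h) - u \<one> = (u g - u \<one>) \<otimes>\<^bsub>real_group\<^esub> (u h - u \<one>)"
    by (simp add: real_group_def)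
qed (simp add: real_group_def)

end

text \<open>A common equivariant image of \<open>m\<close> and \<open>\<nu>\<close> in the space of functions on the group yields one on the
  real line: the Borel structure and the action are carried over along a set-theoretic injection, which
  need not be measurable for the usual Borel structure of the line.\<close>

lemma real_model_of_factor:
  fixes G :: "('g, 'z) monoid_scheme" and actX :: "('g \<times> real) \<Rightarrow> 'x \<Rightarrow> 'x"
    and m :: "'b measure"
  assumes G: "group G" and ctb: "countable (carrier G)"
    and \<pi>: "\<pi> \<in> measurable m (fun_borel G)"
    and \<pi>_eq: "\<And>g b. g \<in> carrier G \<Longrightarrow> b \<in> space m \<Longrightarrow> \<pi> (actB g b) = shift G g (\<pi> b)"
    and F: "F \<in> measurable \<nu> (fun_borel G)"
    and F_eq: "\<And>g t. g \<in> carrier G \<Longrightarrow> AE x in \<nu>. F (actX (g, t) x) = shift G g (F x)"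
    and law: "distr \<nu> (fun_borel G) F = distr m (fun_borel G) \<pi>"
    and nontriv: "\<And>u. u \<in> PiE (carrier G) (\<lambda>_. UNIV) \<Longrightarrow>
      (\<And>g. g \<in> carrier G \<Longrightarrow> shift G g u = u) \<Longrightarrow>
      distr \<nu> (fun_borel G) F \<noteq> return (fun_borel G) u"
  shows "\<exists>(\<eta> :: real measure) actY. boundary_of G m actB \<eta> actY \<and> \<not> trivial_boundary G \<eta> actY \<and>
    measurable_factor (G \<times>\<times> real_group) \<nu> actX \<eta> (\<lambda>(\<gamma>, t). actY \<gamma>)"
proof -
  interpret group G by fact
  let ?Y = "fun_borel G"
  let ?E = "PiE (carrier G) (\<lambda>_. UNIV :: real set)"
  obtain \<iota> :: "('g \<Rightarrow> real) \<Rightarrow> real" where \<iota>: "inj_on \<iota> ?E" using exists_inj_PiE_real[OF ctb] .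
  define \<eta>0 where "\<eta>0 = distr m ?Y \<pi>"
  define \<eta> where "\<eta> = embed_measure \<eta>0 \<iota>"
  define actY where "actY g = (\<lambda>y\<in>\<iota> ` ?E. \<iota> (shift G g (the_inv_into ?E \<iota> y)))" for g
  have sp0: "space \<eta>0 = ?E" by (simp add: \<eta>0_def space_PiM)
  have sets0: "sets \<eta>0 = sets ?Y" by (simp add: \<eta>0_def)
  have inj0: "inj_on \<iota> (space \<eta>0)" using \<iota> sp0 by simp
  have sp: "space \<eta> = \<iota> ` ?E" by (simp add: \<eta>_def space_embed_measure sp0)
  have \<iota>_meas: "\<iota> \<in> measurable \<eta>0 \<eta>" unfolding \<eta>_def by (rule measurable_embed_measure2'[OF inj0])
  then have \<iota>_measY: "\<iota> \<in> measurable ?Y \<eta>" by (simp add: measurable_cong_sets[OF sets0 refl])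
  have inv: "the_inv_into ?E \<iota> (\<iota> u) = u" if "u \<in> ?E" for u using \<iota> that by (rule the_inv_into_f_f)
  have actY_\<iota>: "actY g (\<iota> u) = \<iota> (shift G g u)" if "u \<in> ?E" for g u
    using that inv by (simp add: actY_def)
  have distr\<iota>: "distr \<eta>0 \<eta> \<iota> = \<eta>"
    unfolding \<eta>_def by (rule embed_measure_eq_distr'[OF inj0, symmetric])
  have action: "standard_borel_space_action G \<eta> actY"
    unfolding standard_borel_space_action_def
  proof (intro conjI ballI)
    show "standard_borel_measure \<eta>"
      unfolding \<eta>_def using standard_borel_measure_PiM[OF ctb] standard_borel_measure_cong[OF sets0]
      by (intro standard_borel_measure_embed inj0) simp
    show "group_action G (space \<eta>) actY"
      unfolding sp
    proof (rule group_actionI[OF G])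
      show "actY g \<in> extensional (\<iota> ` ?E)" for g by (simp add: actY_def)
      show "actY g y \<in> \<iota> ` ?E" if "y \<in> \<iota> ` ?E" for g y
        using that shift_space by (auto simp: actY_\<iota>)
      show "actY (g \<otimes>\<^bsub>G\<^esub> h) y = actY g (actY h y)" if "g \<in> carrier G" "h \<in> carrier G" "y \<in> \<iota> ` ?E" for g h y
        using that by (auto simp: actY_\<iota> shift_space shift_mult)
      show "actY \<one>\<^bsub>G\<^esub> y = y" if "y \<in> \<iota> ` ?E" for y
        using that by (auto simp: actY_\<iota> shift_one)
    qed
    fix g assume g: "g \<in> carrier G"
    have "(\<lambda>u. \<iota> (shift G g u)) \<in> measurable \<eta>0 \<eta>"
      using measurable_compose[OF shift_measurable[OF g] \<iota>_measY] by (simp add: measurable_cong_sets[OF sets0 refl])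
    also have "?this \<longleftrightarrow> (\<lambda>u. actY g (\<iota> u)) \<in> measurable \<eta>0 \<eta>"
      by (rule measurable_cong) (simp add: sp0 actY_\<iota>)
    finally show "actY g \<in> measurable \<eta> \<eta>"
      unfolding \<eta>_def by (rule measurable_embed_measure1)
  qed
  have \<pi>E: "\<pi> b \<in> ?E" if "b \<in> space m" for b using measurable_space[OF \<pi> that] by (simp add: space_PiM)
  have FE: "F x \<in> ?E" if "x \<in> space \<nu>" for x using measurable_space[OF F that] by (simp add: space_PiM)
  have "boundary_of G m actB \<eta> actY"
    unfolding boundary_of_def
  proof (intro conjI action bexI ballI)
    show "(\<lambda>b. \<iota> (\<pi> b)) \<in> measurable m \<eta>" by (rule measurable_compose[OF \<pi> \<iota>_measY])
    show "\<iota> (\<pi> (actB g b)) = actY g (\<iota> (\<pi> b))" if "g \<in> carrier G" "b \<in> space m" for g b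
      using that by (simp add: actY_\<iota> \<pi>E \<pi>_eq)
    have "distr m \<eta> (\<lambda>b. \<iota> (\<pi> b)) = distr \<eta>0 \<eta> \<iota>"
      unfolding \<eta>0_def by (subst distr_distr[OF \<iota>_measY \<pi>]) (simp add: comp_def)
    then show "distr m \<eta> (\<lambda>b. \<iota> (\<pi> b)) = \<eta>" by (simp add: distr\<iota>)
  qed
  moreover have "measurable_factor (G \<times>\<times> real_group) \<nu> actX \<eta> (\<lambda>(\<gamma>, t). actY \<gamma>)"
    unfolding measurable_factor_def
  proof (intro bexI conjI ballI)
    have Fm: "(\<lambda>x. \<iota> (F x)) \<in> measurable \<nu> \<eta>" by (rule measurable_compose[OF F \<iota>_measY])
    then show "(\<lambda>x. \<iota> (F x)) \<in> measurable (completion \<nu>) \<eta>" by (rule measurable_completion)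
    have "distr \<nu> \<eta> (\<lambda>x. \<iota> (F x)) = distr (distr \<nu> ?Y F) \<eta> \<iota>"
      by (subst distr_distr[OF \<iota>_measY F]) (simp add: comp_def)
    also have "\<dots> = \<eta>" using distr\<iota> law by (simp add: \<eta>0_def)
    finally show "distr (completion \<nu>) \<eta> (\<lambda>x. \<iota> (F x)) = \<eta>"
      using Fm by (simp add: distr_completion)
    fix g assume "g \<in> carrier (G \<times>\<times> real_group)"
    then obtain \<gamma> t where g: "g = (\<gamma>, t)" "\<gamma> \<in> carrier G" by (auto simp: DirProd_def)
    show "AE x in \<nu>. \<iota> (F (actX g x)) = (case g of (\<gamma>, t) \<Rightarrow> actY \<gamma>) (\<iota> (F x))"
      using F_eq[OF g(2), of t] by (rule AE_mp) (intro AE_I2 impI, simp add: g actY_\<iota> FE)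
  qed
  moreover have "\<not> trivial_boundary G \<eta> actY"
  proof
    assume "trivial_boundary G \<eta> actY"
    then obtain u where u: "u \<in> ?E" and fixed: "\<And>g. g \<in> carrier G \<Longrightarrow> actY g (\<iota> u) = \<iota> u"
      and ret: "\<eta> = return \<eta> (\<iota> u)"
      unfolding trivial_boundary_def sp by auto
    have "shift G g u = u" if "g \<in> carrier G" for g
      using fixed[OF that] inj_onD[OF \<iota> _ shift_space u] by (simp add: actY_\<iota> u)
    moreover have "\<eta>0 = return ?Y u"
    proof (rule measure_eqI)
      show "sets \<eta>0 = sets (return ?Y u)" by (simp add: sets0)
      fix A assume A: "A \<in> sets \<eta>0"
      then have AE: "A \<subseteq> ?E" using sets.sets_into_space sp0 by blast
      have A': "\<iota> ` A \<in> sets \<eta>" unfolding \<eta>_def by (rule in_sets_embed_measure[OF A])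
      have "emeasure \<eta>0 A = emeasure \<eta> (\<iota> ` A)"
        unfolding \<eta>_def by (rule emeasure_embed_measure_image'[OF inj0 A, symmetric])
      also have "\<dots> = indicator (\<iota> ` A) (\<iota> u)" by (subst ret) (rule emeasure_return[OF A'])
      also have "\<dots> = indicator A u" using inj_on_image_mem_iff[OF \<iota> u AE] by (simp add: indicator_def)
      also have "\<dots> = emeasure (return ?Y u) A" using A sets0 by simp
      finally show "emeasure \<eta>0 A = emeasure (return ?Y u) A" .
    qed
    ultimately show False using nontriv[OF u] law by (simp add: \<eta>0_def)
  qed
  ultimately show ?thesis by blast
qed

section \<open>Fibres of the hull of a twist\<close>

lemma group_real_group: "group real_group"
  by (rule groupI) (auto simp: real_group_def intro: exI[of _ "- _"])

lemma real_group_simps [simp]: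
  "carrier real_group = UNIV" "x \<otimes>\<^bsub>real_group\<^esub> y = x + y" "\<one>\<^bsub>real_group\<^esub> = 0"
  by (simp_all add: real_group_def)

lemma inv_real_group [simp]: "inv\<^bsub>real_group\<^esub> x = - x"
  using group.inv_equality[OF group_real_group, of "- x" x] by simp

lemma mem_real_action: "t \<in> set_action real_group a E \<longleftrightarrow> t + a \<in> E"
  unfolding set_action_def r_coset_def by (auto intro: bexI[of _ "t + a"])

lemma topspace_cyl: "topspace (cyl_topology G) = carrier G \<times> UNIV"
  by (simp add: cyl_topology_def)

lemma openin_cyl:
  assumes "A \<subseteq> carrier G" "open U"
  shows "openin (cyl_topology G) (A \<times> U)"
  using assms by (simp add: cyl_topology_def openin_prod_Times_iff)

lemma compactin_cyl:
  assumes "g \<in> carrier G" "compact K"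
  shows "compactin (cyl_topology G) ({g} \<times> K)"
  using assms by (simp add: cyl_topology_def compactin_Times)

text \<open>The fibre of a subset of the product of the group and the line over a group element.\<close>

definition fibre :: "('g \<times> real) set \<Rightarrow> 'g \<Rightarrow> real set" where
  "fibre Q g = {t. (g, t) \<in> Q}"

lemma closed_fibre:
  assumes Q: "closedin (cyl_topology G) Q" and g: "g \<in> carrier G"
  shows "closed (fibre Q g)"
proof -
  have "continuous_map euclideanreal (cyl_topology G) (\<lambda>t. (g, t))"
    using g by (simp add: cyl_topology_def continuous_map_pairwise comp_def)
  from closedin_continuous_map_preimage[OF this Q] show ?thesis
    by (simp add: fibre_def)
qed

lemma topspace_fell: "topspace (fell_topology X) = {F. closedin X F}"
proof -
  have "{F. closedin X F} \<in> {{F. closedin X F \<and> F \<inter> K = {}} | K. compactin X K}"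
    by (auto intro!: exI[of _ "{}"])
  then show ?thesis unfolding fell_topology_def topology_generated_by_topspace by auto
qed

lemma openin_fell_miss: "compactin X K \<Longrightarrow> openin (fell_topology X) {F. closedin X F \<and> F \<inter> K = {}}"
  unfolding fell_topology_def by (intro topology_generated_by_Basis) auto

lemma openin_fell_hit: "openin X U \<Longrightarrow> openin (fell_topology X) {F. closedin X F \<and> F \<inter> U \<noteq> {}}"
  unfolding fell_topology_def by (intro topology_generated_by_Basis) auto

text \<open>The fibre over \<open>g\<close> is the translate by \<open>- s\<close> of the fibre over the identity.\<close>

definition offset :: "('g, 'z) monoid_scheme \<Rightarrow> ('g \<times> real) set \<Rightarrow> 'g \<Rightarrow> real \<Rightarrow> bool" where
  "offset G Q g s \<longleftrightarrow> fibre Q g = {t. t + s \<in> fibre Q \<one>\<^bsub>G\<^esub>}"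

lemma offset_iff: "offset G Q g s \<longleftrightarrow> (\<forall>t. (g, t) \<in> Q \<longleftrightarrow> (\<one>\<^bsub>G\<^esub>, t + s) \<in> Q)"
  by (simp add: offset_def fibre_def set_eq_iff)

text \<open>If two closed sets of reals differ up to a translation, a point of one misses the other by a margin; this
  persists under small changes of the sets in the Fell topology and of the translation.\<close>

lemma not_offset_open:
  assumes G: "group G" and Q: "closedin (cyl_topology G) Q" and g: "g \<in> carrier G"
    and no: "\<not> offset G Q g s"
  obtains W e where "openin (fell_topology (cyl_topology G)) W" "Q \<in> W" "0 < e"
    "\<And>Q' s'. Q' \<in> W \<Longrightarrow> \<bar>s' - s\<bar> < e \<Longrightarrow> \<not> offset G Q' g s'"
proof -
  interpret group G by fact
  let ?T = "cyl_topology G"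
  have sep: "\<exists>e>0. \<forall>y. \<bar>y - x\<bar> \<le> 2 * e \<longrightarrow> y \<notin> fibre Q h" if x: "x \<notin> fibre Q h" and h: "h \<in> carrier G" for x h
  proof -
    have "open (- fibre Q h)" using closed_fibre[OF Q h] by (simp add: open_Compl)
    then obtain d where d: "0 < d" "ball x d \<subseteq> - fibre Q h"
      using x by (metis ComplI openE)
    have "y \<notin> fibre Q h" if "dist y x < d" for y
      using d(2) that by (auto simp: dist_commute)
    with d(1) show ?thesis by (intro exI[of _ "d / 3"]) (auto simp: dist_real_def)
  qed
  let ?W = "\<lambda>h k x y e. {F. closedin ?T F \<and> F \<inter> ({h} \<times> {x - 2 * e..x + 2 * e}) = {}} \<inter>
    {F. closedin ?T F \<and> F \<inter> ({k} \<times> {y - e<..<y + e}) \<noteq> {}}"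
  have Wo: "openin (fell_topology ?T) (?W h k x y e)" if "h \<in> carrier G" "k \<in> carrier G" for h k x y e
    using that by (intro openin_Int openin_fell_miss openin_fell_hit compactin_cyl openin_cyl) auto
  from no consider t where "t \<in> fibre Q g" "t + s \<notin> fibre Q \<one>\<^bsub>G\<^esub>"
    | t where "t \<notin> fibre Q g" "t + s \<in> fibre Q \<one>\<^bsub>G\<^esub>"
    unfolding offset_def by auto
  then show ?thesis
  proof cases
    case 1
    from sep[OF 1(2)] obtain e where e: "0 < e" "\<And>y. \<bar>y - (t + s)\<bar> \<le> 2 * e \<Longrightarrow> y \<notin> fibre Q \<one>\<^bsub>G\<^esub>" by auto
    show ?thesis
    proof (rule that[of "?W \<one>\<^bsub>G\<^esub> g (t + s) t e" e])
      show "openin (fell_topology ?T) (?W \<one>\<^bsub>G\<^esub> g (t + s) t e)" by (rule Wo) (use g in auto)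
      show "Q \<in> ?W \<one>\<^bsub>G\<^esub> g (t + s) t e"
        using Q e 1(1) by (auto simp: fibre_def abs_le_iff)
      fix Q' s' assume Q': "Q' \<in> ?W \<one>\<^bsub>G\<^esub> g (t + s) t e" and s': "\<bar>s' - s\<bar> < e"
      then obtain y where y: "(g, y) \<in> Q'" "t - e < y" "y < t + e" by auto
      have "y + s' \<in> {t + s - 2 * e..t + s + 2 * e}" using y s' by (auto simp: abs_less_iff)
      then have "(\<one>\<^bsub>G\<^esub>, y + s') \<notin> Q'" using Q' by blast
      with y(1) show "\<not> offset G Q' g s'" unfolding offset_iff by blast
    qed (use g e in auto)
  next
    case 2
    from sep[OF 2(1) g] obtain e where e: "0 < e" "\<And>y. \<bar>y - t\<bar> \<le> 2 * e \<Longrightarrow> y \<notin> fibre Q g" by auto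
    show ?thesis
    proof (rule that[of "?W g \<one>\<^bsub>G\<^esub> t (t + s) e" e])
      show "openin (fell_topology ?T) (?W g \<one>\<^bsub>G\<^esub> t (t + s) e)" by (rule Wo) (use g in auto)
      show "Q \<in> ?W g \<one>\<^bsub>G\<^esub> t (t + s) e"
        using Q e 2(2) by (auto simp: fibre_def abs_le_iff)
      fix Q' s' assume Q': "Q' \<in> ?W g \<one>\<^bsub>G\<^esub> t (t + s) e" and s': "\<bar>s' - s\<bar> < e"
      then obtain y where y: "(\<one>\<^bsub>G\<^esub>, y) \<in> Q'" "t + s - e < y" "y < t + s + e" by auto
      have "y - s' \<in> {t - 2 * e..t + 2 * e}" using y s' by (auto simp: abs_less_iff)
      then have n: "(g, y - s') \<notin> Q'" using Q' by blast
      show "\<not> offset G Q' g s'"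
      proof
        assume "offset G Q' g s'"
        then have "(g, y - s') \<in> Q' \<longleftrightarrow> (\<one>\<^bsub>G\<^esub>, (y - s') + s') \<in> Q'" unfolding offset_iff by (rule spec)
        with n y(1) show False by simp
      qed
    qed (use g e in auto)
  qed
qed

text \<open>Compactness of the interval of offsets turns the local statement into a closed condition.\<close>

lemma closedin_offset:
  assumes G: "group G" and g: "g \<in> carrier G"
  shows "closedin (fell_topology (cyl_topology G))
    {Q. closedin (cyl_topology G) Q \<and> (\<exists>s\<in>{a..b}. offset G Q g s)}"
    (is "closedin ?F ?S")
proof (rule closedin_def[THEN iffD2, OF conjI])
  show "?S \<subseteq> topspace ?F" by (auto simp: topspace_fell)
  show "openin ?F (topspace ?F - ?S)"
  proof (subst openin_subopen, intro ballI)
    fix Q assume "Q \<in> topspace ?F - ?S"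
    then have Q: "closedin (cyl_topology G) Q" and no: "\<And>s. s \<in> {a..b} \<Longrightarrow> \<not> offset G Q g s"
      by (auto simp: topspace_fell)
    have "\<forall>s\<in>{a..b}. \<exists>W e. openin ?F W \<and> Q \<in> W \<and> 0 < e \<and>
        (\<forall>Q' s'. Q' \<in> W \<longrightarrow> \<bar>s' - s\<bar> < e \<longrightarrow> \<not> offset G Q' g s')"
    proof
      fix s assume s: "s \<in> {a..b}"
      obtain W e where
        "openin ?F W" "Q \<in> W" "0 < e" "\<And>Q' s'. Q' \<in> W \<Longrightarrow> \<bar>s' - s\<bar> < e \<Longrightarrow> \<not> offset G Q' g s'"
        by (rule not_offset_open[OF G Q g no[OF s]]) metis
      then show "\<exists>W e. openin ?F W \<and> Q \<in> W \<and> 0 < e \<and>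
          (\<forall>Q' s'. Q' \<in> W \<longrightarrow> \<bar>s' - s\<bar> < e \<longrightarrow> \<not> offset G Q' g s')"
        by (intro exI[of _ W] exI[of _ e]) simp
    qed
    then obtain W e where We: "\<And>s. s \<in> {a..b} \<Longrightarrow> openin ?F (W s) \<and> Q \<in> W s \<and> 0 < e s \<and>
        (\<forall>Q' s'. Q' \<in> W s \<longrightarrow> \<bar>s' - s\<bar> < e s \<longrightarrow> \<not> offset G Q' g s')"
      by metis
    have "{a..b} \<subseteq> (\<Union>s\<in>{a..b}. ball s (e s))" using We by force
    then obtain C where C: "C \<subseteq> {a..b}" "finite C" "{a..b} \<subseteq> (\<Union>s\<in>C. ball s (e s))"
      using compactE_image[OF compact_Icc, of "{a..b}" "\<lambda>s. ball s (e s)" a b] by (metis open_ball)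
    define V where "V = topspace ?F \<inter> \<Inter>(W ` C)"
    have "openin ?F V"
    proof (cases "C = {}")
      case False
      then have "openin ?F (\<Inter>(W ` C))"
        using C We by (intro openin_Inter) auto
      then show ?thesis unfolding V_def by (intro openin_Int) auto
    qed (simp add: V_def)
    moreover have "Q \<in> V" using Q C We by (auto simp: V_def topspace_fell)
    moreover have "V \<subseteq> topspace ?F - ?S"
    proof
      fix Q' assume Q': "Q' \<in> V"
      have "\<not> offset G Q' g s" if s: "s \<in> {a..b}" for s
      proof -
        obtain s0 where s0: "s0 \<in> C" "s \<in> ball s0 (e s0)" using C(3) s by blast
        then have "Q' \<in> W s0" "\<bar>s - s0\<bar> < e s0" using Q' by (auto simp: V_def dist_real_def)
        then show ?thesis using We s0(1) C(1) by blast
      qed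
      then show "Q' \<in> topspace ?F - ?S" using Q' by (auto simp: V_def)
    qed
    ultimately show "\<exists>T. openin ?F T \<and> Q \<in> T \<and> T \<subseteq> topspace ?F - ?S" by blast
  qed
qed

lemma continuous_map_fibre:
  assumes g: "g \<in> carrier G"
  shows "continuous_map (fell_topology (cyl_topology G)) (fell_topology euclideanreal) (\<lambda>Q. fibre Q g)"
proof -
  let ?F = "fell_topology (cyl_topology G)"
  have eq: "(\<lambda>Q. fibre Q g) -` {F. closedin euclideanreal F \<and> R F} \<inter> topspace ?F =
      {Q. closedin (cyl_topology G) Q \<and> R (fibre Q g)}" for R
    using closed_fibre[OF _ g] by (auto simp: topspace_fell)
  have int: "fibre Q g \<inter> A = {} \<longleftrightarrow> Q \<inter> ({g} \<times> A) = {}" for Q :: "('a \<times> real) set" and A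
    by (auto simp: fibre_def)
  have "openin ?F ((\<lambda>Q. fibre Q g) -` U \<inter> topspace ?F)"
    if U: "U \<in> {{F. closedin euclideanreal F \<and> F \<inter> K = {}} | K. compactin euclideanreal K} \<union>
      {{F. closedin euclideanreal F \<and> F \<inter> U \<noteq> {}} | U. openin euclideanreal U}" for U
    using U
  proof
    assume "U \<in> {{F. closedin euclideanreal F \<and> F \<inter> K = {}} | K. compactin euclideanreal K}"
    then obtain K where K: "compact K" "U = {F. closedin euclideanreal F \<and> F \<inter> K = {}}" by auto
    show ?thesis unfolding K(2) eq int by (rule openin_fell_miss[OF compactin_cyl[OF g K(1)]])
  next
    assume "U \<in> {{F. closedin euclideanreal F \<and> F \<inter> U \<noteq> {}} | U. openin euclideanreal U}"
    then obtain V where V: "open V" "U = {F. closedin euclideanreal F \<and> F \<inter> V \<noteq> {}}" by auto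
    show ?thesis unfolding V(2) eq int by (rule openin_fell_hit) (use g V in \<open>auto intro!: openin_cyl\<close>)
  qed
  moreover have "(\<lambda>Q. fibre Q g) ` topspace ?F \<subseteq> topspace (fell_topology euclideanreal)"
    using closed_fibre[OF _ g] by (auto simp: topspace_fell)
  ultimately show ?thesis
    unfolding fell_topology_def[of euclideanreal] topology_generated_by_topspace
    by (rule continuous_on_generated_topo)
qed

text \<open>The data of a twist by a quasimorphism of defect at most \<open>D\<close>, with freeness of the action on the hull
  of \<open>P\<close>.\<close>

locale twisted_hull = group G for G :: "('g, 'z) monoid_scheme" (structure) +
  fixes P :: "real set" and \<phi> :: "'g \<Rightarrow> real" and D :: real
  assumes closed_P: "closed P"
    and free: "free_on real_group (orbit_hull real_group euclideanreal P) (set_action real_group)"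
    and qm: "g \<in> carrier G \<Longrightarrow> h \<in> carrier G \<Longrightarrow> \<bar>\<phi> (g \<otimes> h) - \<phi> g - \<phi> h\<bar> \<le> D"
    and \<phi>_one: "\<phi> \<one> = 0"
begin

abbreviation "hullM \<equiv> hull_borel (G \<times>\<times> real_group) (cyl_topology G) (twist G P \<phi>)"
abbreviation "GR \<equiv> G \<times>\<times> real_group"
abbreviation "cyl \<equiv> cyl_topology G"
abbreviation "twhull \<equiv> orbit_hull GR cyl (twist G P \<phi>)"

lemma fibre_action:
  assumes Q: "Q \<subseteq> carrier G \<times> UNIV" and g: "g \<in> carrier G" and h: "h \<in> carrier G"
  shows "fibre (set_action GR (g, r) Q) h = {t. t + r \<in> fibre Q (h \<otimes> g)}"
proof -
  have i: "inv\<^bsub>GR\<^esub> (g, r) = (inv g, - r)"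
    using inv_DirProd[OF group_axioms group_real_group, of g r] g by simp
  have "(h, t) \<in> set_action GR (g, r) Q \<longleftrightarrow> (h \<otimes> g, t + r) \<in> Q" for t
  proof
    assume "(h, t) \<in> set_action GR (g, r) Q"
    then obtain a b where ab: "(a, b) \<in> Q" "h = a \<otimes> inv g" "t = b - r"
      unfolding set_action_def r_coset_def i by (auto simp: DirProd_def)
    then have "a \<in> carrier G" using Q by auto
    then show "(h \<otimes> g, t + r) \<in> Q" using ab g by (simp add: m_assoc)
  next
    assume "(h \<otimes> g, t + r) \<in> Q"
    then show "(h, t) \<in> set_action GR (g, r) Q"
      unfolding set_action_def r_coset_def i using g h
      by (intro UN_I[of "(h \<otimes> g, t + r)"]) (auto simp: DirProd_def m_assoc)
  qed
  then show ?thesis by (simp add: fibre_def)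
qed

lemma twist_sub: "twist G P \<phi> \<subseteq> carrier G \<times> UNIV"
  by (auto simp: twist_def)

lemma fibre_twist: "h \<in> carrier G \<Longrightarrow> fibre (twist G P \<phi>) h = {t. t + \<phi> h \<in> P}"
  by (auto simp: fibre_def twist_def add.commute)

lemma fibre_orbit:
  assumes g: "g \<in> carrier G" and h: "h \<in> carrier G"
  shows "fibre (set_action GR (g, r) (twist G P \<phi>)) h = {t. t + (r + \<phi> (h \<otimes> g)) \<in> P}"
  using g h by (simp add: fibre_action[OF twist_sub] fibre_twist add.assoc)

lemma orbit_offset:
  assumes g: "g \<in> carrier G" and h: "h \<in> carrier G"
  shows "offset G (set_action GR (g, r) (twist G P \<phi>)) h (\<phi> (h \<otimes> g) - \<phi> g)"
  unfolding offset_def using g h by (simp add: fibre_orbit algebra_simps)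

lemma hull_closed: "Q \<in> twhull \<Longrightarrow> closedin cyl Q"
  using closure_of_subset_topspace[of "fell_topology cyl"]
  unfolding orbit_hull_def topspace_fell by blast

lemma hull_sub: "Q \<in> twhull \<Longrightarrow> Q \<subseteq> carrier G \<times> UNIV"
  using hull_closed[THEN closedin_subset] by (simp add: topspace_cyl)

lemma hull_offset:
  assumes Q: "Q \<in> twhull" and h: "h \<in> carrier G"
  shows "\<exists>s\<in>{\<phi> h - D..\<phi> h + D}. offset G Q h s"
proof -
  let ?F = "fell_topology cyl"
  let ?S = "{Q. closedin cyl Q \<and> (\<exists>s\<in>{\<phi> h - D..\<phi> h + D}. offset G Q h s)}"
  let ?O = "{set_action GR z (twist G P \<phi>) | z. z \<in> carrier GR}"
  \<comment> \<open>Only the orbit points that are closed sets matter for the closure.\<close>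
  have "topspace ?F \<inter> ?O \<subseteq> ?S"
  proof
    fix Q assume "Q \<in> topspace ?F \<inter> ?O"
    then obtain g r where g: "g \<in> carrier G" and Qe: "Q = set_action GR (g, r) (twist G P \<phi>)" and Qc: "closedin cyl Q"
      by (auto simp: DirProd_def topspace_fell)
    have "\<phi> (h \<otimes> g) - \<phi> g \<in> {\<phi> h - D..\<phi> h + D}" using qm[OF h g] by (auto simp: abs_le_iff)
    then show "Q \<in> ?S" using orbit_offset[OF g h] Qe Qc by blast
  qed
  then have "?F closure_of (topspace ?F \<inter> ?O) \<subseteq> ?S"
    by (rule closure_of_minimal) (rule closedin_offset[OF group_axioms h])
  then show ?thesis using Q unfolding orbit_hull_def by (auto simp flip: closure_of_restrict)
qed

lemma hull_fibre_one:
  assumes Q: "Q \<in> twhull"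
  shows "fibre Q \<one> \<in> orbit_hull real_group euclideanreal P"
proof -
  let ?O = "{set_action GR z (twist G P \<phi>) | z. z \<in> carrier GR}"
  have "fibre Q \<one> \<in> (\<lambda>Q. fibre Q \<one>) ` (fell_topology cyl closure_of ?O)"
    using Q unfolding orbit_hull_def by blast
  also have "\<dots> \<subseteq> fell_topology euclideanreal closure_of ((\<lambda>Q. fibre Q \<one>) ` ?O)"
    by (rule continuous_map_image_closure_subset[OF continuous_map_fibre]) simp
  also have "\<dots> \<subseteq> orbit_hull real_group euclideanreal P"
    unfolding orbit_hull_def
  proof (rule closure_of_mono, rule image_subsetI)
    fix Q assume "Q \<in> ?O"
    then obtain g r where g: "g \<in> carrier G" and Qe: "Q = set_action GR (g, r) (twist G P \<phi>)"
      by (auto simp: DirProd_def)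
    have "fibre Q \<one> = set_action real_group (r + \<phi> g) P"
      using g by (auto simp: Qe fibre_orbit mem_real_action)
    then show "fibre Q \<one> \<in> {set_action real_group z P | z. z \<in> carrier real_group}" by auto
  qed
  finally show ?thesis .
qed

text \<open>Freeness makes the offset unique.\<close>

lemma translate_inj:
  assumes Q: "Q \<in> twhull" and e: "{t. t + a \<in> fibre Q \<one>} = {t. t + b \<in> fibre Q \<one>}"
  shows "a = b"
proof -
  have "set_action real_group (a - b) (fibre Q \<one>) = fibre Q \<one>"
  proof (rule Set.set_eqI)
    fix t
    have "t + (a - b) \<in> fibre Q \<one> \<longleftrightarrow> (t - b) + a \<in> fibre Q \<one>" by (simp add: algebra_simps)
    also have "\<dots> \<longleftrightarrow> (t - b) + b \<in> fibre Q \<one>" using e by blast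
    finally show "t \<in> set_action real_group (a - b) (fibre Q \<one>) \<longleftrightarrow> t \<in> fibre Q \<one>"
      by (simp add: mem_real_action)
  qed
  then have "a - b = 0"
    using free hull_fibre_one[OF Q] unfolding free_on_def by (metis UNIV_I real_group_simps(1,3))
  then show ?thesis by simp
qed

text \<open>The function on the group attached to a point of the hull: \<open>coc Q h\<close> is the offset of the fibre over
  \<open>h\<close>. It is well defined for \<open>Q\<close> in the hull and all of its translates.\<close>

definition coc :: "('g \<times> real) set \<Rightarrow> 'g \<Rightarrow> real" where
  "coc Q = (\<lambda>h\<in>carrier G. THE s. offset G Q h s)"

lemma coc_eqI:
  assumes "h \<in> carrier G" "offset G Q h s" "\<And>s'. offset G Q h s' \<Longrightarrow> s' = s"
  shows "coc Q h = s"
  unfolding coc_def restrict_apply'[OF assms(1)] using assms(2,3) by (rule the_equality)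

lemma offset_iff_coc:
  assumes Q: "Q \<in> twhull" and h: "h \<in> carrier G"
  shows "offset G Q h s \<longleftrightarrow> s = coc Q h"
proof -
  have u: "s = s'" if "offset G Q h s" "offset G Q h s'" for s s'
    using that by (intro translate_inj[OF Q]) (auto simp: offset_def)
  obtain s0 where s0: "offset G Q h s0" using hull_offset[OF Q h] by blast
  then have "coc Q h = s0" using u by (intro coc_eqI[OF h]) auto
  then show ?thesis using s0 u by auto
qed

lemma fibre_coc:
  assumes Q: "Q \<in> twhull" and h: "h \<in> carrier G"
  shows "fibre Q h = {t. t + coc Q h \<in> fibre Q \<one>}"
  using offset_iff_coc[OF Q h, of "coc Q h"] by (simp add: offset_def)

lemma coc_near:
  assumes Q: "Q \<in> twhull" and h: "h \<in> carrier G"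
  shows "\<bar>coc Q h - \<phi> h\<bar> \<le> D"
  using hull_offset[OF Q h] offset_iff_coc[OF Q h] by (auto simp: abs_le_iff)

lemma coc_one: "Q \<in> twhull \<Longrightarrow> coc Q \<one> = 0"
  using offset_iff_coc[of Q \<one> 0] by (simp add: offset_def)

lemma coc_space: "coc Q \<in> PiE (carrier G) (\<lambda>_. UNIV)"
  by (simp add: coc_def)

lemma coc_action:
  assumes Q: "Q \<in> twhull" and g: "g \<in> carrier G"
  shows "coc (set_action GR (g, r) Q) = shift G g (coc Q)"
proof (rule PiE_ext[OF coc_space shift_space])
  fix h assume h: "h \<in> carrier G"
  let ?Q = "set_action GR (g, r) Q"
  have f: "fibre ?Q k = {t. t + (r + coc Q (k \<otimes> g)) \<in> fibre Q \<one>}" if k: "k \<in> carrier G" for k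
    using fibre_action[OF hull_sub[OF Q] g k, of r] fibre_coc[OF Q, of "k \<otimes> g"] g k by (simp add: add.assoc)
  have o: "offset G ?Q h s \<longleftrightarrow> s = coc Q (h \<otimes> g) - coc Q g" for s
  proof -
    have "offset G ?Q h s \<longleftrightarrow> {t. t + (r + coc Q (h \<otimes> g)) \<in> fibre Q \<one>} = {t. t + (s + (r + coc Q g)) \<in> fibre Q \<one>}"
      unfolding offset_def f[OF h] f[OF one_closed] using g by (simp add: add.assoc)
    also have "\<dots> \<longleftrightarrow> r + coc Q (h \<otimes> g) = s + (r + coc Q g)"
      by (rule iffI, erule translate_inj[OF Q], simp only:)
    finally show ?thesis by auto
  qed
  have "coc ?Q h = coc Q (h \<otimes> g) - coc Q g"
    by (rule coc_eqI[OF h]) (auto simp: o)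
  then show "coc ?Q h = shift G g (coc Q) h" using h coc_one[OF Q] by (simp add: shift_def)
qed

lemma space_hull_borel: "space hullM = twhull"
proof -
  have "twhull \<subseteq> topspace (fell_topology cyl)"
    unfolding orbit_hull_def by (rule closure_of_subset_topspace)
  then show ?thesis
    by (auto simp: hull_borel_def borel_of_top_def space_measure_of_conv)
qed

lemma coc_measurable:
  "coc \<in> measurable hullM (fun_borel G)"
proof (rule measurable_PiM_single')
  show "coc \<in> space hullM \<rightarrow> (\<Pi>\<^sub>E i\<in>carrier G. space borel)"
    using coc_space by auto
  fix h assume h: "h \<in> carrier G"
  let ?X = "subtopology (fell_topology cyl) twhull"
  show "(\<lambda>Q. coc Q h) \<in> borel_measurable hullM"
    unfolding borel_measurable_iff_le
  proof
    fix a :: real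
    let ?S = "{Q. closedin cyl Q \<and> (\<exists>s\<in>{\<phi> h - D..a}. offset G Q h s)}"
    have "closedin (fell_topology cyl) ?S" by (rule closedin_offset[OF group_axioms h])
    then have "closedin ?X (twhull \<inter> ?S)" by (auto simp: closedin_subtopology)
    then have "openin ?X (topspace ?X - twhull \<inter> ?S)" by blast
    then have "topspace ?X - twhull \<inter> ?S \<in> sets hullM"
      unfolding hull_borel_def borel_of_top_def
    proof (intro in_measure_of CollectI)
      show "{U. openin ?X U} \<subseteq> Pow (topspace ?X)" using openin_subset by blast
    qed
    then have "space hullM - (topspace ?X - twhull \<inter> ?S) \<in>
        sets hullM" by (rule sets.compl_sets)
    also have "space hullM - (topspace ?X - twhull \<inter> ?S) = twhull \<inter> ?S"
      unfolding space_hull_borel using hull_closed by (auto simp: topspace_fell)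
    also have "twhull \<inter> ?S = {Q \<in> twhull. coc Q h \<le> a}"
    proof -
      have "(\<exists>s\<in>{\<phi> h - D..a}. offset G Q h s) \<longleftrightarrow> coc Q h \<le> a" if "Q \<in> twhull" for Q
        using offset_iff_coc[OF that h] coc_near[OF that h] by (auto simp: abs_le_iff)
      then show ?thesis using hull_closed by auto
    qed
    finally show "{Q \<in> space hullM. coc Q h \<le> a} \<in>
        sets hullM"
      unfolding space_hull_borel .
  qed
qed

end

section \<open>Reduction to the group\<close>

text \<open>Measurability of \<open>f\<close> is not needed: a push-forward along a map for which the preimage formula does
  not define a measure is zero.\<close>

lemma emeasure_self_distr:
  assumes d: "distr N M f = M" and M: "prob_space M" and B: "B \<in> sets M"
  shows "emeasure M B = emeasure N (f -` B \<inter> space N)"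
proof -
  interpret prob_space M by fact
  let ?ms = "measure_space (space M) (sigma_sets (space M) (sets M)) (\<lambda>A. emeasure N (f -` A \<inter> space N))"
  have e: "emeasure M A = (if A \<in> sigma_sets (space M) (sets M) \<and> ?ms then emeasure N (f -` A \<inter> space N) else 0)" for A
    using fun_cong[OF emeasure_measure_of_conv[of "space M" "sets M" "\<lambda>A. emeasure N (f -` A \<inter> space N)"], of A]
    unfolding distr_def[symmetric] d .
  have ?ms using e[of "space M"] emeasure_space_1 by (auto split: if_splits)
  then show ?thesis using e[of B] B by (simp add: sets.sigma_sets_eq)
qed

lemma discrete_measure_as_pmf:
  assumes q': "prob_space q'" "sets q' = sets (count_space A)" and A: "countable A"
  obtains q :: "'a pmf" where "set_pmf q \<subseteq> A"
    and "\<And>f :: 'a \<Rightarrow> real. integral\<^sup>L q' f = \<E> q f"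
    and "\<And>B. measure (measure_pmf q) B = measure q' (B \<inter> A)"
proof -
  interpret q': prob_space q' by fact
  have sq: "space q' = A" using sets_eq_imp_space_eq[OF q'(2)] by simp
  let ?M = "distr q' (count_space UNIV) (\<lambda>x. x)"
  have m: "(\<lambda>x. x) \<in> measurable q' (count_space UNIV)"
    by (subst measurable_cong_sets[OF q'(2) refl]) simp
  have meas: "measure ?M B = measure q' (B \<inter> A)" for B
    by (subst measure_distr[OF m]) (simp_all add: sq)
  have ae0: "AE x in q'. measure q' {x} \<noteq> 0"
  proof (rule AE_I')
    let ?N = "{x \<in> A. measure q' {x} = 0}"
    have "(\<Union>x\<in>?N. {x}) \<in> null_sets q'"
      by (rule null_sets_UN') (use A q'(2) in \<open>auto simp: null_sets_def q'.emeasure_eq_measure intro: countable_subset\<close>)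
    then show "?N \<in> null_sets q'" by simp
    show "{x \<in> space q'. \<not> measure q' {x} \<noteq> 0} \<subseteq> ?N" by (auto simp: sq)
  qed
  have ae: "AE x in ?M. measure ?M {x} \<noteq> 0"
  proof (subst AE_distr_iff[OF m])
    show "AE x in q'. measure ?M {x} \<noteq> 0"
      by (rule AE_mp[OF ae0], intro AE_I2 impI) (simp add: meas sq)
  qed simp
  have inv: "measure_pmf (Abs_pmf ?M) = ?M"
    by (rule Abs_pmf_inverse) (use q'.prob_space_distr[OF m] ae in auto)
  show ?thesis
  proof (rule that[of "Abs_pmf ?M"])
    show "measure (measure_pmf (Abs_pmf ?M)) B = measure q' (B \<inter> A)" for B unfolding inv by (rule meas)
    show "set_pmf (Abs_pmf ?M) \<subseteq> A"
    proof
      fix x assume "x \<in> set_pmf (Abs_pmf ?M)"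
      then have "measure ?M {x} \<noteq> 0" unfolding set_pmf.rep_eq inv by simp
      then show "x \<in> A" unfolding meas by (cases "x \<in> A") auto
    qed
    show "integral\<^sup>L q' f = \<E> (Abs_pmf ?M) f" for f :: "'a \<Rightarrow> real"
      unfolding inv by (subst integral_distr[OF m]) auto
  qed
qed

lemma integrable_pmf_summable:
  fixes f :: "'a \<Rightarrow> real"
  assumes "set_pmf q \<subseteq> A" "(\<lambda>a. pmf q a * \<bar>f a\<bar>) summable_on A"
  shows "integrable (measure_pmf q) f"
proof -
  have "(\<lambda>a. norm (pmf q a * f a)) summable_on A" using assms(2) by (simp add: abs_mult)
  then have "Infinite_Set_Sum.abs_summable_on (\<lambda>a. pmf q a * f a) A"
    using abs_summable_equivalent by blast
  also have "?this \<longleftrightarrow> Infinite_Set_Sum.abs_summable_on (\<lambda>a. pmf q a * f a) UNIV"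
    by (rule abs_summable_on_cong_neutral) (use assms(1) in \<open>auto simp: set_pmf_eq\<close>)
  finally have "integrable (count_space UNIV) (\<lambda>a. pmf q a *\<^sub>R f a)"
    by (simp add: Infinite_Set_Sum.abs_summable_on_def)
  then show ?thesis
    unfolding measure_pmf_eq_density by (subst integrable_density) auto
qed

lemma semigroup_generated_subset:
  assumes "group G" "S \<subseteq> carrier G"
  shows "semigroup_generated G S \<subseteq> carrier G"
proof
  interpret group G by fact
  fix x assume "x \<in> semigroup_generated G S"
  then show "x \<in> carrier G" by induction (use assms(2) in auto)
qed

text \<open>The step distribution on the group induced by a measure on the product with the line.\<close>

lemma push_to_group_walk:
  fixes G :: "('g, 'z) monoid_scheme"
  assumes G: "group G" and ctb: "countable (carrier G)"
    and p: "prob_space p" "sets p = sets (borel_of_top (cyl_topology G))"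
    and sym: "symmetric_measure (G \<times>\<times> real_group) p"
    and gen: "semigroup_generated (G \<times>\<times> real_group) (measure_support (cyl_topology G) p) =
           carrier (G \<times>\<times> real_group)"
  defines "q' \<equiv> push_to_group G p"
  shows "space p = carrier G \<times> UNIV"
    and "fst \<in> measurable p (count_space (carrier G))"
    and "prob_space q'" and "sets q' = sets (count_space (carrier G))"
    and "\<exists>q. symmetric_walk G q \<and> (\<forall>f :: 'g \<Rightarrow> real. integral\<^sup>L q' f = \<E> q f) \<and>
      (\<forall>g\<in>carrier G. pmf q g = measure q' {g})"
proof -
  interpret group G by fact
  interpret p: prob_space p by fact
  let ?T = "cyl_topology G"
  have sp: "space p = carrier G \<times> UNIV"
    using sets_eq_imp_space_eq[OF p(2)] by (simp add: borel_of_top_def topspace_cyl space_measure_of_conv)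
  have op: "U \<in> sets p" if "openin ?T U" for U
    unfolding p(2) borel_of_top_def
  proof (intro in_measure_of CollectI that)
    show "{U. openin ?T U} \<subseteq> Pow (topspace ?T)" using openin_subset by blast
  qed
  have rect: "A \<times> UNIV \<in> sets p" if "A \<subseteq> carrier G" for A
    by (rule op[OF openin_cyl[OF that]]) simp
  have fst: "fst \<in> measurable p (count_space (carrier G))"
  proof (rule measurableI)
    fix A assume "A \<in> sets (count_space (carrier G))"
    then have "A \<subseteq> carrier G" by simp
    moreover have "fst -` A \<inter> space p = (A \<inter> carrier G) \<times> UNIV" by (auto simp: sp)
    ultimately show "fst -` A \<inter> space p \<in> sets p" using rect[of "A \<inter> carrier G"] by simp
  qed (auto simp: sp)
  have q': "prob_space q'" "sets q' = sets (count_space (carrier G))"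
    using p.prob_space_distr[OF fst] by (simp_all add: q'_def push_to_group_def)
  interpret q': prob_space q' by fact
  show "space p = carrier G \<times> UNIV" "fst \<in> measurable p (count_space (carrier G))"
    "prob_space q'" "sets q' = sets (count_space (carrier G))" by fact+
  have mq: "measure q' A = measure p (A \<times> UNIV)" if "A \<subseteq> carrier G" for A
  proof -
    have "fst -` A \<inter> space p = A \<times> UNIV" using that by (auto simp: sp)
    then show ?thesis using that unfolding q'_def push_to_group_def by (simp add: measure_distr[OF fst])
  qed
  obtain q :: "'g pmf" where q: "set_pmf q \<subseteq> carrier G"
    and qE: "\<And>f :: 'g \<Rightarrow> real. integral\<^sup>L q' f = \<E> q f"
    and qm: "\<And>B. measure (measure_pmf q) B = measure q' (B \<inter> carrier G)"
    using discrete_measure_as_pmf[OF q' ctb] by blast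
  have pq: "pmf q g = measure q' {g}" if "g \<in> carrier G" for g
    using qm[of "{g}"] that by (simp add: measure_pmf_single)
  have inv2: "inv\<^bsub>G \<times>\<times> real_group\<^esub> (g, t) = (inv\<^bsub>G\<^esub> g, - t)" if "g \<in> carrier G" for g t
    using inv_DirProd[OF G group_real_group that, of t] by simp
  have symq: "map_pmf (m_inv G) q = q"
  proof (rule pmf_eqI)
    fix g
    show "pmf (map_pmf (m_inv G) q) g = pmf q g"
    proof (cases "g \<in> carrier G")
      case True
      have i: "m_inv G -` {g} \<inter> carrier G = {inv\<^bsub>G\<^esub> g}" using True by auto
      have "pmf (map_pmf (m_inv G) q) g = measure q' {inv\<^bsub>G\<^esub> g}"
        unfolding pmf_map qm i ..
      also have "\<dots> = measure p ({inv\<^bsub>G\<^esub> g} \<times> UNIV)" using True by (intro mq) auto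
      also have "\<dots> = measure p ((\<lambda>z. inv\<^bsub>G \<times>\<times> real_group\<^esub> z) -` ({g} \<times> UNIV) \<inter> space p)"
        using True by (intro arg_cong[where f="measure p"]) (auto simp: sp inv2)
      also have "\<dots> = measure p ({g} \<times> UNIV)"
        using emeasure_self_distr[OF sym[unfolded symmetric_measure_def] p(1) rect[of "{g}"]] True
        by (simp add: measure_def)
      also have "\<dots> = pmf q g" using True by (simp add: pq mq)
      finally show ?thesis .
    next
      case False
      then have "m_inv G -` {g} \<inter> carrier G = {}" by auto
      then have "pmf (map_pmf (m_inv G) q) g = 0" unfolding pmf_map qm by simp
      moreover have "pmf q g = 0" using False q by (auto simp: set_pmf_eq)
      ultimately show ?thesis by simp
    qed
  qed
  have genq: "semigroup_generated G (set_pmf q) = carrier G"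
  proof
    show "semigroup_generated G (set_pmf q) \<subseteq> carrier G" by (rule semigroup_generated_subset[OF G q])
    have "fst z \<in> semigroup_generated G (set_pmf q)"
      if "z \<in> semigroup_generated (G \<times>\<times> real_group) (measure_support ?T p)" for z
      using that
    proof induction
      case (incl z)
      obtain g t where z: "z = (g, t)" by (cases z)
      have g: "g \<in> carrier G" using incl by (auto simp: measure_support_def topspace_cyl z)
      have "openin ?T ({g} \<times> UNIV)" using g by (intro openin_cyl) auto
      then have "0 < emeasure p ({g} \<times> UNIV)" using incl by (auto simp: measure_support_def z)
      then have "pmf q g > 0" using g by (simp add: pq mq p.emeasure_eq_measure)
      then have "g \<in> set_pmf q" by (simp add: set_pmf_iff)
      then show ?case unfolding z fst_conv by (rule semigroup_generated.incl)
    next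
      case (mult x y)
      have "fst (x \<otimes>\<^bsub>G \<times>\<times> real_group\<^esub> y) = fst x \<otimes>\<^bsub>G\<^esub> fst y"
        by (cases x; cases y) (simp add: DirProd_def)
      with mult.IH show ?case by (simp add: semigroup_generated.mult)
    qed
    from this[of "(_, 0)"] show "carrier G \<subseteq> semigroup_generated G (set_pmf q)"
      unfolding gen by (auto simp: DirProd_def)
  qed
  have "symmetric_walk G q"
    by (intro symmetric_walk.intro G symmetric_walk_axioms.intro q symq genq)
  then show "\<exists>q. symmetric_walk G q \<and> (\<forall>f :: 'g \<Rightarrow> real. integral\<^sup>L q' f = \<E> q f) \<and>
      (\<forall>g\<in>carrier G. pmf q g = measure q' {g})"
    using qE pq by blast
qed

text \<open>Functions vanishing at the identity, each translate of which by the action \<open>shift\<close> is uniformly close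
  to \<open>\<phi>\<close>. Since all translates are constrained, the set is invariant.\<close>

definition near_functions :: "('g, 'z) monoid_scheme \<Rightarrow> ('g \<Rightarrow> real) \<Rightarrow> real \<Rightarrow> ('g \<Rightarrow> real) set" where
  "near_functions G \<phi> C = {u \<in> PiE (carrier G) (\<lambda>_. UNIV). u \<one>\<^bsub>G\<^esub> = 0 \<and>
     (\<forall>g\<in>carrier G. \<forall>h\<in>carrier G. \<bar>u (h \<otimes>\<^bsub>G\<^esub> g) - u g - \<phi> h\<bar> \<le> C)}"

context group
begin

lemma near_functions_shift:
  assumes u: "u \<in> near_functions G \<phi> C" and g: "g \<in> carrier G"
  shows "shift G g u \<in> near_functions G \<phi> C"
  using u g unfolding near_functions_def
  by (auto simp: shift_def m_assoc)

lemma near_functions_shift_measurable: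
  assumes g: "g \<in> carrier G"
  shows "shift G g \<in> measurable (restrict_space (fun_borel G) (near_functions G \<phi> C))
      (restrict_space (fun_borel G) (near_functions G \<phi> C))"
proof (rule measurable_restrict_space2)
  show "shift G g \<in> space (restrict_space (fun_borel G) (near_functions G \<phi> C)) \<rightarrow>
      near_functions G \<phi> C"
    using near_functions_shift[OF _ g] by (auto simp: space_restrict_space)
  show "shift G g \<in> measurable (restrict_space (fun_borel G) (near_functions G \<phi> C))
      (fun_borel G)"
    by (rule measurable_restrict_space1) (rule shift_measurable[OF g])
qed

end

text \<open>The line acts trivially on the functions \<open>coc Q\<close>, so that the image of a stationary measure on the hull is
  stationary for the image of \<open>p\<close> on the group.\<close>

lemma (in twisted_hull) coc_image_stationary:
  fixes p \<nu>
  assumes ctb: "countable (carrier G)"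
    and p: "prob_space p" and sp: "space p = carrier G \<times> UNIV"
    and fst: "fst \<in> measurable p (count_space (carrier G))"
    and \<nu>: "prob_space \<nu>" "sets \<nu> = sets hullM"
    and st: "stationary p \<nu> (set_action GR)"
  defines "N \<equiv> restrict_space (fun_borel G) (near_functions G \<phi> (3 * D))"
  shows "coc \<in> measurable \<nu> N"
    and "stationary (push_to_group G p) (distr \<nu> N coc) (shift G)"
proof -
  interpret p: prob_space p by fact
  interpret \<nu>: prob_space \<nu> by fact
  interpret pn: pair_prob_space p \<nu> ..
  let ?Y = "fun_borel G"
  let ?q = "push_to_group G p"
  have sn: "space \<nu> = twhull" using sets_eq_imp_space_eq[OF \<nu>(2)] by (simp add: space_hull_borel)
  have cY: "coc \<in> measurable \<nu> ?Y"
    using coc_measurable by (simp add: measurable_cong_sets[OF \<nu>(2) refl])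
  have near: "coc Q \<in> near_functions G \<phi> (3 * D)" if Q: "Q \<in> twhull" for Q
  proof -
    have "\<bar>coc Q (h \<otimes> g) - coc Q g - \<phi> h\<bar> \<le> 3 * D" if "g \<in> carrier G" "h \<in> carrier G" for g h
      using coc_near[OF Q, of "h \<otimes> g"] coc_near[OF Q that(1)] qm[OF that(2,1)] that by (auto simp: abs_le_iff)
    then show ?thesis using coc_space coc_one[OF Q] by (simp add: near_functions_def)
  qed
  show cN: "coc \<in> measurable \<nu> N"
    unfolding N_def by (rule measurable_restrict_space2) (use near cY sn in auto)
  let ?M = "distr \<nu> N coc"
  have sN: "space N = near_functions G \<phi> (3 * D)"
    by (auto simp: N_def space_restrict_space space_PiM near_functions_def)
  have shN: "shift G g \<in> measurable N N" if g: "g \<in> carrier G" for g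
    unfolding N_def by (rule near_functions_shift_measurable[OF g])
  have qs: "sets ?q = sets (count_space (carrier G))" by (simp add: push_to_group_def)
  have "(\<lambda>(g, u). shift G g u) \<in> measurable (count_space (carrier G) \<Otimes>\<^sub>M N) N"
    by (rule measurable_pair_measure_countable1[OF ctb]) (use shN in auto)
  then have am: "(\<lambda>(g, u). shift G g u) \<in> measurable (?q \<Otimes>\<^sub>M ?M) ?M"
    by (subst measurable_cong_sets[OF sets_pair_measure_cong[OF qs sets_distr] sets_distr])
  have prod: "?q \<Otimes>\<^sub>M ?M = distr (p \<Otimes>\<^sub>M \<nu>) (count_space (carrier G) \<Otimes>\<^sub>M N) (\<lambda>(z, Q). (fst z, coc Q))"
    unfolding push_to_group_def
    by (rule pair_measure_distr[OF fst cN]) (rule prob_space_imp_sigma_finite[OF \<nu>.prob_space_distr[OF cN]])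
  have pm: "(\<lambda>(z, Q). (fst z, coc Q)) \<in> measurable (p \<Otimes>\<^sub>M \<nu>) (count_space (carrier G) \<Otimes>\<^sub>M N)"
    using fst cN by measurable
  have key: "emeasure \<nu> B = emeasure (p \<Otimes>\<^sub>M \<nu>) ((\<lambda>(g, x). set_action GR g x) -` B \<inter> space (p \<Otimes>\<^sub>M \<nu>))"
    if "B \<in> sets \<nu>" for B
    by (rule emeasure_self_distr[OF st[unfolded stationary_def] \<nu>(1) that])
  \<comment> \<open>The pairs that the action map sends back into the hull form a measurable set of full measure.\<close>
  let ?S = "(\<lambda>(g, x). set_action GR g x) -` space \<nu> \<inter> space (p \<Otimes>\<^sub>M \<nu>)"
  have S1: "emeasure (p \<Otimes>\<^sub>M \<nu>) ?S = 1" using key[OF sets.top] \<nu>.emeasure_space_1 by simp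
  then have S: "?S \<in> sets (p \<Otimes>\<^sub>M \<nu>)" using emeasure_notin_sets by fastforce
  have SAE: "AE w in p \<Otimes>\<^sub>M \<nu>. w \<in> ?S"
    using S S1 pn.P.AE_in_set_eq_1[of ?S] by (simp add: pn.P.emeasure_eq_measure)
  show "stationary ?q ?M (shift G)"
    unfolding stationary_def
  proof (rule measure_eqI)
    fix A assume "A \<in> sets (distr (?q \<Otimes>\<^sub>M ?M) ?M (\<lambda>(g, x). shift G g x))"
    then have A: "A \<in> sets N" by simp
    define A' where "A' = (\<lambda>(g, u). shift G g u) -` A \<inter> space (count_space (carrier G) \<Otimes>\<^sub>M N)"
    have A'1: "A' = (\<lambda>(g, u). shift G g u) -` A \<inter> space (?q \<Otimes>\<^sub>M ?M)"
      by (simp add: A'_def space_pair_measure push_to_group_def)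
    have A's: "A' \<in> sets (count_space (carrier G) \<Otimes>\<^sub>M N)"
      unfolding A'_def using \<open>(\<lambda>(g, u). shift G g u) \<in> measurable (count_space (carrier G) \<Otimes>\<^sub>M N) N\<close> A
      by (rule measurable_sets)
    let ?B = "(\<lambda>(z, Q). (fst z, coc Q)) -` A' \<inter> space (p \<Otimes>\<^sub>M \<nu>)"
    have B: "?B \<in> sets (p \<Otimes>\<^sub>M \<nu>)" by (rule measurable_sets[OF pm A's])
    have cA: "coc -` A \<inter> space \<nu> \<in> sets \<nu>" by (rule measurable_sets[OF cN A])
    have "emeasure (distr (?q \<Otimes>\<^sub>M ?M) ?M (\<lambda>(g, x). shift G g x)) A = emeasure (?q \<Otimes>\<^sub>M ?M) A'"
      using emeasure_distr[OF am, of A] A A'1 by simp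
    also have "\<dots> = emeasure (p \<Otimes>\<^sub>M \<nu>) ?B" unfolding prod by (rule emeasure_distr[OF pm A's])
    also have "\<dots> = emeasure (p \<Otimes>\<^sub>M \<nu>) (?B \<inter> ?S)"
      by (rule emeasure_eq_AE) (use SAE B S in auto)
    also have "?B \<inter> ?S = (\<lambda>(g, x). set_action GR g x) -` (coc -` A \<inter> space \<nu>) \<inter> space (p \<Otimes>\<^sub>M \<nu>)"
    proof (rule Set.set_eqI)
      fix w :: "('g \<times> real) \<times> ('g \<times> real) set"
      obtain g t Q where w: "w = ((g, t), Q)" by (metis surj_pair)
      show "w \<in> ?B \<inter> ?S \<longleftrightarrow> w \<in> (\<lambda>(g, x). set_action GR g x) -` (coc -` A \<inter> space \<nu>) \<inter> space (p \<Otimes>\<^sub>M \<nu>)"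
      proof (cases "w \<in> space (p \<Otimes>\<^sub>M \<nu>)")
        case True
        then have g: "g \<in> carrier G" and Q: "Q \<in> twhull" by (auto simp: w space_pair_measure sp sn)
        have "(g, coc Q) \<in> space (count_space (carrier G) \<Otimes>\<^sub>M N)"
          using g near[OF Q] by (simp add: space_pair_measure sN)
        then show ?thesis using True by (auto simp: w A'_def coc_action[OF Q g])
      qed simp
    qed
    also have "emeasure (p \<Otimes>\<^sub>M \<nu>) \<dots> = emeasure \<nu> (coc -` A \<inter> space \<nu>)"
      by (rule key[OF cA, symmetric])
    also have "\<dots> = emeasure ?M A" by (rule emeasure_distr[OF cN A, symmetric])
    finally show "emeasure (distr (?q \<Otimes>\<^sub>M ?M) ?M (\<lambda>(g, x). shift G g x)) A = emeasure ?M A" .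
  qed simp
qed

section \<open>The boundary factor\<close>

theorem corollary1p5:
  fixes \<Gamma> :: "('g, 'z) monoid_scheme"
    and P :: "real set"
    and \<phi> :: "'g \<Rightarrow> real"
    and p :: "('g \<times> real) measure"
    and \<nu> :: "('g \<times> real) set measure"
    and m :: "'b measure"
    and actB :: "'g \<Rightarrow> 'b \<Rightarrow> 'b"
  assumes "group \<Gamma>" and "countable (carrier \<Gamma>)"
    and "closed P"
    and "free_on real_group (orbit_hull real_group euclideanreal P) (set_action real_group)"
    and "uniquely_ergodic real_group (hull_borel real_group euclideanreal P)
           (set_action real_group)"
    and "quasimorphism \<Gamma> \<phi>" and "\<phi> \<one>\<^bsub>\<Gamma>\<^esub> = 0"
    and "\<not> (\<exists>\<psi>\<in>hom \<Gamma> real_group. bounded_distance (carrier \<Gamma>) \<phi> \<psi>)"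
    and "prob_space p" and "sets p = sets (borel_of_top (cyl_topology \<Gamma>))"
    and "symmetric_measure (\<Gamma> \<times>\<times> real_group) p"
    and "absolutely_continuous (cyl_haar \<Gamma>) p"
    and "semigroup_generated (\<Gamma> \<times>\<times> real_group) (measure_support (cyl_topology \<Gamma>) p) =
           carrier (\<Gamma> \<times>\<times> real_group)"
    and "(\<lambda>\<gamma>. measure (push_to_group \<Gamma> p) {\<gamma>} * \<bar>\<phi> \<gamma>\<bar>) summable_on carrier \<Gamma>"
    and "poisson_boundary \<Gamma> (push_to_group \<Gamma> p) m actB"
    and "prob_space \<nu>"
    and "sets \<nu> = sets (hull_borel (\<Gamma> \<times>\<times> real_group) (cyl_topology \<Gamma>) (twist \<Gamma> P \<phi>))"
    and "stationary p \<nu> (set_action (\<Gamma> \<times>\<times> real_group))"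
  shows "\<exists>(\<eta> :: real measure) actY.
           boundary_of \<Gamma> m actB \<eta> actY \<and> \<not> trivial_boundary \<Gamma> \<eta> actY \<and>
           measurable_factor (\<Gamma> \<times>\<times> real_group) \<nu> (set_action (\<Gamma> \<times>\<times> real_group))
             \<eta> (\<lambda>(\<gamma>, t). actY \<gamma>)"
proof -
  note asm = assms
  interpret group \<Gamma> by fact
  obtain D where qm: "\<And>g h. g \<in> carrier \<Gamma> \<Longrightarrow> h \<in> carrier \<Gamma> \<Longrightarrow> \<bar>\<phi> (g \<otimes>\<^bsub>\<Gamma>\<^esub> h) - \<phi> g - \<phi> h\<bar> \<le> D"
    using asm(6) by (auto simp: quasimorphism_def)
  interpret twisted_hull \<Gamma> P \<phi> D
    by unfold_locales (use asm(3,4,7) qm in auto)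
  note walk = push_to_group_walk[OF asm(1,2,9,10,11,13)]
  obtain q where q: "symmetric_walk \<Gamma> q"
    and qE: "\<And>f :: 'g \<Rightarrow> real. integral\<^sup>L (push_to_group \<Gamma> p) f = \<E> q f"
    and qpmf: "\<And>g. g \<in> carrier \<Gamma> \<Longrightarrow> pmf q g = measure (push_to_group \<Gamma> p) {g}"
    using walk(5) by blast
  interpret symmetric_walk \<Gamma> q by fact
  have int: "integrable q \<phi>"
  proof (rule integrable_pmf_summable[OF supp])
    show "(\<lambda>a. pmf q a * \<bar>\<phi> a\<bar>) summable_on carrier \<Gamma>"
      using asm(14) by (rule summable_on_cong[THEN iffD1, rotated]) (simp add: qpmf)
  qed
  let ?Y = "fun_borel \<Gamma>"
  \<comment> \<open>The constant: \<open>coc Q (h g)\<close> and \<open>coc Q g\<close> are within \<open>D\<close> of the values of \<open>\<phi>\<close>, and \<open>\<phi> (h g)\<close> is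
    within \<open>D\<close> of \<open>\<phi> h + \<phi> g\<close>.\<close>
  define N where "N = restrict_space ?Y (near_functions \<Gamma> \<phi> (3 * D))"
  define M where "M = distr \<nu> N coc"
  interpret \<nu>: prob_space \<nu> by fact
  note img = coc_image_stationary[OF asm(2,9) walk(1,2) asm(16,17,18), folded N_def]
  interpret M: prob_space M unfolding M_def by (rule \<nu>.prob_space_distr[OF img(1)])
  have spM: "space M = near_functions \<Gamma> \<phi> (3 * D)"
    by (auto simp: M_def N_def space_restrict_space space_PiM near_functions_def)
  have sn: "space \<nu> = twhull" using sets_eq_imp_space_eq[OF asm(17)] by (simp add: space_hull_borel)
  have shM: "shift \<Gamma> g \<in> measurable M M" if g: "g \<in> carrier \<Gamma>" for g
    unfolding M_def N_def measurable_distr_eq1 measurable_distr_eq2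
    by (rule near_functions_shift_measurable[OF g])
  have evM: "(\<lambda>u. u g) \<in> borel_measurable M" if g: "g \<in> carrier \<Gamma>" for g
    unfolding M_def N_def measurable_distr_eq1
    by (rule measurable_restrict_space1) (rule measurable_component_singleton[OF g])
  have S: "stationary_space \<Gamma> q M (shift \<Gamma>)"
  proof (intro stationary_space.intro q M.prob_space_axioms stationary_space_axioms.intro shM)
    show "shift \<Gamma> (g \<otimes>\<^bsub>\<Gamma>\<^esub> h) u = shift \<Gamma> g (shift \<Gamma> h u)" if "g \<in> carrier \<Gamma>" "h \<in> carrier \<Gamma>" for g h u
      using that by (rule shift_mult)
    show "integral\<^sup>L M f = \<E> q (\<lambda>g. \<integral>x. f (shift \<Gamma> g x) \<partial>M)"
      if "f \<in> borel_measurable M" "\<And>x. x \<in> space M \<Longrightarrow> \<bar>f x :: real\<bar> \<le> K" for f K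
      using stationary_integral[OF img(2)[folded M_def] walk(3,4) asm(2) M.prob_space_axioms shM that]
      by (simp add: qE)
  qed
  then interpret S: stationary_space \<Gamma> q M "shift \<Gamma>" .
  interpret K: stationary_cocycle \<Gamma> q M "shift \<Gamma>" "\<lambda>g u. u g" \<phi> "3 * D" D
  proof (intro stationary_cocycle.intro S stationary_cocycle_axioms.intro evM qm int)
    fix g h u assume "g \<in> carrier \<Gamma>" "h \<in> carrier \<Gamma>" "u \<in> space M"
    then show "u (g \<otimes>\<^bsub>\<Gamma>\<^esub> h) = shift \<Gamma> h u g + u h"
      by (simp add: shift_def spM near_functions_def)
  next
    fix g u assume g: "g \<in> carrier \<Gamma>" and u: "u \<in> space M"
    have "\<bar>u (g \<otimes>\<^bsub>\<Gamma>\<^esub> \<one>\<^bsub>\<Gamma>\<^esub>) - u \<one>\<^bsub>\<Gamma>\<^esub> - \<phi> g\<bar> \<le> 3 * D"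
      using u g unfolding spM near_functions_def by blast
    then show "\<bar>u g - \<phi> g\<bar> \<le> 3 * D" using u g by (simp add: spM near_functions_def)
  qed
  obtain \<kappa> where \<kappa>: "\<kappa> \<in> borel_measurable M"
    and \<kappa>_b: "\<And>u. u \<in> space M \<Longrightarrow> \<bar>\<kappa> u\<bar> \<le> 3 * D + D + \<bar>\<phi> \<one>\<^bsub>\<Gamma>\<^esub>\<bar>"
    and \<kappa>_eq: "AE u in M. \<E> q (\<lambda>s. u s + \<kappa> (shift \<Gamma> s u) - \<kappa> u) = 0"
    using K.exists_transfer_function by blast
  \<comment> \<open>Adding the coboundary of \<open>\<kappa>\<close> makes the cocycle harmonic and keeps it near \<open>\<phi>\<close>.\<close>
  define d where "d g u = u g + \<kappa> (shift \<Gamma> g u) - \<kappa> u" for g u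
  let ?C = "3 * D + 2 * (3 * D + D + \<bar>\<phi> \<one>\<^bsub>\<Gamma>\<^esub>\<bar>)"
  have d_meas: "d g \<in> borel_measurable M" if "g \<in> carrier \<Gamma>" for g
    unfolding d_def using evM[OF that] S.act_comp_meas[OF \<kappa> that] \<kappa> by measurable
  have d_near: "\<bar>d g u - \<phi> g\<bar> \<le> ?C" if "g \<in> carrier \<Gamma>" "u \<in> space M" for g u
    using K.near[OF that] \<kappa>_b[OF S.act_space[OF that]] \<kappa>_b[OF that(2)] unfolding d_def abs_le_iff by auto
  have d_coc: "d (g \<otimes>\<^bsub>\<Gamma>\<^esub> h) u = d g (shift \<Gamma> h u) + d h u"
    if "g \<in> carrier \<Gamma>" "h \<in> carrier \<Gamma>" "u \<in> space M" for g h u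
    using K.cocycle[OF that] shift_mult[OF that(1,2), of u] by (simp add: d_def)
  have d_harm: "AE u in M. \<E> q (\<lambda>s. d s u) = 0"
    unfolding d_def by (rule \<kappa>_eq)
  interpret H: harmonic_cocycle \<Gamma> q M "shift \<Gamma>" d \<phi> ?C D
    by (intro harmonic_cocycle.intro stationary_cocycle.intro S stationary_cocycle_axioms.intro
        harmonic_cocycle_axioms.intro d_meas d_coc d_near qm int d_harm)
  interpret B: cocycle_and_boundary \<Gamma> q M "shift \<Gamma>" d \<phi> ?C D "push_to_group \<Gamma> p" m actB
    by (intro cocycle_and_boundary.intro H.harmonic_cocycle_axioms cocycle_and_boundary_axioms.intro
        walk(3,4) qE asm(2,15))
  obtain \<pi> where \<pi>: "\<pi> \<in> measurable m ?Y"
    and \<pi>_eq: "\<And>g b. g \<in> carrier \<Gamma> \<Longrightarrow> b \<in> space m \<Longrightarrow> \<pi> (actB g b) = shift \<Gamma> g (\<pi> b)"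
    and \<pi>_law: "distr m ?Y \<pi> = distr M ?Y (\<lambda>u. \<lambda>j\<in>carrier \<Gamma>. d j u)"
    using B.exists_boundary_map by blast
  define F where "F Q = (\<lambda>j\<in>carrier \<Gamma>. d j (coc Q))" for Q
  have dY: "(\<lambda>u. \<lambda>j\<in>carrier \<Gamma>. d j u) \<in> measurable M ?Y"
    by (rule measurable_restrict) (rule d_meas)
  have cM: "coc \<in> measurable \<nu> M" using img(1) by (simp add: M_def)
  have Fm: "F \<in> measurable \<nu> ?Y"
    unfolding F_def using measurable_compose[OF cM dY] .
  have cocM: "coc Q \<in> space M" if "Q \<in> twhull" for Q
    using measurable_space[OF cM] that sn by simp
  have law: "distr \<nu> ?Y F = distr m ?Y \<pi>"
  proof -
    have "sets M = sets N" unfolding M_def by (rule sets_distr)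
    then have "distr \<nu> M coc = distr \<nu> N coc" by (intro distr_cong refl)
    then have "distr M ?Y (\<lambda>u. \<lambda>j\<in>carrier \<Gamma>. d j u) = distr (distr \<nu> M coc) ?Y (\<lambda>u. \<lambda>j\<in>carrier \<Gamma>. d j u)"
      by (simp only: M_def[symmetric])
    also have "\<dots> = distr \<nu> ?Y F"
      by (subst distr_distr[OF dY cM]) (simp add: F_def[abs_def] comp_def)
    finally show ?thesis using \<pi>_law by simp
  qed
  show ?thesis
  proof (rule real_model_of_factor[OF asm(1,2) \<pi> \<pi>_eq Fm _ law])
    fix g t assume g: "g \<in> carrier \<Gamma>"
    show "AE Q in \<nu>. F (set_action GR (g, t) Q) = shift \<Gamma> g (F Q)"
    proof (rule AE_I2)
      fix Q assume "Q \<in> space \<nu>"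
      then have Q: "Q \<in> twhull" by (simp add: sn)
      have "d \<one>\<^bsub>\<Gamma>\<^esub> (coc Q) = 0"
        using d_coc[of "\<one>\<^bsub>\<Gamma>\<^esub>" "\<one>\<^bsub>\<Gamma>\<^esub>" "coc Q"] cocM[OF Q] shift_one[OF coc_space, of Q] by simp
      then show "F (set_action GR (g, t) Q) = shift \<Gamma> g (F Q)"
        using g d_coc[OF _ g cocM[OF Q]] by (auto simp: F_def shift_def[of _ _ "restrict _ _"] coc_action[OF Q g])
    qed
  next
    fix u assume u: "u \<in> PiE (carrier \<Gamma>) (\<lambda>_. UNIV)" and fixed: "\<And>g. g \<in> carrier \<Gamma> \<Longrightarrow> shift \<Gamma> g u = u"
    show "distr \<nu> ?Y F \<noteq> return ?Y u"
    proof
      assume ret: "distr \<nu> ?Y F = return ?Y u"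
      \<comment> \<open>The fixed function would be, up to a constant, a homomorphism at bounded distance from \<open>\<phi>\<close>.\<close>
      let ?A = "{v \<in> space ?Y. \<forall>g\<in>carrier \<Gamma>. \<bar>v g - \<phi> g\<bar> \<le> ?C}"
      have A: "?A \<in> sets ?Y"
      proof (rule sets.sets_Collect_countable_All'[OF _ asm(2)])
        fix g assume "g \<in> carrier \<Gamma>"
        then have [measurable]: "(\<lambda>v. v g) \<in> borel_measurable ?Y" by (rule measurable_component_singleton)
        show "{v \<in> space ?Y. \<bar>v g - \<phi> g\<bar> \<le> ?C} \<in> sets ?Y" by measurable
      qed
      have vA: "F -` ?A \<inter> space \<nu> = space \<nu>"
        using d_near cocM sn measurable_space[OF Fm] by (auto simp: F_def)
      have "indicator ?A u = emeasure (distr \<nu> ?Y F) ?A"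
        unfolding ret by (rule emeasure_return[OF A, symmetric])
      also have "\<dots> = emeasure \<nu> (F -` ?A \<inter> space \<nu>)" by (rule emeasure_distr[OF Fm A])
      also have "\<dots> = 1" unfolding vA by (rule \<nu>.emeasure_space_1)
      finally have "u \<in> ?A" by (cases "u \<in> ?A") simp_all
      then have near: "\<bar>u g - \<phi> g\<bar> \<le> ?C" if "g \<in> carrier \<Gamma>" for g using that by blast
      have "bounded_distance (carrier \<Gamma>) \<phi> (\<lambda>g. u g - u \<one>\<^bsub>\<Gamma>\<^esub>)"
        unfolding bounded_distance_def bounded_iff
      proof (intro exI[of _ "?C + \<bar>u \<one>\<^bsub>\<Gamma>\<^esub>\<bar>"] ballI)
        fix y assume "y \<in> (\<lambda>g. \<phi> g - (u g - u \<one>\<^bsub>\<Gamma>\<^esub>)) ` carrier \<Gamma>"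
        then obtain g where "g \<in> carrier \<Gamma>" "y = \<phi> g - (u g - u \<one>\<^bsub>\<Gamma>\<^esub>)" by blast
        then show "norm y \<le> ?C + \<bar>u \<one>\<^bsub>\<Gamma>\<^esub>\<bar>" using near[of g] by simp
      qed
      moreover have "(\<lambda>g. u g - u \<one>\<^bsub>\<Gamma>\<^esub>) \<in> hom \<Gamma> real_group" by (rule shift_fixed_hom[OF fixed])
      ultimately show False using asm(8) by blast
    qed
  qed
qed

end
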